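(* Let $X, Y$ be Polish spaces equipped with Borel probability measures $\mu$ and $\nu$, and let $c:X\times Y\to[0,\infty]$ be Borel measurable. Assume there exists a finite cost transport plan. (A) Let $(h_n)_{n}$ be measurable functions $h_n:X\times Y\to[0,\infty]$ such that each $h_n$ is $\mu\otimes\nu$-a.s. finite and $h_n\uparrow\infty$ uniformly. Then $P_{c\wedge h_n}\uparrow P^{\mathrm{rel}}_c$. (B) The following are equivalent: (i) there exist measurable $\varphi:X\to[-\infty,\infty)$ and $\psi:Y\to[-\infty,\infty)$ with $\varphi(x)+\psi(y)\le c(x,y)$ for all $x\in X, y\in Y$ and $P^{\mathrm{rel}}_c=D=J_c(\varphi,\psi)$; (ii) there exists a $\mu\otimes\nu$-a.s. finite measurable function $h:X\times Y\to[0,\infty]$ with $P^{\mathrm{rel}}_c=P_{c\wedge h}$.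
   Context: $\Pi(\mu,\nu)$ is the set of Borel probability measures on $X\times Y$ with marginals $\mu$ and $\nu$. For a Borel function $c':X\times Y\to[0,\infty]$, set $P_{c'}=\inf\{\int c'\,d\pi:\pi\in\Pi(\mu,\nu)\}$. A finite cost transport plan is some $\pi\in\Pi(\mu,\nu)$ with $\int c\,d\pi<\infty$. For $0\le\varepsilon\le1$, let $\Pi^{\varepsilon}(\mu,\nu)$ be the set of non-negative Borel measures $\pi$ on $X\times Y$ with $\pi(X\times Y)\ge1-\varepsilon$ whose marginals are dominated by $\mu$ and $\nu$ respectively. Set $P^{\mathrm{rel}}_c=\lim_{\varepsilon\to0}\inf\{\int c\,d\pi:\pi\in\Pi^\varepsilon(\mu,\nu)\}$. $D=\sup\{\int\varphi\,d\mu+\int\psi\,d\nu\}$, where the supremum runs over all integrable $\varphi:X\to[-\infty,\infty)$ and $\psi:Y\to[-\infty,\infty)$ with $\varphi(x)+\psi(y)\le c(x,y)$ everywhere. For measurable $\varphi,\psi$ with $\varphi(x)+\psi(y)\le c(x,y)$ everywhere, define $J_c(\varphi,\psi)=\int_{X\times Y}(\varphi(x)+\psi(y))\,d\pi(x,y)\in[-\infty,\infty)$, where $\pi$ is any finite cost transport plan. This value does not depend on the choice of $\pi$. $h_n\uparrow\infty$ uniformly means that $h_n\le h_{n+1}$ and, for every constant $m\in[0,\infty)$, $h_n\ge m$ everywhere for all sufficiently large $n$. *)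

theory Defs
  imports "HOL-Probability.Probability"
begin

definition couplings :: "'a::topological_space measure \<Rightarrow> 'b::topological_space measure \<Rightarrow> ('a \<times> 'b) measure set" where
  "couplings \<mu> \<nu> = {\<pi>. sets \<pi> = sets (borel :: ('a \<times> 'b) measure) \<and> prob_space \<pi> \<and>
      (\<forall>A \<in> sets (borel :: 'a measure). emeasure \<pi> (A \<times> UNIV) = emeasure \<mu> A) \<and>
      (\<forall>B \<in> sets (borel :: 'b measure). emeasure \<pi> (UNIV \<times> B) = emeasure \<nu> B)}"

definition Pcost :: "'a::topological_space measure \<Rightarrow> 'b::topological_space measure \<Rightarrow> ('a \<times> 'b \<Rightarrow> ennreal) \<Rightarrow> ennreal" where
  "Pcost \<mu> \<nu> c' = (INF \<pi> \<in> couplings \<mu> \<nu>. \<integral>\<^sup>+ z. c' z \<partial>\<pi>)"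

definition finite_cost_plan :: "'a::topological_space measure \<Rightarrow> 'b::topological_space measure \<Rightarrow> ('a \<times> 'b \<Rightarrow> ennreal) \<Rightarrow> ('a \<times> 'b) measure \<Rightarrow> bool" where
  "finite_cost_plan \<mu> \<nu> c \<pi> \<longleftrightarrow> \<pi> \<in> couplings \<mu> \<nu> \<and> (\<integral>\<^sup>+ z. c z \<partial>\<pi>) < \<infinity>"

definition partial_plans :: "'a::topological_space measure \<Rightarrow> 'b::topological_space measure \<Rightarrow> real \<Rightarrow> ('a \<times> 'b) measure set" where
  "partial_plans \<mu> \<nu> \<epsilon> = {\<pi>. sets \<pi> = sets (borel :: ('a \<times> 'b) measure) \<and>
      emeasure \<pi> UNIV \<ge> ennreal (1 - \<epsilon>) \<and>
      (\<forall>A \<in> sets (borel :: 'a measure). emeasure \<pi> (A \<times> UNIV) \<le> emeasure \<mu> A) \<and>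
      (\<forall>B \<in> sets (borel :: 'b measure). emeasure \<pi> (UNIV \<times> B) \<le> emeasure \<nu> B)}"

definition Peps :: "'a::topological_space measure \<Rightarrow> 'b::topological_space measure \<Rightarrow> ('a \<times> 'b \<Rightarrow> ennreal) \<Rightarrow> real \<Rightarrow> ennreal" where
  "Peps \<mu> \<nu> c \<epsilon> = (INF \<pi> \<in> partial_plans \<mu> \<nu> \<epsilon>. \<integral>\<^sup>+ z. c z \<partial>\<pi>)"

definition Prel :: "'a::topological_space measure \<Rightarrow> 'b::topological_space measure \<Rightarrow> ('a \<times> 'b \<Rightarrow> ennreal) \<Rightarrow> ennreal" where
  "Prel \<mu> \<nu> c = Lim (at_right 0) (Peps \<mu> \<nu> c)"

definition ereal_integrable :: "'a measure \<Rightarrow> ('a \<Rightarrow> ereal) \<Rightarrow> bool" where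
  "ereal_integrable M f \<longleftrightarrow> f \<in> borel_measurable M \<and> (AE x in M. \<bar>f x\<bar> \<noteq> \<infinity>) \<and>
      integrable M (\<lambda>x. real_of_ereal (f x))"

definition ereal_integral :: "'a measure \<Rightarrow> ('a \<Rightarrow> ereal) \<Rightarrow> ereal" where
  "ereal_integral M f = ereal (\<integral> x. real_of_ereal (f x) \<partial>M)"

definition admissible :: "('a \<times> 'b \<Rightarrow> ennreal) \<Rightarrow> ('a \<Rightarrow> ereal) \<Rightarrow> ('b \<Rightarrow> ereal) \<Rightarrow> bool" where
  "admissible c \<phi> \<psi> \<longleftrightarrow> (\<forall>x. \<phi> x < \<infinity>) \<and> (\<forall>y. \<psi> y < \<infinity>) \<and>
      (\<forall>x y. \<phi> x + \<psi> y \<le> enn2ereal (c (x, y)))"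

definition Dual :: "'a measure \<Rightarrow> 'b measure \<Rightarrow> ('a \<times> 'b \<Rightarrow> ennreal) \<Rightarrow> ereal" where
  "Dual \<mu> \<nu> c = (SUP (\<phi>, \<psi>) \<in> {(\<phi>, \<psi>). ereal_integrable \<mu> \<phi> \<and> ereal_integrable \<nu> \<psi> \<and> admissible c \<phi> \<psi>}.
      ereal_integral \<mu> \<phi> + ereal_integral \<nu> \<psi>)"

definition ereal_int_upper :: "'a measure \<Rightarrow> ('a \<Rightarrow> ereal) \<Rightarrow> ereal" where
  "ereal_int_upper M f = enn2ereal (\<integral>\<^sup>+ x. e2ennreal (f x) \<partial>M) - enn2ereal (\<integral>\<^sup>+ x. e2ennreal (- f x) \<partial>M)"

definition Jc :: "'a::topological_space measure \<Rightarrow> 'b::topological_space measure \<Rightarrow> ('a \<times> 'b \<Rightarrow> ennreal) \<Rightarrow> ('a \<Rightarrow> ereal) \<Rightarrow> ('b \<Rightarrow> ereal) \<Rightarrow> ereal" where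
  "Jc \<mu> \<nu> c \<phi> \<psi> = ereal_int_upper (SOME \<pi>. finite_cost_plan \<mu> \<nu> c \<pi>) (\<lambda>(x, y). \<phi> x + \<psi> y)"

end

theory Submission
  imports Defs
begin

text \<open>
  The core is a duality theorem: if \<open>c\<close> is finite \<open>\<mu> \<otimes> \<nu>\<close>-almost everywhere and has a plan of finite
  cost, then its transport cost is at most the supremum of \<open>\<integral>\<phi> d\<mu> + \<integral>\<psi> d\<nu>\<close> over bounded Borel
  potentials with \<open>\<phi> + \<psi> \<le> c\<close>, and a limit of such potentials is optimal.

  For costs taking finitely many values on a rectangle partition, plans come from Hahn--Banach
  functionals, which are countably additive because the marginals are inner regular. To reach Borel
  costs one uses that the dual value is continuous along decreasing sequences: almost everywhere
  finiteness on the product bounds normalized potentials from above, the finite plan bounds them from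
  below, and near-minimizers of \<open>\<integral>exp \<phi> + \<integral>exp \<psi>\<close> (suitably weighted) converge almost everywhere.
  Choquet's capacitability argument then produces a plan for \<open>c\<close>.

  Bounded potentials below \<open>c\<close> never exceed the relaxed cost, so \<open>P (c \<and> h) \<le> P\<^sup>r\<^sup>e\<^sup>l\<close> whenever \<open>h\<close> is
  almost everywhere finite. The converse in the limit follows by restricting a plan to \<open>{c < m}\<close>. For
  the equivalence, optimal \<open>\<phi>, \<psi>\<close> give \<open>h = (\<phi> + \<psi>)\<^sup>+\<close>, and conversely the optimal potentials of
  \<open>c \<and> h\<close> are optimal for \<open>c\<close>.
\<close>

section \<open>Linear functionals below sublinear ones\<close>

text \<open>The obstacle is that \<open>c\<close> is merely Borel: lower semicontinuity, and with it
  weak compactness of plans, is not at hand, and a product-null set may carry all the mass of a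
  coupling. So the size of a truncation is judged by \<open>\<mu> \<Otimes>\<^sub>M \<nu>\<close>
  while costs are integrated under plans; the finite plan links the two, since it keeps potentials
  with bounded dual value from escaping to -\<infinity>. Increasing limits of costs are cheap: a
  whole increasing sequence is priced inside one sublinear functional, the resulting plan serves all
  its members, and monotone convergence finishes. Decreasing limits are the hard direction. There
  the limit pair is controlled only through the sum \<phi> + \<psi>: the two potentials need not be
  integrable separately and may be -\<infinity>, and the integral of the sum is recovered from
  two-sided truncations, whose dual values see the marginals alone. One compactness statement is
  used twice, with a decreasing sequence of costs for capacitability and with a constant one for
  optimal potentials.\<close>

lemma hahn_banach_functions:
  fixes V :: "('z \<Rightarrow> real) set" and p :: "('z \<Rightarrow> real) \<Rightarrow> real"
  assumes V0: "(\<lambda>_. 0) \<in> V"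
    and Vadd: "\<And>f g. f \<in> V \<Longrightarrow> g \<in> V \<Longrightarrow> (\<lambda>z. f z + g z) \<in> V"
    and Vscale: "\<And>a f. f \<in> V \<Longrightarrow> (\<lambda>z. a * f z) \<in> V"
    and sub: "\<And>f g. f \<in> V \<Longrightarrow> g \<in> V \<Longrightarrow> p (\<lambda>z. f z + g z) \<le> p f + p g"
    and hom: "\<And>a f. f \<in> V \<Longrightarrow> a > 0 \<Longrightarrow> p (\<lambda>z. a * f z) = a * p f"
  obtains \<Lambda> where "\<And>f. f \<in> V \<Longrightarrow> \<Lambda> f \<le> p f"
    and "\<And>f g. f \<in> V \<Longrightarrow> g \<in> V \<Longrightarrow> \<Lambda> (\<lambda>z. f z + g z) = \<Lambda> f + \<Lambda> g"
    and "\<And>a f. f \<in> V \<Longrightarrow> \<Lambda> (\<lambda>z. a * f z) = a * \<Lambda> f"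
proof -
  define sublin where "sublin q \<longleftrightarrow> (\<forall>f\<in>V. \<forall>g\<in>V. q (\<lambda>z. f z + g z) \<le> q f + q g) \<and>
      (\<forall>f\<in>V. \<forall>a>0. q (\<lambda>z. a * f z) = a * q f)" for q :: "('z \<Rightarrow> real) \<Rightarrow> real"
  \<comment> \<open>Functionals are pinned to 0 outside \<open>V\<close>; otherwise their values
    there could be lowered without end and no minimal element would exist. The order
    \<open>P\<close> below points downwards, so a maximal element in the sense of Zorn's lemma is a
    minimal sublinear functional.\<close>
  define A where "A = {q. sublin q \<and> (\<forall>f\<in>V. q f \<le> p f) \<and> (\<forall>f. f \<notin> V \<longrightarrow> q f = 0)}"
  define P where "P q q' \<longleftrightarrow> (\<forall>f. q' f \<le> q f)" for q q' :: "('z \<Rightarrow> real) \<Rightarrow> real"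
  have Vneg: "(\<lambda>z. - f z) \<in> V" if "f \<in> V" for f
    using Vscale[OF that, of "-1"] by simp
  have subD: "q (\<lambda>z. f z + g z) \<le> q f + q g" if "sublin q" "f \<in> V" "g \<in> V" for q f g
    using that(1)[unfolded sublin_def, THEN conjunct1, THEN bspec, OF that(2), THEN bspec, OF that(3)] .
  have homD: "q (\<lambda>z. a * f z) = a * q f" if "sublin q" "f \<in> V" "a > 0" for q f a
    using that(1)[unfolded sublin_def, THEN conjunct2, THEN bspec, OF that(2)] that(3) by blast
  have zero: "q (\<lambda>_. 0) = 0" if "sublin q" for q
    using homD[OF that V0, of 2] by simp
  have neg: "- q (\<lambda>z. - f z) \<le> q f" if "sublin q" "f \<in> V" for q f
  proof -
    have "q (\<lambda>z. f z + - f z) \<le> q f + q (\<lambda>z. - f z)"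
      by (rule subD[OF that Vneg[OF that(2)]])
    then show ?thesis using zero[OF that(1)] by simp
  qed
  have lower: "- p (\<lambda>z. - f z) \<le> q f" if "q \<in> A" "f \<in> V" for q f
    using neg[of q f] that Vneg[of f] unfolding A_def by force
  have "\<exists>m\<in>A. \<forall>a\<in>A. P m a \<longrightarrow> a = m"
  proof (rule predicate_Zorn)
    show "partial_order_on A (relation_of P A)"
      by (rule partial_order_on_relation_ofI) (auto simp: P_def intro: order_trans intro!: ext order.antisym)
  next
    fix C assume C: "C \<in> Chains (relation_of P A)"
    then have CA: "C \<subseteq> A" and tot: "\<And>q q'. q \<in> C \<Longrightarrow> q' \<in> C \<Longrightarrow> P q q' \<or> P q' q"
      unfolding Chains_def relation_of_def by auto
    show "\<exists>u\<in>A. \<forall>a\<in>C. P a u"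
    proof (cases "C = {}")
      case True
      define u where "u f = (if f \<in> V then p f else 0)" for f
      have "u \<in> A" using sub hom Vadd Vscale unfolding A_def sublin_def u_def by auto
      then show ?thesis using True by auto
    next
      case False
      define u where "u f = (INF q\<in>C. q f)" for f
      have bdd: "bdd_below ((\<lambda>q. q f) ` C)" if "f \<in> V" for f
        using lower[OF _ that] CA by (intro bdd_belowI2) blast
      have uout: "u f = 0" if "f \<notin> V" for f
      proof -
        have "(\<lambda>q. q f) ` C = (\<lambda>q. 0) ` C" using that CA unfolding A_def by (intro image_cong) auto
        then have "(\<lambda>q. q f) ` C = {0}" using False by auto
        then show ?thesis unfolding u_def by simp
      qed
      have ule: "u f \<le> q f" if "q \<in> C" for q f
      proof (cases "f \<in> V")
        case True then show ?thesis unfolding u_def using bdd that by (intro cINF_lower) auto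
      next
        case F: False then show ?thesis using uout that CA unfolding A_def by auto
      qed
      have "u (\<lambda>z. f z + g z) \<le> u f + u g" if "f \<in> V" "g \<in> V" for f g
      proof -
        have *: "u (\<lambda>z. f z + g z) \<le> q f + q' g" if qq: "q \<in> C" "q' \<in> C" for q q'
        proof -
          obtain r where r: "r \<in> C" "P q r" "P q' r" using tot[OF qq] qq unfolding P_def by auto
          have "u (\<lambda>z. f z + g z) \<le> r (\<lambda>z. f z + g z)" by (rule ule[OF r(1)])
          also have "\<dots> \<le> r f + r g" using r CA \<open>f \<in> V\<close> \<open>g \<in> V\<close> by (intro subD) (auto simp: A_def)
          also have "\<dots> \<le> q f + q' g" using r unfolding P_def by (intro add_mono) auto
          finally show ?thesis .
        qed
        have "u (\<lambda>z. f z + g z) - q f \<le> u g" if "q \<in> C" for q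
          unfolding u_def[of g] using False *[OF that] by (intro cINF_greatest) (auto simp: algebra_simps)
        then have "u (\<lambda>z. f z + g z) - u g \<le> u f"
          unfolding u_def[of f] using False by (intro cINF_greatest) (auto simp: algebra_simps)
        then show ?thesis by simp
      qed
      moreover have "u (\<lambda>z. a * f z) = a * u f" if "f \<in> V" "a > 0" for f a
      proof -
        \<comment> \<open>Stated for every positive scalar, because the opposite inequality is the
          instance \<open>1 / a\<close> applied to the function \<open>a * f\<close>.\<close>
        have ge: "a * u f \<le> u (\<lambda>z. a * f z)" if "f \<in> V" "a > 0" for f a
          unfolding u_def[of "\<lambda>z. a * f z"]
        proof (intro cINF_greatest)
          fix q assume q: "q \<in> C"
          then have "q (\<lambda>z. a * f z) = a * q f" using CA that by (intro homD) (auto simp: A_def)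
          then show "a * u f \<le> q (\<lambda>z. a * f z)" using ule[OF q, of f] that by simp
        qed (use False in auto)
        have "(1 / a) * u (\<lambda>z. a * f z) \<le> u (\<lambda>z. (1 / a) * (a * f z))"
          using ge[OF Vscale[OF that(1), of a], of "1 / a"] that by simp
        then have "u (\<lambda>z. a * f z) \<le> a * u f" using that by (simp add: field_simps)
        then show ?thesis using ge[OF that] by simp
      qed
      moreover have "u f \<le> p f" if "f \<in> V" for f
        using False ule[of _ f] CA that unfolding A_def by fastforce
      ultimately have "u \<in> A" using uout unfolding A_def sublin_def by auto
      then show ?thesis using ule unfolding P_def by blast
    qed
  qed
  then obtain q where qA: "q \<in> A" and min: "\<And>r. r \<in> A \<Longrightarrow> P q r \<Longrightarrow> r = q" by blast
  have qs: "sublin q" using qA unfolding A_def by auto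
  have qadd: "q (\<lambda>z. f z + g z) \<le> q f + q g" if "f \<in> V" "g \<in> V" for f g
    by (rule subD[OF qs that])
  have qhom: "q (\<lambda>z. a * f z) = a * q f" if "f \<in> V" "a \<ge> 0" for f a
    using that zero[OF qs] homD[OF qs] by (cases "a = 0") auto
  have odd: "q (\<lambda>z. - y z) = - q y" if y: "y \<in> V" for y
  proof -
    \<comment> \<open>The usual competitor against minimality: \<open>r\<close> is again sublinear
      and lies below \<open>q\<close>, hence equals \<open>q\<close>. Its value at the negative of
      \<open>y\<close>, tested with \<open>t = 1\<close>, then forces \<open>q\<close> to be odd,
      and an odd sublinear functional is linear.\<close>
    define r where "r f = (if f \<in> V then (INF t\<in>{0..}. q (\<lambda>z. f z + t * y z) - t * q y) else 0)" for f
    have low: "- q (\<lambda>z. - f z) \<le> q (\<lambda>z. f z + t * y z) - t * q y" if "f \<in> V" "t \<ge> 0" for f t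
    proof -
      have "q (\<lambda>z. (f z + t * y z) + - f z) \<le> q (\<lambda>z. f z + t * y z) + q (\<lambda>z. - f z)"
        by (intro qadd Vadd Vneg Vscale that y)
      then show ?thesis using qhom[OF y that(2)] by simp
    qed
    have rle: "r f \<le> q (\<lambda>z. f z + t * y z) - t * q y" if "f \<in> V" "t \<ge> 0" for f t
    proof -
      have "bdd_below ((\<lambda>t. q (\<lambda>z. f z + t * y z) - t * q y) ` {0..})"
        using low[OF that(1)] by (intro bdd_belowI2) auto
      then show ?thesis unfolding r_def using that by (auto intro!: cINF_lower)
    qed
    have rgr: "b \<le> r f" if "f \<in> V" "\<And>t. t \<ge> 0 \<Longrightarrow> b \<le> q (\<lambda>z. f z + t * y z) - t * q y" for f b
      unfolding r_def using that by (auto intro!: cINF_greatest)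
    have rq: "r f \<le> q f" if "f \<in> V" for f using rle[OF that, of 0] by simp
    have "r (\<lambda>z. f z + g z) \<le> r f + r g" if fg: "f \<in> V" "g \<in> V" for f g
    proof -
      have *: "r (\<lambda>z. f z + g z) \<le> (q (\<lambda>z. f z + s * y z) - s * q y) + (q (\<lambda>z. g z + t * y z) - t * q y)"
        if "s \<ge> 0" "t \<ge> 0" for s t
      proof -
        have "r (\<lambda>z. f z + g z) \<le> q (\<lambda>z. (f z + g z) + (s + t) * y z) - (s + t) * q y"
          using that fg by (intro rle Vadd) auto
        also have "(\<lambda>z. (f z + g z) + (s + t) * y z) = (\<lambda>z. (f z + s * y z) + (g z + t * y z))"
          by (auto simp: algebra_simps)
        also have "q \<dots> - (s + t) * q y \<le> (q (\<lambda>z. f z + s * y z) + q (\<lambda>z. g z + t * y z)) - (s + t) * q y"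
          using fg y by (intro diff_right_mono qadd Vadd Vscale) auto
        finally show ?thesis by (simp add: algebra_simps)
      qed
      have "r (\<lambda>z. f z + g z) - (q (\<lambda>z. f z + s * y z) - s * q y) \<le> r g" if "s \<ge> 0" for s
        using *[OF that] fg by (intro rgr) (auto simp: algebra_simps)
      then have "r (\<lambda>z. f z + g z) - r g \<le> r f"
        using fg by (intro rgr) (force simp: algebra_simps)+
      then show ?thesis by simp
    qed
    moreover have "r (\<lambda>z. a * f z) = a * r f" if "f \<in> V" "a > 0" for f a
    proof -
      have ge: "a * r f \<le> r (\<lambda>z. a * f z)" if f: "f \<in> V" and a: "a > 0" for f a
      proof (intro rgr Vscale f)
        fix t :: real assume t: "t \<ge> 0"
        have eq: "(\<lambda>z. a * f z + t * y z) = (\<lambda>z. a * (f z + (t / a) * y z))"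
          using a by (auto simp: algebra_simps)
        have "q (\<lambda>z. a * f z + t * y z) - t * q y = a * (q (\<lambda>z. f z + (t / a) * y z) - (t / a) * q y)"
          unfolding eq using a by (subst qhom[OF Vadd[OF f Vscale[OF y]]]) (auto simp: algebra_simps)
        also have "\<dots> \<ge> a * r f" using a t by (intro mult_left_mono rle f) auto
        finally show "a * r f \<le> q (\<lambda>z. a * f z + t * y z) - t * q y" .
      qed
      have "(1 / a) * r (\<lambda>z. a * f z) \<le> r (\<lambda>z. (1 / a) * (a * f z))"
        using ge[OF Vscale[OF that(1), of a], of "1 / a"] that by simp
      then have "r (\<lambda>z. a * f z) \<le> a * r f" using that by (simp add: field_simps)
      then show ?thesis using ge[OF that] by simp
    qed
    moreover have "r f \<le> p f" if "f \<in> V" for f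
      using rq[OF that] qA that unfolding A_def by force
    ultimately have "r \<in> A" unfolding A_def sublin_def by (auto simp: r_def)
    moreover have "P q r" using rq qA unfolding P_def A_def by (metis (mono_tags, lifting) mem_Collect_eq order_refl r_def)
    ultimately have "r = q" by (rule min)
    moreover have "r (\<lambda>z. - y z) \<le> q (\<lambda>z. - y z + 1 * y z) - 1 * q y" by (intro rle Vneg y) auto
    ultimately have "q (\<lambda>z. - y z) \<le> - q y" using zero[OF qs] by simp
    moreover have "- q y \<le> q (\<lambda>z. - y z)" using neg[OF qs Vneg[OF y]] by simp
    ultimately show ?thesis by simp
  qed
  show ?thesis
  proof
    show "q f \<le> p f" if "f \<in> V" for f using qA that unfolding A_def by auto
    show "q (\<lambda>z. f z + g z) = q f + q g" if fg: "f \<in> V" "g \<in> V" for f g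
    proof -
      have "q (\<lambda>z. - f z + - g z) \<le> q (\<lambda>z. - f z) + q (\<lambda>z. - g z)" by (intro qadd Vneg fg)
      moreover have "q (\<lambda>z. - f z + - g z) = - q (\<lambda>z. f z + g z)"
        using odd[OF Vadd[OF fg]] by (simp add: algebra_simps)
      ultimately show ?thesis using odd[OF fg(1)] odd[OF fg(2)] qadd[OF fg] by simp
    qed
    show "q (\<lambda>z. a * f z) = a * q f" if f: "f \<in> V" for a f
    proof (cases "a \<ge> 0")
      case False
      have "q (\<lambda>z. - ((- a) * f z)) = - q (\<lambda>z. (- a) * f z)" by (intro odd Vscale f)
      then show ?thesis using qhom[OF f, of "- a"] False by simp
    qed (use qhom f in auto)
  qed
qed

section \<open>Functions on finite rectangle partitions\<close>

definition bounded_borel :: "('a::topological_space \<Rightarrow> real) set" where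
  "bounded_borel = {\<phi>. \<phi> \<in> borel_measurable borel \<and> bounded (range \<phi>)}"

lemma bounded_borelI:
  "\<phi> \<in> borel_measurable borel \<Longrightarrow> (\<And>x. \<bar>\<phi> x\<bar> \<le> B) \<Longrightarrow> \<phi> \<in> bounded_borel"
  unfolding bounded_borel_def by (auto simp: bounded_iff)

lemma bounded_borel_measurable: "\<phi> \<in> bounded_borel \<Longrightarrow> \<phi> \<in> borel_measurable borel"
  unfolding bounded_borel_def by auto

lemma bounded_borelE:
  assumes "\<phi> \<in> bounded_borel" obtains B where "\<And>x. \<bar>\<phi> x\<bar> \<le> B"
  using assms unfolding bounded_borel_def by (auto simp: bounded_iff)

lemma bounded_borel_const: "(\<lambda>_. a) \<in> bounded_borel"
  by (rule bounded_borelI[where B = "\<bar>a\<bar>"]) auto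

lemma bounded_borel_scale: "\<phi> \<in> bounded_borel \<Longrightarrow> (\<lambda>x. a * \<phi> x) \<in> bounded_borel"
proof -
  assume \<phi>: "\<phi> \<in> bounded_borel"
  then obtain B where "\<And>x. \<bar>\<phi> x\<bar> \<le> B" using bounded_borelE by blast
  then have "\<bar>a * \<phi> x\<bar> \<le> \<bar>a\<bar> * B" for x by (simp add: abs_mult mult_left_mono)
  moreover have "\<phi> \<in> borel_measurable borel" by (rule bounded_borel_measurable[OF \<phi>])
  ultimately show ?thesis by (intro bounded_borelI) auto
qed

lemma bounded_borel_add:
  assumes "\<phi> \<in> bounded_borel" "\<psi> \<in> bounded_borel"
  shows "(\<lambda>x. \<phi> x + \<psi> x) \<in> bounded_borel"
proof -
  obtain B C where "\<And>x. \<bar>\<phi> x\<bar> \<le> B" "\<And>x. \<bar>\<psi> x\<bar> \<le> C" using bounded_borelE[OF assms(1)] bounded_borelE[OF assms(2)] by metis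
  then have "\<bar>\<phi> x + \<psi> x\<bar> \<le> B + C" for x by (meson abs_triangle_ineq add_mono order_trans)
  then show ?thesis using assms[THEN bounded_borel_measurable] by (intro bounded_borelI) auto
qed

lemma integrable_bounded_borel:
  fixes M :: "'a::topological_space measure"
  assumes M: "prob_space M" "sets M = sets borel" and "\<phi> \<in> bounded_borel"
  shows "integrable M \<phi>"
proof -
  interpret prob_space M by fact
  obtain B where "\<And>x. \<bar>\<phi> x\<bar> \<le> B" using bounded_borelE[OF assms(3)] by blast
  moreover have "\<phi> \<in> borel_measurable M"
    using bounded_borel_measurable[OF assms(3)] assms(2) by (simp cong: measurable_cong_sets)
  ultimately show ?thesis by (intro integrable_const_bound[where B = B]) auto
qed

section \<open>Inner regularity, for countably many Borel sets at once\<close>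

lemma compact_inner_approx:
  fixes M :: "'a::{second_countable_topology, complete_space} measure"
  assumes "finite_measure M" "sets M = sets borel" "B \<in> sets borel" "0 < (e::real)"
  shows "\<exists>K. compact K \<and> K \<subseteq> B \<and> emeasure M (B - K) \<le> ennreal e"
proof -
  interpret finite_measure M by fact
  have "emeasure M B = (SUP K\<in>{K. K \<subseteq> B \<and> compact K}. emeasure M K)"
    using assms(3) by (intro inner_regular) (use assms(2) in auto)
  then have "\<exists>K\<in>{K. K \<subseteq> B \<and> compact K}. emeasure M B < emeasure M K + ennreal e"
    using assms(4) emeasure_finite[of B] by (intro SUP_approx_ennreal) auto
  then obtain K where K: "K \<subseteq> B" "compact K" "emeasure M B < emeasure M K + ennreal e" by auto
  have "emeasure M (B - K) = emeasure M B - emeasure M K"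
    using K assms borel_compact[OF K(2)] by (intro emeasure_Diff) auto
  also have "\<dots> \<le> ennreal e"
    using K(3) by (auto simp: ennreal_minus_le_iff)
  finally show ?thesis using K by auto
qed

text \<open>For each \<open>n\<close> a compact set is chosen inside \<open>A n\<close> and another
  inside its complement, and \<open>L\<close> is the intersection of their unions. On
  \<open>L\<close> the set \<open>A n\<close> coincides with the compact set chosen inside it. The
  losses are \<open>e / 2 * (1/2)^Suc n\<close> twice for each \<open>n\<close>, which sums to
  \<open>e\<close>.\<close>

lemma compact_with_compact_traces:
  fixes M :: "'a::polish_space measure"
  assumes M: "finite_measure M" "sets M = sets borel"
    and A: "\<And>n::nat. A n \<in> sets borel" and e: "0 < (e::real)"
  obtains L where "compact L" "emeasure M (- L) \<le> ennreal e" "\<And>n. compact (L \<inter> A n)"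
proof -
  interpret finite_measure M by fact
  have "\<exists>K. compact K \<and> K \<subseteq> B \<and> emeasure M (B - K) \<le> ennreal (e / 2 * (1/2)^Suc n)"
    if "B \<in> sets borel" for B and n :: nat
    using e that by (intro compact_inner_approx M) auto
  then have "\<forall>n. \<exists>K. compact K \<and> K \<subseteq> A n \<and> emeasure M (A n - K) \<le> ennreal (e / 2 * (1/2)^Suc n)"
    "\<forall>n. \<exists>K. compact K \<and> K \<subseteq> - A n \<and> emeasure M (- A n - K) \<le> ennreal (e / 2 * (1/2)^Suc n)"
    using A by auto
  then obtain K K' where K: "\<And>n. compact (K n)" "\<And>n. K n \<subseteq> A n"
      "\<And>n. emeasure M (A n - K n) \<le> ennreal (e / 2 * (1/2)^Suc n)"
    and K': "\<And>n. compact (K' n)" "\<And>n. K' n \<subseteq> - A n"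
      "\<And>n. emeasure M (- A n - K' n) \<le> ennreal (e / 2 * (1/2)^Suc n)"
    by metis
  define L where "L = (\<Inter>n. K n \<union> K' n)"
  have Kb: "K n \<in> sets M" "K' n \<in> sets M" "A n \<in> sets M" for n
    using K(1) K'(1) A M(2) by (auto intro: borel_compact)
  have sp: "space M = UNIV" using M(2) sets_eq_imp_space_eq by fastforce
  have cl: "closed L" unfolding L_def using compact_imp_closed[OF K(1)] compact_imp_closed[OF K'(1)] by (intro closed_INT ballI closed_Un)
  have L: "compact L"
  proof -
    have "L = (K 0 \<union> K' 0) \<inter> L" unfolding L_def by auto
    then show ?thesis using compact_Int_closed[OF compact_Un[OF K(1) K'(1)] cl, of 0 0] by simp
  qed
  have Lc: "- L = (\<Union>n. (A n - K n) \<union> (- A n - K' n))"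
    unfolding L_def using K(2) K'(2) by blast
  have compl: "- A n \<in> sets M" for n using Kb(3)[of n] sp by (metis Compl_eq_Diff_UNIV sets.compl_sets)
  have "emeasure M (- L) \<le> (\<Sum>n. emeasure M ((A n - K n) \<union> (- A n - K' n)))"
    unfolding Lc using Kb compl by (intro emeasure_subadditive_countably) auto
  also have "\<dots> \<le> (\<Sum>n. ennreal (e * (1/2)^Suc n))"
  proof (rule suminf_le)
    fix n
    have "emeasure M ((A n - K n) \<union> (- A n - K' n)) \<le> emeasure M (A n - K n) + emeasure M (- A n - K' n)"
      using Kb compl by (intro emeasure_subadditive) auto
    also have "\<dots> \<le> ennreal (e / 2 * (1/2)^Suc n) + ennreal (e / 2 * (1/2)^Suc n)"
      by (intro add_mono K K')
    also have "\<dots> = ennreal (e * (1/2)^Suc n)"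
      using e by (subst ennreal_plus[symmetric]) (auto simp: field_simps)
    finally show "emeasure M ((A n - K n) \<union> (- A n - K' n)) \<le> ennreal (e * (1/2)^Suc n)" .
  qed auto
  also have "\<dots> = ennreal e"
  proof -
    have "(\<lambda>n. e * (1/2)^Suc n) sums (e * 1)" by (intro sums_mult power_half_series)
    then show ?thesis using e by (subst suminf_ennreal2) (auto simp: sums_iff)
  qed
  finally have "emeasure M (- L) \<le> ennreal e" .
  moreover have "compact (L \<inter> A n)" for n
  proof -
    have "L \<inter> A n = L \<inter> K n" unfolding L_def using K(2) K'(2) by blast
    then show ?thesis using L K(1) by (simp add: compact_Int)
  qed
  ultimately show ?thesis using L that by blast
qed

text \<open>A finite Borel partition of each factor is encoded by a labelling into the naturals with
  finite range. Labels make common refinements a matter of pairing numbers. The value type is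
  arbitrary so that sets (as predicates) and costs share the same closure lemmas.\<close>

definition rect_fun :: "('a::topological_space \<times> 'b::topological_space \<Rightarrow> 'c) \<Rightarrow> bool" where
  "rect_fun k \<longleftrightarrow> (\<exists>a b G. a \<in> borel \<rightarrow>\<^sub>M count_space (UNIV :: nat set) \<and> finite (range a) \<and>
      b \<in> borel \<rightarrow>\<^sub>M count_space (UNIV :: nat set) \<and> finite (range b) \<and>
      k = (\<lambda>z. G (a (fst z)) (b (snd z))))"

lemma rect_fun_altdef:
  "rect_fun k \<longleftrightarrow> (\<exists>a b G. a \<in> borel \<rightarrow>\<^sub>M count_space (UNIV :: nat set) \<and> finite (range a) \<and>
      b \<in> borel \<rightarrow>\<^sub>M count_space (UNIV :: nat set) \<and> finite (range b) \<and> (\<forall>x y. k (x, y) = G (a x) (b y)))"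
  unfolding rect_fun_def fun_eq_iff split_paired_All by simp

lemma rect_funI:
  assumes "a \<in> borel \<rightarrow>\<^sub>M count_space (UNIV :: nat set)" "finite (range a)"
    "b \<in> borel \<rightarrow>\<^sub>M count_space (UNIV :: nat set)" "finite (range b)"
    "\<And>x y. k (x, y) = G (a x) (b y)"
  shows "rect_fun k"
  unfolding rect_fun_def using assms by (intro exI[of _ a] exI[of _ b] exI[of _ G]) auto

lemma rect_funE:
  assumes "rect_fun k"
  obtains a b G where "a \<in> borel \<rightarrow>\<^sub>M count_space (UNIV :: nat set)" "finite (range a)"
    "b \<in> borel \<rightarrow>\<^sub>M count_space (UNIV :: nat set)" "finite (range b)"
    "\<And>x y. k (x, y) = G (a x) (b y)"
  using assms unfolding rect_fun_def by auto

lemma rect_fun_const: "rect_fun (\<lambda>_. v)"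
  by (rule rect_funI[of "\<lambda>_. 0" "\<lambda>_. 0" _ "\<lambda>_ _. v"]) auto

lemma rect_fun_compose: "rect_fun k \<Longrightarrow> rect_fun (\<lambda>z. H (k z))"
  unfolding rect_fun_def by force

text \<open>Pairing the labels of the two functions yields the common refinement of their
  partitions, on which both are constant.\<close>

lemma rect_fun_compose2:
  fixes k l :: "'a::topological_space \<times> 'b::topological_space \<Rightarrow> _"
  assumes "rect_fun k" "rect_fun l"
  shows "rect_fun (\<lambda>z. H (k z) (l z))"
proof -
  obtain a b G where 1: "a \<in> borel \<rightarrow>\<^sub>M count_space (UNIV :: nat set)" "finite (range a)"
    "b \<in> borel \<rightarrow>\<^sub>M count_space (UNIV :: nat set)" "finite (range b)" "\<And>x y. k (x, y) = G (a x) (b y)"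
    using assms(1) by (rule rect_funE) blast
  obtain a' b' G' where 2: "a' \<in> borel \<rightarrow>\<^sub>M count_space (UNIV :: nat set)" "finite (range a')"
    "b' \<in> borel \<rightarrow>\<^sub>M count_space (UNIV :: nat set)" "finite (range b')" "\<And>x y. l (x, y) = G' (a' x) (b' y)"
    using assms(2) by (rule rect_funE) blast
  have meas: "(\<lambda>x. prod_encode (f x, g x)) \<in> borel \<rightarrow>\<^sub>M count_space UNIV"
    if "f \<in> borel \<rightarrow>\<^sub>M count_space UNIV" "g \<in> borel \<rightarrow>\<^sub>M count_space UNIV" for f g :: "'x::topological_space \<Rightarrow> nat"
  proof -
    have "(\<lambda>x. (f x, g x)) \<in> borel \<rightarrow>\<^sub>M (count_space UNIV \<Otimes>\<^sub>M count_space UNIV)"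
      by (intro measurable_Pair that)
    then have "(\<lambda>x. (f x, g x)) \<in> borel \<rightarrow>\<^sub>M count_space UNIV"
      by (simp add: pair_measure_countable)
    then show ?thesis by (rule measurable_compose) auto
  qed
  have fin: "finite (range (\<lambda>x. prod_encode (f x, g x)))"
    if "finite (range f)" "finite (range g)" for f g :: "'x \<Rightarrow> nat"
    by (rule finite_subset[of _ "prod_encode ` (range f \<times> range g)"]) (use that in auto)
  show ?thesis
    by (rule rect_funI[OF meas[OF 1(1) 2(1)] fin[OF 1(2) 2(2)] meas[OF 1(3) 2(3)] fin[OF 1(4) 2(4)],
          of _ "\<lambda>i j. H (G (fst (prod_decode i)) (fst (prod_decode j))) (G' (snd (prod_decode i)) (snd (prod_decode j)))"])
       (simp add: 1 2)
qed

lemma rect_fun_Times: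
  assumes "A \<in> sets borel" "B \<in> sets borel"
  shows "rect_fun (\<lambda>z. z \<in> A \<times> B)"
proof (rule rect_funI[where G = "\<lambda>i j. i = 1 \<and> j = 1"])
  show "(\<lambda>x. if x \<in> A then 1 else 0) \<in> borel \<rightarrow>\<^sub>M count_space (UNIV :: nat set)"
    "(\<lambda>x. if x \<in> B then 1 else 0) \<in> borel \<rightarrow>\<^sub>M count_space (UNIV :: nat set)"
    using assms by (auto intro: measurable_If_set)
qed (auto intro: finite_subset[of _ "{0,1}"])

lemma rect_fun_finite_range:
  assumes "rect_fun k" shows "finite (range k)"
proof -
  obtain a b :: "_ \<Rightarrow> nat" and G where 1: "finite (range a)" "finite (range b)" "\<And>x y. k (x, y) = G (a x) (b y)"
    using assms by (rule rect_funE) blast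
  have "range k \<subseteq> (\<lambda>(i, j). G i j) ` (range a \<times> range b)"
    using 1(3) by (fastforce simp: image_iff)
  then show ?thesis using 1 by (meson finite_SigmaI finite_imageI finite_subset)
qed

lemma rect_fun_measurable:
  fixes k :: "'a::polish_space \<times> 'b::polish_space \<Rightarrow> 'c"
  assumes "rect_fun k" shows "k \<in> borel \<rightarrow>\<^sub>M count_space UNIV"
proof -
  obtain a b G where 1: "a \<in> borel \<rightarrow>\<^sub>M count_space (UNIV :: nat set)"
    "b \<in> borel \<rightarrow>\<^sub>M count_space (UNIV :: nat set)" "\<And>x y. k (x, y) = G (a x) (b y)"
    using assms by (rule rect_funE) blast
  have "(\<lambda>z. (a (fst z), b (snd z))) \<in> (borel \<Otimes>\<^sub>M borel) \<rightarrow>\<^sub>M (count_space UNIV \<Otimes>\<^sub>M count_space UNIV)"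
    using 1 by (intro measurable_Pair measurable_compose[OF measurable_fst] measurable_compose[OF measurable_snd])
  then have "(\<lambda>z. (a (fst z), b (snd z))) \<in> borel \<rightarrow>\<^sub>M count_space UNIV"
    by (simp add: pair_measure_countable borel_prod)
  then have "(\<lambda>z. (\<lambda>(i, j). G i j) (a (fst z), b (snd z))) \<in> borel \<rightarrow>\<^sub>M count_space UNIV"
    by (rule measurable_compose) auto
  moreover have "k = (\<lambda>z. (\<lambda>(i, j). G i j) (a (fst z), b (snd z)))" using 1(3) by (auto simp: fun_eq_iff)
  ultimately show ?thesis by simp
qed

section \<open>Couplings from positive functionals\<close>

locale polish_marginals = pair_prob_space \<mu> \<nu>
  for \<mu> :: "'a::polish_space measure" and \<nu> :: "'b::polish_space measure" +
  assumes sets_mu [measurable_cong]: "sets \<mu> = sets borel"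
    and sets_nu [measurable_cong]: "sets \<nu> = sets borel"
begin

abbreviation dual_value :: "('a \<Rightarrow> real) \<Rightarrow> ('b \<Rightarrow> real) \<Rightarrow> real" where
  "dual_value \<phi> \<psi> \<equiv> (\<integral>x. \<phi> x \<partial>\<mu>) + (\<integral>y. \<psi> y \<partial>\<nu>)"

lemma space_mu: "space \<mu> = UNIV" and space_nu: "space \<nu> = UNIV"
  using sets_mu sets_nu by (metis sets_eq_imp_space_eq space_borel)+

lemma integrable_mu: "\<phi> \<in> bounded_borel \<Longrightarrow> integrable \<mu> \<phi>"
  and integrable_nu: "\<psi> \<in> bounded_borel \<Longrightarrow> integrable \<nu> \<psi>"
  by (auto intro!: integrable_bounded_borel M1.prob_space_axioms M2.prob_space_axioms sets_mu sets_nu)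

lemma integral_sum_ge:
  assumes "\<phi> \<in> bounded_borel" "\<psi> \<in> bounded_borel" "\<And>x y. b \<le> \<phi> x + \<psi> y"
  shows "b \<le> dual_value \<phi> \<psi>"
proof -
  have "b - \<psi> y \<le> (\<integral>x. \<phi> x \<partial>\<mu>)" for y
    using assms(3)[of _ y] by (intro M1.integral_ge_const integrable_mu assms(1)) (auto simp: algebra_simps)
  then have "b - (\<integral>x. \<phi> x \<partial>\<mu>) \<le> (\<integral>y. \<psi> y \<partial>\<nu>)"
    by (intro M2.integral_ge_const integrable_nu assms(2)) (auto simp: algebra_simps)
  then show ?thesis by simp
qed

text \<open>\<open>Inf (T f)\<close> is the least price of dominating \<open>f\<close> by a sum of
  potentials plus a nonnegative multiple of some \<open>k j\<close>, where potentials cost their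
  integrals and each \<open>k j\<close> costs \<open>t\<close>. The dual hypothesis says exactly
  that this market has no arbitrage, so that the price is finite. A linear functional below the
  price has the right marginals and charges at most \<open>t\<close> for every
  \<open>k j\<close>.\<close>

lemma exists_functional_below:
  fixes k :: "nat \<Rightarrow> 'a \<times> 'b \<Rightarrow> real"
  assumes kb: "\<And>j. bounded (range (k j))" and k0: "\<And>j z. 0 \<le> k j z" and kinc: "\<And>z. incseq (\<lambda>j. k j z)"
    and dual: "\<And>j \<phi> \<psi>. \<phi> \<in> bounded_borel \<Longrightarrow> \<psi> \<in> bounded_borel \<Longrightarrow> (\<And>x y. \<phi> x + \<psi> y \<le> k j (x, y)) \<Longrightarrow>
        dual_value \<phi> \<psi> \<le> t"
  obtains \<Lambda> :: "('a \<times> 'b \<Rightarrow> real) \<Rightarrow> real"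
  where "\<And>f g. bounded (range f) \<Longrightarrow> bounded (range g) \<Longrightarrow> \<Lambda> (\<lambda>z. f z + g z) = \<Lambda> f + \<Lambda> g"
    and "\<And>a f. bounded (range f) \<Longrightarrow> \<Lambda> (\<lambda>z. a * f z) = a * \<Lambda> f"
    and "\<And>f. bounded (range f) \<Longrightarrow> (\<And>z. 0 \<le> f z) \<Longrightarrow> 0 \<le> \<Lambda> f"
    and "\<And>\<phi> \<psi>. \<phi> \<in> bounded_borel \<Longrightarrow> \<psi> \<in> bounded_borel \<Longrightarrow>
        \<Lambda> (\<lambda>z. \<phi> (fst z) + \<psi> (snd z)) = dual_value \<phi> \<psi>"
    and "\<And>j. \<Lambda> (k j) \<le> t"
proof -
  \<comment> \<open>The bounds on \<open>k j\<close> are built into the sublinear functional \<open>Inf (T f)\<close>; since \<open>k\<close> is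
    increasing, one index \<open>j\<close> at a time suffices for subadditivity.\<close>
  define T where "T f = {dual_value \<phi> \<psi> + l * t | \<phi> \<psi> l.
      \<phi> \<in> bounded_borel \<and> \<psi> \<in> bounded_borel \<and> l \<ge> 0 \<and>
      (\<exists>j. \<forall>x y. f (x, y) \<le> \<phi> x + \<psi> y + l * k j (x, y))}" for f
  have TI: "dual_value \<phi> \<psi> + l * t \<in> T f"
    if "\<phi> \<in> bounded_borel" "\<psi> \<in> bounded_borel" "l \<ge> 0" "\<And>x y. f (x, y) \<le> \<phi> x + \<psi> y + l * k j (x, y)"
    for f \<phi> \<psi> l j using that unfolding T_def by blast
  have TE: "\<exists>\<phi> \<psi> l j. a = dual_value \<phi> \<psi> + l * t \<and> \<phi> \<in> bounded_borel \<and>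
      \<psi> \<in> bounded_borel \<and> l \<ge> 0 \<and> (\<forall>x y. f (x, y) \<le> \<phi> x + \<psi> y + l * k j (x, y))" if "a \<in> T f" for a f
    using that unfolding T_def by blast
  \<comment> \<open>This is the absence of arbitrage. If \<open>l\<close> is positive, dividing the
    domination inequality by \<open>l\<close> exhibits a pair of potentials below
    \<open>k j\<close>, to which the dual bound applies; if \<open>l = 0\<close>, only the marginal
    integrals are involved.\<close>
  have lower: "b \<le> a" if a: "a \<in> T f" and b: "\<And>z. b \<le> f z" for a b f
  proof -
    obtain \<phi> \<psi> l j where *: "a = dual_value \<phi> \<psi> + l * t"
      "\<phi> \<in> bounded_borel" "\<psi> \<in> bounded_borel" "l \<ge> 0" "\<And>x y. f (x, y) \<le> \<phi> x + \<psi> y + l * k j (x, y)"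
      using TE[OF a] by blast
    show ?thesis
    proof (cases "l = 0")
      case True
      have "b \<le> \<phi> x + \<psi> y" for x y using *(5)[of x y] b[of "(x, y)"] True by simp
      then show ?thesis using * True integral_sum_ge[of \<phi> \<psi> b] by simp
    next
      case False
      then have l: "l > 0" using *(4) by simp
      have "dual_value (\<lambda>x. (1 / l) * (b + (-1) * \<phi> x)) (\<lambda>y. (- 1 / l) * \<psi> y) \<le> t"
      proof (rule dual)
        fix x y
        have "b - \<phi> x - \<psi> y \<le> k j (x, y) * l" using *(5)[of x y] b[of "(x, y)"] by (simp add: algebra_simps)
        then have "(b - \<phi> x - \<psi> y) / l \<le> k j (x, y)" using l by (simp add: pos_divide_le_eq)
        then show "1 / l * (b + - 1 * \<phi> x) + - 1 / l * \<psi> y \<le> k j (x, y)"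
          by (simp add: diff_divide_distrib)
      qed (intro bounded_borel_scale bounded_borel_add bounded_borel_const *)+
      moreover have "(\<integral>x. (1 / l) * (b + (-1) * \<phi> x) \<partial>\<mu>) = (b - (\<integral>x. \<phi> x \<partial>\<mu>)) / l"
        using integrable_mu[OF *(2)] by (simp add: M1.prob_space)
      ultimately have "(b - (\<integral>x. \<phi> x \<partial>\<mu>) - (\<integral>y. \<psi> y \<partial>\<nu>)) / l \<le> t" by (simp add: diff_divide_distrib)
      then have "b - (\<integral>x. \<phi> x \<partial>\<mu>) - (\<integral>y. \<psi> y \<partial>\<nu>) \<le> t * l"
        using l by (simp add: pos_divide_le_eq)
      then show ?thesis using *(1) by (simp add: algebra_simps)
    qed
  qed
  define p where "p f = Inf (T f)" for f
  have bdd: "bdd_below (T f)" if f: "bounded (range f)" for f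
  proof -
    obtain B where "\<And>z. \<bar>f z\<bar> \<le> B" using f by (auto simp: bounded_iff)
    then have "- B \<le> f z" for z by (meson abs_le_D2 minus_le_iff)
    then show ?thesis using lower[of _ f "- B"] by (intro bdd_belowI) blast
  qed
  have ub: "p f \<le> a" if "a \<in> T f" "bounded (range f)" for a f
    unfolding p_def by (intro cInf_lower bdd that)
  have nonempty: "T f \<noteq> {}" if f: "bounded (range f)" for f
  proof -
    obtain B where B: "\<And>z. \<bar>f z\<bar> \<le> B" using f by (auto simp: bounded_iff)
    have "dual_value (\<lambda>_. B) (\<lambda>_. 0) + 0 * t \<in> T f"
      by (rule TI[of _ _ _ _ "0"]) (use B in \<open>auto intro: bounded_borel_const abs_le_D1\<close>)
    then show ?thesis by blast
  qed
  have greatest: "b \<le> p f" if "bounded (range f)" "\<And>a. a \<in> T f \<Longrightarrow> b \<le> a" for b f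
    unfolding p_def using nonempty that by (intro cInf_greatest) auto
  have badd: "bounded (range (\<lambda>z. f z + g z))" if "bounded (range f)" "bounded (range g)" for f g :: "'a \<times> 'b \<Rightarrow> real"
    using that by (rule bounded_plus_comp)
  have bscale: "bounded (range (\<lambda>z. a * f z))" if "bounded (range f)" for f :: "'a \<times> 'b \<Rightarrow> real" and a
    using bounded_scaleR_comp[OF that, of a] by simp
  have sub: "p (\<lambda>z. f z + g z) \<le> p f + p g" if f: "bounded (range f)" and g: "bounded (range g)" for f g
  proof -
    have *: "p (\<lambda>z. f z + g z) \<le> a + b" if a: "a \<in> T f" and b: "b \<in> T g" for a b
    proof -
      obtain \<phi> \<psi> l j where 1: "a = dual_value \<phi> \<psi> + l * t"
        "\<phi> \<in> bounded_borel" "\<psi> \<in> bounded_borel" "l \<ge> 0" "\<And>x y. f (x, y) \<le> \<phi> x + \<psi> y + l * k j (x, y)"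
        using TE[OF a] by blast
      obtain \<phi>' \<psi>' l' j' where 2: "b = dual_value \<phi>' \<psi>' + l' * t"
        "\<phi>' \<in> bounded_borel" "\<psi>' \<in> bounded_borel" "l' \<ge> 0" "\<And>x y. g (x, y) \<le> \<phi>' x + \<psi>' y + l' * k j' (x, y)"
        using TE[OF b] by blast
      have "dual_value (\<lambda>x. \<phi> x + \<phi>' x) (\<lambda>y. \<psi> y + \<psi>' y) + (l + l') * t \<in> T (\<lambda>z. f z + g z)"
      proof (rule TI[of _ _ _ _ "max j j'"])
        fix x y
        have "l * k j (x, y) \<le> l * k (max j j') (x, y)" "l' * k j' (x, y) \<le> l' * k (max j j') (x, y)"
          using 1 2 by (auto intro!: mult_left_mono incseqD[OF kinc])
        then show "f (x, y) + g (x, y) \<le> \<phi> x + \<phi>' x + (\<psi> y + \<psi>' y) + (l + l') * k (max j j') (x, y)"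
          using 1(5)[of x y] 2(5)[of x y] by (simp add: algebra_simps)
      qed (use 1 2 in \<open>auto intro: bounded_borel_add\<close>)
      then have "p (\<lambda>z. f z + g z) \<le> dual_value (\<lambda>x. \<phi> x + \<phi>' x) (\<lambda>y. \<psi> y + \<psi>' y) + (l + l') * t"
        by (rule ub[OF _ badd[OF f g]])
      also have "\<dots> = a + b"
        using 1 2 by (simp add: integrable_mu integrable_nu algebra_simps)
      finally show ?thesis .
    qed
    have "p (\<lambda>z. f z + g z) - a \<le> p g" if "a \<in> T f" for a
      using *[OF that] by (intro greatest g) (auto simp: algebra_simps)
    then have "p (\<lambda>z. f z + g z) - p g \<le> p f"
      by (intro greatest f) (force simp: algebra_simps)
    then show ?thesis by simp
  qed
  have hom: "p (\<lambda>z. c * f z) = c * p f" if f: "bounded (range f)" and c: "c > 0" for c f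
  proof -
    have le: "p (\<lambda>z. c * f z) \<le> c * p f" if f: "bounded (range f)" and c: "c > 0" for c f
    proof -
      have "p (\<lambda>z. c * f z) / c \<le> p f"
      proof (intro greatest f)
        fix a assume "a \<in> T f"
        then obtain \<phi> \<psi> l j where 1: "a = dual_value \<phi> \<psi> + l * t"
          "\<phi> \<in> bounded_borel" "\<psi> \<in> bounded_borel" "l \<ge> 0" "\<And>x y. f (x, y) \<le> \<phi> x + \<psi> y + l * k j (x, y)"
          using TE by blast
        have "dual_value (\<lambda>x. c * \<phi> x) (\<lambda>y. c * \<psi> y) + (c * l) * t \<in> T (\<lambda>z. c * f z)"
        proof (rule TI[of _ _ _ _ "j"])
          fix x y
          have "c * f (x, y) \<le> c * (\<phi> x + \<psi> y + l * k j (x, y))" using c 1(5) by (intro mult_left_mono) auto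
          then show "c * f (x, y) \<le> c * \<phi> x + c * \<psi> y + c * l * k j (x, y)" by (simp add: algebra_simps)
        qed (use 1 c in \<open>auto intro: bounded_borel_scale\<close>)
        then have "p (\<lambda>z. c * f z) \<le> c * a"
          using ub[OF _ bscale[OF f]] 1(1) by (simp add: algebra_simps)
        then show "p (\<lambda>z. c * f z) / c \<le> a" using c by (simp add: field_simps)
      qed
      then show ?thesis using c by (simp add: field_simps)
    qed
    have "p (\<lambda>z. (1 / c) * (c * f z)) \<le> (1 / c) * p (\<lambda>z. c * f z)"
      using c by (intro le bscale f) auto
    then have "c * p f \<le> p (\<lambda>z. c * f z)" using c by (simp add: field_simps)
    then show ?thesis using le[OF f c] by simp
  qed
  obtain \<Lambda> where L: "\<And>f. f \<in> {f. bounded (range f)} \<Longrightarrow> \<Lambda> f \<le> p f"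
    "\<And>f g. f \<in> {f. bounded (range f)} \<Longrightarrow> g \<in> {f. bounded (range f)} \<Longrightarrow> \<Lambda> (\<lambda>z. f z + g z) = \<Lambda> f + \<Lambda> g"
    "\<And>a f. f \<in> {f. bounded (range f)} \<Longrightarrow> \<Lambda> (\<lambda>z. a * f z) = a * \<Lambda> f"
  proof (rule hahn_banach_functions[of "{f. bounded (range f)}" p])
    show "(\<lambda>_::'a \<times> 'b. 0::real) \<in> {f. bounded (range f)}" by (auto simp: image_constant_conv)
  qed (use sub hom badd bscale in auto)
  have Lneg: "\<Lambda> (\<lambda>z. - f z) = - \<Lambda> f" if "bounded (range f)" for f
    using L(3)[of f "-1"] that by simp
  have ble: "bounded (range (\<lambda>z. \<phi> (fst z) + \<psi> (snd z)))"
    if \<phi>: "\<phi> \<in> bounded_borel" and \<psi>: "\<psi> \<in> bounded_borel" for \<phi> :: "'a \<Rightarrow> real" and \<psi> :: "'b \<Rightarrow> real"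
  proof -
    have "bounded (range (\<lambda>z::'a \<times> 'b. \<phi> (fst z)))" "bounded (range (\<lambda>z::'a \<times> 'b. \<psi> (snd z)))"
      using \<phi> \<psi> unfolding bounded_borel_def by (auto simp: bounded_iff)
    then show ?thesis by (rule badd)
  qed
  have le: "\<Lambda> (\<lambda>z. \<phi> (fst z) + \<psi> (snd z)) \<le> dual_value \<phi> \<psi>"
    if \<phi>: "\<phi> \<in> bounded_borel" and \<psi>: "\<psi> \<in> bounded_borel" for \<phi> \<psi>
  proof -
    have "dual_value \<phi> \<psi> + 0 * t \<in> T (\<lambda>z. \<phi> (fst z) + \<psi> (snd z))"
      using \<phi> \<psi> by (intro TI[of _ _ _ _ "0"]) auto
    then have "p (\<lambda>z. \<phi> (fst z) + \<psi> (snd z)) \<le> dual_value \<phi> \<psi>"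
      using ub[OF _ ble[OF \<phi> \<psi>]] by simp
    then show ?thesis using L(1)[of "\<lambda>z. \<phi> (fst z) + \<psi> (snd z)"] ble[OF \<phi> \<psi>] by simp
  qed
  show ?thesis
  proof
    show "0 \<le> \<Lambda> f" if f: "bounded (range f)" "\<And>z. 0 \<le> f z" for f
    proof -
      have bn: "bounded (range (\<lambda>z. - f z))" using bscale[OF f(1), of "-1"] by simp
      have "dual_value (\<lambda>_. 0) (\<lambda>_. 0) + 0 * t \<in> T (\<lambda>z. - f z)"
        using f(2) by (intro TI[of _ _ _ _ "0"]) (auto intro: bounded_borel_const)
      then have "p (\<lambda>z. - f z) \<le> 0" using ub[OF _ bn] by simp
      then have "\<Lambda> (\<lambda>z. - f z) \<le> 0" using L(1)[of "\<lambda>z. - f z"] bn by simp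
      then show ?thesis using Lneg[OF f(1)] by simp
    qed
    show "\<Lambda> (\<lambda>z. \<phi> (fst z) + \<psi> (snd z)) = dual_value \<phi> \<psi>"
      if \<phi>: "\<phi> \<in> bounded_borel" and \<psi>: "\<psi> \<in> bounded_borel" for \<phi> \<psi>
    proof -
      \<comment> \<open>Domination by the price gives one inequality; the negated pair of potentials
        gives the other.\<close>
      have "\<Lambda> (\<lambda>z. (-1) * \<phi> (fst z) + (-1) * \<psi> (snd z)) \<le> dual_value (\<lambda>x. (-1) * \<phi> x) (\<lambda>y. (-1) * \<psi> y)"
        by (intro le bounded_borel_scale \<phi> \<psi>)
      then have "\<Lambda> (\<lambda>z. - (\<phi> (fst z) + \<psi> (snd z))) \<le> - (\<integral>x. \<phi> x \<partial>\<mu>) - (\<integral>y. \<psi> y \<partial>\<nu>)"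
        by (simp add: algebra_simps)
      then show ?thesis using le[OF \<phi> \<psi>] Lneg[OF ble[OF \<phi> \<psi>]] by simp
    qed
    show "\<Lambda> (k j) \<le> t" for j
    proof -
      have "dual_value (\<lambda>_. 0) (\<lambda>_. 0) + 1 * t \<in> T (k j)"
        by (intro TI[of _ _ _ _ "j"]) (auto intro: bounded_borel_const)
      then have "p (k j) \<le> t" using ub[OF _ kb] by simp
      then show ?thesis using L(1)[of "k j"] kb by simp
    qed
  qed (use L in auto)
qed


text \<open>\<open>\<Lambda>\<close> gives only a finitely additive set function on finite unions of
  rectangles. Continuity at the empty set, which Caratheodory's theorem asks for, is inherited from
  the marginals, since these are countably additive and tight. The integral formula concerns
  rectangle functions only: on other bounded functions \<open>\<Lambda>\<close> and the extended
  measure may disagree.\<close>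

lemma coupling_of_functional:
  fixes \<Lambda> :: "('a \<times> 'b \<Rightarrow> real) \<Rightarrow> real"
  assumes add: "\<And>f g. bounded (range f) \<Longrightarrow> bounded (range g) \<Longrightarrow> \<Lambda> (\<lambda>z. f z + g z) = \<Lambda> f + \<Lambda> g"
    and scale: "\<And>a f. bounded (range f) \<Longrightarrow> \<Lambda> (\<lambda>z. a * f z) = a * \<Lambda> f"
    and pos: "\<And>f. bounded (range f) \<Longrightarrow> (\<And>z. 0 \<le> f z) \<Longrightarrow> 0 \<le> \<Lambda> f"
    and marg: "\<And>\<phi> \<psi>. \<phi> \<in> bounded_borel \<Longrightarrow> \<psi> \<in> bounded_borel \<Longrightarrow>
        \<Lambda> (\<lambda>z. \<phi> (fst z) + \<psi> (snd z)) = dual_value \<phi> \<psi>"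
  obtains \<pi> where "\<pi> \<in> couplings \<mu> \<nu>"
    and "\<And>k. rect_fun k \<Longrightarrow> (\<And>z. 0 \<le> k z) \<Longrightarrow> (\<integral>\<^sup>+z. ennreal (k z) \<partial>\<pi>) = ennreal (\<Lambda> k)"
proof -
  have bI: "bounded (range f)" if "\<And>z. \<bar>f z\<bar> \<le> B" for f :: "'a \<times> 'b \<Rightarrow> real" and B
    using that by (auto simp: bounded_iff)
  have bind: "bounded (range (indicat_real E))" for E :: "('a \<times> 'b) set"
    by (rule bI[of _ 1]) (auto simp: indicator_def)
  have mono: "\<Lambda> f \<le> \<Lambda> g" if "bounded (range f)" "bounded (range g)" "\<And>z. f z \<le> g z" for f g
  proof -
    have m1: "bounded (range (\<lambda>z. (-1) * f z))" using bounded_scaleR_comp[OF that(1), of "-1"] by simp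
    have "0 \<le> \<Lambda> (\<lambda>z. g z + (-1) * f z)"
      using that by (intro pos bounded_plus_comp m1) auto
    also have "\<dots> = \<Lambda> g + (-1) * \<Lambda> f"
      using add[OF that(2) m1] scale[OF that(1), of "-1"] by simp
    finally show ?thesis by simp
  qed
  define R where "R = {E :: ('a \<times> 'b) set. rect_fun (\<lambda>z. z \<in> E)}"
  define m where "m E = ennreal (\<Lambda> (indicator E))" for E
  have m_nonneg: "0 \<le> \<Lambda> (indicator E)" for E by (intro pos bind) auto
  have RI: "E \<in> R" if "rect_fun (\<lambda>z. z \<in> E)" for E using that unfolding R_def by simp
  have alg: "algebra UNIV R"
    unfolding algebra_iff_Un
  proof (intro conjI ballI)
    show "{} \<in> R" by (rule RI) (simp add: rect_fun_const)
    show "UNIV - E \<in> R" if "E \<in> R" for E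
      using that rect_fun_compose[of "\<lambda>z. z \<in> E" Not] unfolding R_def by simp
    show "E \<union> F \<in> R" if "E \<in> R" "F \<in> R" for E F
      using that rect_fun_compose2[of "\<lambda>z. z \<in> E" "\<lambda>z. z \<in> F" "(\<or>)"] unfolding R_def by simp
  qed auto
  then interpret A: algebra UNIV R .
  have R_borel: "E \<in> sets borel" if "E \<in> R" for E
  proof -
    have "{z \<in> space borel. z \<in> E} \<in> sets borel"
      using rect_fun_measurable[of "\<lambda>z. z \<in> E"] that unfolding R_def by (intro predE) simp
    then show ?thesis by simp
  qed
  have R_Times: "A \<times> B \<in> R" if "A \<in> sets borel" "B \<in> sets borel" for A B
    by (intro RI rect_fun_Times that)
  have sigma_R: "sigma_sets UNIV R = sets borel"
  proof
    show "sigma_sets UNIV R \<subseteq> sets borel"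
      using R_borel sets.sigma_sets_subset[of R borel] by auto
    have "sets (borel :: ('a \<times> 'b) measure) = sigma_sets UNIV {a \<times> b |a b. a \<in> sets borel \<and> b \<in> sets borel}"
      unfolding borel_prod[symmetric] sets_pair_measure by simp
    also have "\<dots> \<subseteq> sigma_sets UNIV R"
      by (rule sigma_sets_mono') (auto intro: R_Times)
    finally show "sets borel \<subseteq> sigma_sets UNIV R" .
  qed
  have marg1: "\<Lambda> (indicator (A \<times> UNIV)) = measure \<mu> A" if A: "A \<in> sets borel" for A
  proof -
    have "\<Lambda> (\<lambda>z. indicator A (fst z) + 0) = dual_value (indicator A) (\<lambda>_. 0)"
      using A by (intro marg bounded_borelI[of _ 1] bounded_borel_const) auto
    moreover have "(\<lambda>z::'a \<times> 'b. indicat_real A (fst z) + 0) = indicator (A \<times> UNIV)"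
      by (auto simp: indicator_def fun_eq_iff)
    ultimately show ?thesis using A by (simp add: sets_mu space_mu)
  qed
  have marg2: "\<Lambda> (indicator (UNIV \<times> B)) = measure \<nu> B" if B: "B \<in> sets borel" for B
  proof -
    have "\<Lambda> (\<lambda>z. 0 + indicator B (snd z)) = dual_value (\<lambda>_. 0) (indicator B)"
      using B by (intro marg bounded_borelI[of _ 1] bounded_borel_const) auto
    moreover have "(\<lambda>z::'a \<times> 'b. 0 + indicat_real B (snd z)) = indicator (UNIV \<times> B)"
      by (auto simp: indicator_def fun_eq_iff)
    ultimately show ?thesis using B by (simp add: sets_nu space_nu)
  qed
  have positive: "positive R m"
  proof -
    have "indicat_real {} = (\<lambda>z::'a \<times> 'b. 0 * indicator {} z)" by (simp add: fun_eq_iff)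
    then have "\<Lambda> (indicator {}) = 0" using scale[OF bind[of "{}"], of 0] by simp
    then show ?thesis by (simp add: positive_def m_def)
  qed
  have additive: "additive R m"
    unfolding additive_def
  proof (intro ballI impI)
    fix E F assume "E \<in> R" "F \<in> R" "E \<inter> F = {}"
    then have "indicat_real (E \<union> F) = (\<lambda>z. indicator E z + indicator F z)"
      by (auto simp: fun_eq_iff indicator_def)
    then show "m (E \<union> F) = m E + m F"
      using add[OF bind[of E] bind[of F]] m_nonneg by (simp add: m_def ennreal_plus)
  qed
  \<comment> \<open>Up to small marginal mass, \<open>E i\<close> lives on a product \<open>L \<times> M\<close> of compact sets on which all
    its rectangles have compact trace, so the finite intersection property applies.\<close>
  have cont: "(\<lambda>i. m (E i)) \<longlonglongrightarrow> 0"
    if E: "range E \<subseteq> R" "decseq E" "(\<Inter>i. E i) = {}" for E :: "nat \<Rightarrow> ('a \<times> 'b) set"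
  proof -
    have dec: "m (E j) \<le> m (E i)" if "i \<le> j" for i j
      unfolding m_def using decseqD[OF E(2) that]
      by (intro ennreal_leI mono bind) (auto simp: indicator_def)
    have "\<forall>i. \<exists>a b G. a \<in> borel \<rightarrow>\<^sub>M count_space (UNIV :: nat set) \<and> finite (range a) \<and>
        b \<in> borel \<rightarrow>\<^sub>M count_space (UNIV :: nat set) \<and> finite (range b) \<and>
        (\<forall>x y. ((x, y) \<in> E i) = G (a x) (b y))"
    proof
      fix i have "rect_fun (\<lambda>z. z \<in> E i)" using E(1) unfolding R_def by auto
      then show "\<exists>a b G. a \<in> borel \<rightarrow>\<^sub>M count_space (UNIV :: nat set) \<and> finite (range a) \<and>
        b \<in> borel \<rightarrow>\<^sub>M count_space (UNIV :: nat set) \<and> finite (range b) \<and>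
        (\<forall>x y. ((x, y) \<in> E i) = G (a x) (b y))"
        unfolding rect_fun_altdef .
    qed
    then obtain a b G where a: "\<And>i. a i \<in> borel \<rightarrow>\<^sub>M count_space (UNIV :: nat set)" "\<And>i. finite (range (a i))"
      and b: "\<And>i. b i \<in> borel \<rightarrow>\<^sub>M count_space (UNIV :: nat set)" "\<And>i. finite (range (b i))"
      and G: "\<And>i x y. ((x, y) \<in> E i) = G i (a i x) (b i y)"
      by metis
    have am: "{x. a i x = n} \<in> sets borel" for i n
      using measurable_sets[OF a(1), of "{n}" i] by (simp add: vimage_def)
    have bm: "{y. b i y = n} \<in> sets borel" for i n
      using measurable_sets[OF b(1), of "{n}" i] by (simp add: vimage_def)
    have small: "\<exists>i. m (E i) \<le> ennreal (2 * e)" if e: "0 < e" for e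
    proof -
      \<comment> \<open>The pairing of \<open>i\<close> with a label \<open>n\<close> lists all
        level sets of all labellings in one sequence, so a single \<open>L\<close> serves every
        \<open>E i\<close>.\<close>
      obtain L where L: "compact L" "emeasure \<mu> (- L) \<le> ennreal e"
        "\<And>n. compact (L \<inter> {x. a (fst (prod_decode n)) x = snd (prod_decode n)})"
        using compact_with_compact_traces[OF M1.finite_measure_axioms sets_mu, of
            "\<lambda>n. {x. a (fst (prod_decode n)) x = snd (prod_decode n)}" e] am e by blast
      obtain M where M: "compact M" "emeasure \<nu> (- M) \<le> ennreal e"
        "\<And>n. compact (M \<inter> {y. b (fst (prod_decode n)) y = snd (prod_decode n)})"
        using compact_with_compact_traces[OF M2.finite_measure_axioms sets_nu, of
            "\<lambda>n. {y. b (fst (prod_decode n)) y = snd (prod_decode n)}" e] bm e by blast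
      have La: "compact (L \<inter> {x. a i x = n})" for i n using L(3)[of "prod_encode (i, n)"] by simp
      have Mb: "compact (M \<inter> {y. b i y = n})" for i n using M(3)[of "prod_encode (i, n)"] by simp
      have comp: "compact (E i \<inter> L \<times> M)" for i
      proof -
        \<comment> \<open>\<open>I\<close> holds the label pairs that make up \<open>E i\<close>;
          thus the trace of \<open>E i\<close> on \<open>L \<times> M\<close> is a finite union of
          products of compact traces.\<close>
        define I where "I = {r \<in> range (a i) \<times> range (b i). G i (fst r) (snd r)}"
        define F where "F r = (L \<inter> {x. a i x = fst r}) \<times> (M \<inter> {y. b i y = snd r})" for r
        have "E i \<inter> L \<times> M = (\<Union>r\<in>I. F r)"
        proof (intro subset_antisym subsetI)
          fix z assume z: "z \<in> E i \<inter> L \<times> M"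
          obtain x y where xy: "z = (x, y)" by (cases z)
          have "(a i x, b i y) \<in> I" using z G[of _ _ i] by (simp add: I_def xy)
          moreover have "z \<in> F (a i x, b i y)" using z by (simp add: F_def xy)
          ultimately show "z \<in> (\<Union>r\<in>I. F r)" by blast
        next
          fix z assume "z \<in> (\<Union>r\<in>I. F r)"
          then obtain r where r: "r \<in> I" "z \<in> F r" by blast
          obtain x y where xy: "z = (x, y)" by (cases z)
          show "z \<in> E i \<inter> L \<times> M" using r G[of _ _ i] by (simp add: F_def I_def xy)
        qed
        moreover have "finite I"
          unfolding I_def using a(2)[of i] b(2)[of i] by simp
        moreover have "compact (F r)" for r unfolding F_def by (intro compact_Times La Mb)
        ultimately show ?thesis using compact_UN[of I F] by simp
      qed
      have "\<exists>i. E i \<inter> L \<times> M = {}"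
      proof (rule ccontr)
        assume ne: "\<not> ?thesis"
        have "E 0 \<inter> L \<times> M \<inter> (\<Inter>i. E i \<inter> L \<times> M) \<noteq> {}"
        proof (rule compact_imp_fip_image[OF comp])
          show "closed (E i \<inter> L \<times> M)" for i by (intro compact_imp_closed comp)
          show "E 0 \<inter> L \<times> M \<inter> (\<Inter>i\<in>I. E i \<inter> L \<times> M) \<noteq> {}" if I: "finite I" for I
          proof -
            define N where "N = Max (insert 0 I)"
            have "i \<le> N" if "i \<in> insert 0 I" for i unfolding N_def using I that by (intro Max_ge) auto
            then have "E N \<subseteq> E i" if "i \<in> insert 0 I" for i
              using decseqD[OF E(2), of i N] that by auto
            moreover obtain z where z: "z \<in> E N \<inter> L \<times> M"
              using ne unfolding ex_in_conv[symmetric] by blast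
            ultimately have "z \<in> E i" if "i \<in> insert 0 I" for i
              using that by auto
            then have "z \<in> E 0 \<inter> L \<times> M \<inter> (\<Inter>i\<in>I. E i \<inter> L \<times> M)" using z by simp
            then show ?thesis unfolding ex_in_conv[symmetric] by (rule exI)
          qed
        qed
        then show False using E(3) by blast
      qed
      then obtain i where i: "E i \<inter> L \<times> M = {}" by blast
      \<comment> \<open>Points whose label does not occur on \<open>L\<close>; in particular they
        lie outside \<open>L\<close>. Since membership in \<open>E i\<close> depends on labels only,
        a point of \<open>E i\<close> outside both strips would have a twin in \<open>E i\<close>
        inside \<open>L \<times> M\<close>, which is impossible.\<close>
      define A' where "A' = {x. a i x \<notin> a i ` L}"
      define B' where "B' = {y. b i y \<notin> b i ` M}"
      have A': "A' \<in> sets borel"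
        using measurable_sets[OF a(1)[of i], of "- (a i ` L)"] by (simp add: A'_def vimage_def)
      have B': "B' \<in> sets borel"
        using measurable_sets[OF b(1)[of i], of "- (b i ` M)"] by (simp add: B'_def vimage_def)
      have sub: "(x, y) \<in> A' \<times> UNIV \<union> UNIV \<times> B'" if "(x, y) \<in> E i" for x y
      proof (rule ccontr)
        assume "\<not> ?thesis"
        then obtain x' y' where "x' \<in> L" "a i x = a i x'" "y' \<in> M" "b i y = b i y'"
          unfolding A'_def B'_def by auto
        then have "(x', y') \<in> E i \<inter> L \<times> M" using that G by auto
        then show False using i by auto
      qed
      have mA: "measure \<mu> A' \<le> e"
      proof -
        have "emeasure \<mu> A' \<le> emeasure \<mu> (- L)"
          using compact_imp_closed[OF L(1)] by (intro emeasure_mono) (auto simp: A'_def sets_mu)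
        then have "emeasure \<mu> A' \<le> ennreal e" using L(2) by simp
        then show ?thesis using e by (simp add: M1.emeasure_eq_measure)
      qed
      have mB: "measure \<nu> B' \<le> e"
      proof -
        have "emeasure \<nu> B' \<le> emeasure \<nu> (- M)"
          using compact_imp_closed[OF M(1)] by (intro emeasure_mono) (auto simp: B'_def sets_nu)
        then have "emeasure \<nu> B' \<le> ennreal e" using M(2) by simp
        then show ?thesis using e by (simp add: M2.emeasure_eq_measure)
      qed
      have "\<Lambda> (indicator (E i)) \<le> \<Lambda> (\<lambda>z. indicator (A' \<times> UNIV) z + indicator (UNIV \<times> B') z)"
        using sub by (intro mono bind bounded_plus_comp) (fastforce simp: indicator_def)
      also have "\<dots> = measure \<mu> A' + measure \<nu> B'"
        using add[OF bind bind] marg1[OF A'] marg2[OF B'] by simp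
      finally have "\<Lambda> (indicator (E i)) \<le> 2 * e" using mA mB by simp
      then show ?thesis unfolding m_def by (auto intro: ennreal_leI)
    qed
    show ?thesis
    proof (rule order_tendstoI)
      fix v :: ennreal assume v: "0 < v"
      then obtain e where e: "0 < e" "ennreal e < v"
        by (metis ennreal_less_zero_iff ennreal_rat_dense)
      obtain i where "m (E i) \<le> ennreal (2 * (e / 2))" using small[of "e / 2"] e by auto
      then have "m (E j) < v" if "i \<le> j" for j using dec[OF that] e by simp
      then show "\<forall>\<^sub>F i in sequentially. m (E i) < v" by (auto simp: eventually_sequentially)
    qed simp
  qed
  have "\<exists>m'. (\<forall>s\<in>R. m' s = m s) \<and> measure_space UNIV (sigma_sets UNIV R) m'"
  proof (rule A.caratheodory_empty_continuous[OF positive additive])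
    show "m E \<noteq> \<infinity>" for E by (simp add: m_def)
  qed (rule cont)
  then obtain m' where m': "\<And>s. s \<in> R \<Longrightarrow> m' s = m s" "measure_space UNIV (sigma_sets UNIV R) m'"
    by blast
  define \<pi> where "\<pi> = measure_of UNIV R m'"
  have sets_pi: "sets \<pi> = sets borel" unfolding \<pi>_def using sigma_R by simp
  have em: "emeasure \<pi> E = ennreal (\<Lambda> (indicator E))" if "E \<in> R" for E
  proof -
    have "emeasure \<pi> E = m' E"
      using m'(2) that R_borel[OF that] sets_pi unfolding measure_space_def
      by (intro emeasure_measure_of[OF \<pi>_def]) (auto simp: sigma_R)
    then show ?thesis using m'(1)[OF that] by (simp add: m_def)
  qed
  have UNIVR: "UNIV \<in> R" using A.top .
  have sp: "space \<pi> = UNIV" using sets_eq_imp_space_eq[OF sets_pi] by simp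
  have c1: "emeasure \<pi> (A \<times> UNIV) = emeasure \<mu> A" if "A \<in> sets borel" for A
    using em[OF R_Times[OF that, of UNIV]] marg1[OF that] by (simp add: M1.emeasure_eq_measure)
  have c2: "emeasure \<pi> (UNIV \<times> B) = emeasure \<nu> B" if "B \<in> sets borel" for B
    using em[OF R_Times[OF _ that, of UNIV]] marg2[OF that] by (simp add: M2.emeasure_eq_measure)
  have "prob_space \<pi>"
    using c1[of UNIV] M1.emeasure_space_1 by (intro prob_spaceI) (simp add: sp space_mu)
  then have "\<pi> \<in> couplings \<mu> \<nu>" using c1 c2 sets_pi unfolding couplings_def by auto
  moreover have "(\<integral>\<^sup>+z. ennreal (k z) \<partial>\<pi>) = ennreal (\<Lambda> k)" if k: "rect_fun k" "\<And>z. 0 \<le> k z" for k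
  proof -
    have fin: "finite (range k)" using rect_fun_finite_range[OF k(1)] .
    have lev: "k -` {v} \<in> R" for v
      by (rule RI) (use rect_fun_compose[OF k(1), of "\<lambda>u. u = v"] in simp)
    have rep: "k z = (\<Sum>v\<in>range k. v * indicator (k -` {v}) z)" for z
    proof -
      have "(\<Sum>v\<in>range k. v * indicator (k -` {v}) z) = (\<Sum>v\<in>{k z}. v * indicator (k -` {v}) z)"
        using fin by (intro sum.mono_neutral_right) (auto simp: indicator_def)
      then show ?thesis by simp
    qed
    \<comment> \<open>Boundedness of the partial sums is carried through the induction because
      additivity of \<open>\<Lambda>\<close> is known for bounded functions only.\<close>
    have Lsum: "\<Lambda> (\<lambda>z. \<Sum>v\<in>V. v * indicator (k -` {v}) z) = (\<Sum>v\<in>V. v * \<Lambda> (indicator (k -` {v})))"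
      and bsum: "bounded (range (\<lambda>z. \<Sum>v\<in>V. v * indicat_real (k -` {v}) z))" if "finite V" for V
      using that
    proof (induction V)
      case empty
      { case 1 show ?case using scale[OF bind[of "{}"], of 0] by simp }
      { case 2 show ?case by (rule bI[of _ 0]) simp }
    next
      case (insert v V)
      have b: "bounded (range (\<lambda>z. v * indicat_real (k -` {v}) z))"
        using bounded_scaleR_comp[OF bind, of v] by simp
      { case 1 show ?case by (simp only: sum.insert[OF insert.hyps] add[OF b insert.IH(2)] scale[OF bind] insert.IH(1)) }
      { case 2 show ?case using bounded_plus_comp[OF b insert.IH(2)] by (simp only: sum.insert[OF insert.hyps]) }
    qed
    have "(\<integral>\<^sup>+z. ennreal (k z) \<partial>\<pi>) = (\<integral>\<^sup>+z. (\<Sum>v\<in>range k. ennreal v * indicator (k -` {v}) z) \<partial>\<pi>)"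
    proof (rule nn_integral_cong)
      fix z
      have "(\<Sum>v\<in>range k. ennreal v * indicator (k -` {v}) z) = (\<Sum>v\<in>{k z}. ennreal v * indicator (k -` {v}) z)"
        using fin by (intro sum.mono_neutral_right) (auto simp: indicator_def)
      then show "ennreal (k z) = (\<Sum>v\<in>range k. ennreal v * indicator (k -` {v}) z)" by simp
    qed
    also have "\<dots> = (\<Sum>v\<in>range k. ennreal v * emeasure \<pi> (k -` {v}))"
      using R_borel[OF lev] sets_pi
      by (subst nn_integral_sum) (auto intro!: sum.cong nn_integral_cmult_indicator borel_measurable_times_ennreal borel_measurable_indicator)
    also have "\<dots> = (\<Sum>v\<in>range k. ennreal (v * \<Lambda> (indicator (k -` {v}))))"
      using k(2) em[OF lev] m_nonneg by (intro sum.cong) (auto simp: ennreal_mult)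
    also have "\<dots> = ennreal (\<Sum>v\<in>range k. v * \<Lambda> (indicator (k -` {v})))"
      using k(2) m_nonneg by (intro sum_ennreal) auto
    also have "(\<Sum>v\<in>range k. v * \<Lambda> (indicator (k -` {v}))) = \<Lambda> k"
      unfolding Lsum[OF fin, symmetric] by (intro arg_cong[of _ _ \<Lambda>] ext rep[symmetric])
    finally show ?thesis .
  qed
  ultimately show ?thesis by (rule that)
qed

text \<open>The quantifier order matters: one coupling works for all \<open>j\<close>. This is what
  later permits monotone convergence along \<open>k\<close> without extracting limits of
  couplings.\<close>

lemma exists_coupling_le:
  fixes k :: "nat \<Rightarrow> 'a \<times> 'b \<Rightarrow> real"
  assumes rect: "\<And>j. rect_fun (k j)" and k0: "\<And>j z. 0 \<le> k j z" and kinc: "\<And>z. incseq (\<lambda>j. k j z)"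
    and dual: "\<And>j \<phi> \<psi>. \<phi> \<in> bounded_borel \<Longrightarrow> \<psi> \<in> bounded_borel \<Longrightarrow> (\<And>x y. \<phi> x + \<psi> y \<le> k j (x, y)) \<Longrightarrow>
        dual_value \<phi> \<psi> \<le> t"
  shows "\<exists>\<pi>\<in>couplings \<mu> \<nu>. \<forall>j. (\<integral>\<^sup>+z. ennreal (k j z) \<partial>\<pi>) \<le> ennreal t"
proof -
  have kb: "bounded (range (k j))" for j by (intro finite_imp_bounded rect_fun_finite_range rect)
  obtain \<Lambda> where L: "\<And>f g. bounded (range f) \<Longrightarrow> bounded (range g) \<Longrightarrow> \<Lambda> (\<lambda>z. f z + g z) = \<Lambda> f + \<Lambda> g"
    "\<And>a f. bounded (range f) \<Longrightarrow> \<Lambda> (\<lambda>z. a * f z) = a * \<Lambda> f"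
    "\<And>f. bounded (range f) \<Longrightarrow> (\<And>z. 0 \<le> f z) \<Longrightarrow> 0 \<le> \<Lambda> f"
    "\<And>\<phi> \<psi>. \<phi> \<in> bounded_borel \<Longrightarrow> \<psi> \<in> bounded_borel \<Longrightarrow>
        \<Lambda> (\<lambda>z. \<phi> (fst z) + \<psi> (snd z)) = dual_value \<phi> \<psi>"
    "\<And>j. \<Lambda> (k j) \<le> t"
    by (rule exists_functional_below[OF kb k0 kinc dual]) blast+
  obtain \<pi> where "\<pi> \<in> couplings \<mu> \<nu>"
    "\<And>k. rect_fun k \<Longrightarrow> (\<And>z. 0 \<le> k z) \<Longrightarrow> (\<integral>\<^sup>+z. ennreal (k z) \<partial>\<pi>) = ennreal (\<Lambda> k)"
    by (rule coupling_of_functional[OF L(1-4)]) blast+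
  then show ?thesis using L(5) rect k0 by (auto intro!: bexI[of _ \<pi>] ennreal_leI)
qed

end

section \<open>Compactness of dual potentials\<close>

text \<open>The elementary inequality \<open>pt\<close> trades squares for absolute values: a
  squared distance of order 4^(-k) gives an L1 distance of at most twice 2^(-k). These are summable,
  so the telescoping series converges absolutely almost everywhere.\<close>

lemma AE_convergent_of_L2_differences:
  fixes w :: "nat \<Rightarrow> 'a \<Rightarrow> real"
  assumes "prob_space M" and [measurable]: "\<And>k. w k \<in> borel_measurable M"
    and L2: "\<And>k. (\<integral>\<^sup>+x. ennreal ((w (Suc k) x - w k x)\<^sup>2) \<partial>M) \<le> ennreal ((1/4)^k)"
  shows "AE x in M. convergent (\<lambda>k. w k x)"
proof -
  interpret prob_space M by fact
  have L1: "(\<integral>\<^sup>+x. ennreal \<bar>w (Suc k) x - w k x\<bar> \<partial>M) \<le> ennreal (2 * (1/2)^k)" for k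
  proof -
    have pt: "\<bar>d\<bar> \<le> (1/2)^k + 2^k * d\<^sup>2" for d :: real
    proof (cases "\<bar>d\<bar> \<le> (1/2)^k")
      case True then show ?thesis by (auto intro: order_trans)
    next
      case False
      then have "1 \<le> 2^k * \<bar>d\<bar>" by (simp add: power_one_over field_simps)
      then have "1 * \<bar>d\<bar> \<le> (2^k * \<bar>d\<bar>) * \<bar>d\<bar>" by (intro mult_right_mono) auto
      then have "\<bar>d\<bar> \<le> 2^k * d\<^sup>2" by (simp add: power2_eq_square mult.assoc)
      then show ?thesis by (simp add: add_increasing)
    qed
    have "(\<integral>\<^sup>+x. ennreal \<bar>w (Suc k) x - w k x\<bar> \<partial>M) \<le>
        (\<integral>\<^sup>+x. ennreal ((1/2)^k) + ennreal (2^k) * ennreal ((w (Suc k) x - w k x)\<^sup>2) \<partial>M)"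
      using pt by (intro nn_integral_mono) (auto simp: ennreal_mult[symmetric] ennreal_plus[symmetric] simp del: ennreal_plus intro!: ennreal_leI)
    also have "\<dots> = ennreal ((1/2)^k) + ennreal (2^k) * (\<integral>\<^sup>+x. ennreal ((w (Suc k) x - w k x)\<^sup>2) \<partial>M)"
      by (simp add: nn_integral_add nn_integral_cmult emeasure_space_1)
    also have "\<dots> \<le> ennreal ((1/2)^k) + ennreal (2^k) * ennreal ((1/4)^k)"
      by (intro add_left_mono mult_left_mono L2) auto
    also have "\<dots> = ennreal ((1/2)^k + 2^k * (1/4)^k)"
      by (simp add: ennreal_mult[symmetric] ennreal_plus[symmetric] del: ennreal_plus)
    also have "(1/2::real)^k + 2^k * (1/4)^k = 2 * (1/2)^k"
      by (simp flip: power_mult_distrib)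
    finally show ?thesis .
  qed
  have "(\<integral>\<^sup>+x. (\<Sum>k. ennreal \<bar>w (Suc k) x - w k x\<bar>) \<partial>M) = (\<Sum>k. \<integral>\<^sup>+x. ennreal \<bar>w (Suc k) x - w k x\<bar> \<partial>M)"
    by (intro nn_integral_suminf) measurable
  also have "\<dots> \<le> (\<Sum>k. ennreal (2 * (1/2)^k))"
    by (intro suminf_le L1) auto
  also have "\<dots> = ennreal (\<Sum>k. 2 * (1/2)^k)"
    by (intro suminf_ennreal2 summable_mult summable_geometric) auto
  finally have "(\<integral>\<^sup>+x. (\<Sum>k. ennreal \<bar>w (Suc k) x - w k x\<bar>) \<partial>M) \<noteq> \<infinity>"
    by (auto simp: top_unique)
  then have "AE x in M. (\<Sum>k. ennreal \<bar>w (Suc k) x - w k x\<bar>) \<noteq> \<infinity>"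
    by (intro nn_integral_PInf_AE) auto
  then show ?thesis
  proof (rule eventually_mono)
    fix x assume "(\<Sum>k. ennreal \<bar>w (Suc k) x - w k x\<bar>) \<noteq> \<infinity>"
    then have "summable (\<lambda>k. \<bar>w (Suc k) x - w k x\<bar>)"
      by (intro summable_suminf_not_top) auto
    then have "summable (\<lambda>k. w (Suc k) x - w k x)" by (rule summable_rabs_cancel)
    then have "convergent (\<lambda>n. \<Sum>k<n. w (Suc k) x - w k x)" by (simp add: summable_iff_convergent)
    then have "convergent (\<lambda>n. w n x - w 0 x)" by (simp only: sum_lessThan_telescope[of "\<lambda>k. w k x"])
    then have "convergent (\<lambda>n. (w n x - w 0 x) + w 0 x)"
      by (intro convergent_add convergent_const)
    then show "convergent (\<lambda>k. w k x)" by simp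
  qed
qed

text \<open>A pair of potentials is determined only up to a constant moved from one to the other,
  and a median fixes that constant. Allowing an error of 1 reduces the search to the least level on
  the grid \<open>real n - B\<close> below which half of the mass lies; one grid step lower, more
  than half of the mass lies above.\<close>

lemma exists_approx_median:
  assumes "prob_space M" "sets M = sets borel" "\<phi> \<in> bounded_borel"
  shows "\<exists>s. 1/2 \<le> measure M {x. \<phi> x \<le> s} \<and> 1/2 \<le> measure M {x. s - 1 \<le> \<phi> x}"
proof -
  interpret prob_space M by fact
  have [measurable]: "\<phi> \<in> borel_measurable M"
    using bounded_borel_measurable[OF assms(3)] assms(2) by (simp cong: measurable_cong_sets)
  have sp: "space M = UNIV" using sets_eq_imp_space_eq[OF assms(2)] by simp
  have ev: "{x. \<phi> x \<le> a} \<in> sets M" "{x. a \<le> \<phi> x} \<in> sets M" for a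
  proof -
    have "{x \<in> space M. \<phi> x \<le> a} \<in> sets M" "{x \<in> space M. a \<le> \<phi> x} \<in> sets M" by measurable
    then show "{x. \<phi> x \<le> a} \<in> sets M" "{x. a \<le> \<phi> x} \<in> sets M" by (simp_all add: sp)
  qed
  obtain B where B: "\<And>x. \<bar>\<phi> x\<bar> \<le> B" using bounded_borelE[OF assms(3)] by blast
  define P where "P n \<longleftrightarrow> 1/2 \<le> measure M {x. \<phi> x \<le> real n - B}" for n :: nat
  have B': "- B \<le> \<phi> x" "\<phi> x \<le> B" for x using B[of x] by auto
  have P: "P (nat \<lceil>2 * B\<rceil>)"
  proof -
    have "\<phi> x \<le> real (nat \<lceil>2 * B\<rceil>) - B" for x
      using B'(2)[of x] real_nat_ceiling_ge[of "2 * B"] by linarith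
    then have "{x. \<phi> x \<le> real (nat \<lceil>2 * B\<rceil>) - B} = UNIV" by blast
    then show ?thesis using prob_space sp unfolding P_def by simp
  qed
  define n where "n = (LEAST n. P n)"
  have Pn: "P n" unfolding n_def by (rule LeastI[of P, OF P])
  have "1/2 \<le> measure M {x. (real n - B) - 1 \<le> \<phi> x}"
  proof (cases n)
    case 0
    have "{x. (real n - B) - 1 \<le> \<phi> x} = UNIV" using B' 0 by (auto intro: order_trans[of _ "- B"])
    then show ?thesis using prob_space sp by simp
  next
    case (Suc m)
    then have "\<not> P m" unfolding n_def by (metis lessI not_less_Least)
    then have m: "measure M {x. \<phi> x \<le> real m - B} < 1/2" unfolding P_def by simp
    have "measure M (space M - {x. \<phi> x \<le> real m - B}) = 1 - measure M {x. \<phi> x \<le> real m - B}"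
      by (intro prob_compl ev)
    moreover have "measure M (space M - {x. \<phi> x \<le> real m - B}) \<le> measure M {x. (real n - B) - 1 \<le> \<phi> x}"
      by (rule finite_measure_mono) (use ev in \<open>auto simp: Suc\<close>)
    ultimately show ?thesis using m by simp
  qed
  then show ?thesis using Pn unfolding P_def by blast
qed

text \<open>For fixed \<open>x\<close> the set where \<open>c x\<close> is at most \<open>m\<close>
  has mass above \<open>1 - d\<close> for some \<open>m\<close>, hence meets the set where
  \<open>\<Psi> n\<close> is at least \<open>- K\<close>, whatever \<open>n\<close> is. At a common
  point \<open>y\<close> the constraint bounds \<open>\<Phi> n x\<close> by \<open>m + K\<close>,
  and \<open>m\<close> does not depend on \<open>n\<close>.\<close>

lemma AE_bdd_above_sections:
  fixes \<Phi> :: "nat \<Rightarrow> 'a \<Rightarrow> real" and \<Psi> :: "nat \<Rightarrow> 'b \<Rightarrow> real"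
  assumes N: "prob_space N" and [measurable]: "\<And>x. c x \<in> borel_measurable N" "\<And>n. \<Psi> n \<in> borel_measurable N"
    and fin: "AE x in M. AE y in N. c x y \<noteq> (\<infinity>::ennreal)"
    and le: "\<And>n x y. ennreal (\<Phi> n x + \<Psi> n y) \<le> c x y"
    and d: "0 < d" "\<And>n. d \<le> measure N {y \<in> space N. - K \<le> \<Psi> n y}"
  shows "AE x in M. bdd_above (range (\<lambda>n. \<Phi> n x))"
proof -
  interpret prob_space N by fact
  show ?thesis using fin
  proof (rule eventually_mono)
    fix x assume x: "AE y in N. c x y \<noteq> \<infinity>"
    define A where "A m = {y \<in> space N. c x y \<le> of_nat m}" for m :: nat
    have [measurable]: "A m \<in> sets N" for m unfolding A_def by measurable
    have "(\<lambda>m. measure N (A m)) \<longlonglongrightarrow> measure N (\<Union>m. A m)"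
      by (intro finite_Lim_measure_incseq) (auto simp: incseq_def A_def intro: order_trans)
    moreover have "measure N (\<Union>m. A m) = 1"
    proof (subst prob_eq_1)
      show "AE y in N. y \<in> (\<Union>m. A m)" using x AE_space
      proof eventually_elim
        case (elim y)
        then obtain m :: nat where "c x y < of_nat m" using ennreal_Ex_less_of_nat by (auto simp: less_top)
        then show ?case using elim by (auto simp: A_def intro: less_imp_le)
      qed
    qed auto
    ultimately have "\<forall>\<^sub>F m in sequentially. measure N (A m) > 1 - d"
      using d(1) by (intro order_tendstoD) auto
    then obtain m where m: "measure N (A m) > 1 - d" by (auto simp: eventually_sequentially)
    have "\<Phi> n x \<le> real m + K" for n
    proof -
      let ?B = "{y \<in> space N. - K \<le> \<Psi> n y}"
      have "A m \<inter> ?B \<noteq> {}"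
      proof
        assume "A m \<inter> ?B = {}"
        then have "measure N (A m \<union> ?B) = measure N (A m) + measure N ?B"
          by (intro finite_measure_Union) auto
        then show False using m d(2)[of n] prob_le_1[of "A m \<union> ?B"] by simp
      qed
      then obtain y where y: "c x y \<le> of_nat m" "- K \<le> \<Psi> n y" unfolding A_def by blast
      have "ennreal (\<Phi> n x + \<Psi> n y) \<le> ennreal (real m)"
        using order_trans[OF le y(1)] by (simp add: ennreal_of_nat_eq_real_of_nat)
      then have "\<Phi> n x + \<Psi> n y \<le> real m" by (simp add: ennreal_le_iff)
      then show ?thesis using y(2) by simp
    qed
    then show "bdd_above (range (\<lambda>n. \<Phi> n x))" by (intro bdd_aboveI2)
  qed
qed

context polish_marginals
begin

lemma coupling_props:
  assumes "\<pi> \<in> couplings \<mu> \<nu>"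
  shows "prob_space \<pi>" "sets \<pi> = sets borel" "space \<pi> = UNIV"
    "fst \<in> \<pi> \<rightarrow>\<^sub>M \<mu>" "snd \<in> \<pi> \<rightarrow>\<^sub>M \<nu>" "distr \<pi> \<mu> fst = \<mu>" "distr \<pi> \<nu> snd = \<nu>"
proof -
  show "prob_space \<pi>" and s: "sets \<pi> = sets borel" using assms by (auto simp: couplings_def)
  show sp: "space \<pi> = UNIV" using sets_eq_imp_space_eq[OF s] by simp
  have sb: "sets \<pi> = sets (borel \<Otimes>\<^sub>M borel)" unfolding borel_prod by (rule s)
  show f: "fst \<in> \<pi> \<rightarrow>\<^sub>M \<mu>" and g: "snd \<in> \<pi> \<rightarrow>\<^sub>M \<nu>"
    using measurable_fst measurable_snd measurable_cong_sets[OF sb sets_mu] measurable_cong_sets[OF sb sets_nu] by blast+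
  show "distr \<pi> \<mu> fst = \<mu>"
  proof (rule measure_eqI)
    fix A assume "A \<in> sets (distr \<pi> \<mu> fst)"
    then have A: "A \<in> sets \<mu>" by simp
    have "emeasure (distr \<pi> \<mu> fst) A = emeasure \<pi> (A \<times> UNIV)"
      using f A by (subst emeasure_distr) (auto intro!: arg_cong[where f = "emeasure \<pi>"] simp: sp)
    then show "emeasure (distr \<pi> \<mu> fst) A = emeasure \<mu> A" using assms A by (simp add: couplings_def sets_mu)
  qed simp
  show "distr \<pi> \<nu> snd = \<nu>"
  proof (rule measure_eqI)
    fix A assume "A \<in> sets (distr \<pi> \<nu> snd)"
    then have A: "A \<in> sets \<nu>" by simp
    have "emeasure (distr \<pi> \<nu> snd) A = emeasure \<pi> (UNIV \<times> A)"
      using g A by (subst emeasure_distr) (auto intro!: arg_cong[where f = "emeasure \<pi>"] simp: sp)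
    then show "emeasure (distr \<pi> \<nu> snd) A = emeasure \<nu> A" using assms A by (simp add: couplings_def sets_nu)
  qed simp
qed

lemma coupling_AE:
  assumes "\<pi> \<in> couplings \<mu> \<nu>"
  shows "AE x in \<mu>. P x \<Longrightarrow> AE z in \<pi>. P (fst z)" "AE y in \<nu>. Q y \<Longrightarrow> AE z in \<pi>. Q (snd z)"
  using coupling_props[OF assms] by (metis AE_distrD)+

lemma coupling_integral:
  fixes \<phi> :: "'a \<Rightarrow> real" and \<psi> :: "'b \<Rightarrow> real"
  assumes \<pi>: "\<pi> \<in> couplings \<mu> \<nu>" and \<phi>: "\<phi> \<in> bounded_borel" and \<psi>: "\<psi> \<in> bounded_borel"
  shows "integrable \<pi> (\<lambda>z. \<phi> (fst z) + \<psi> (snd z))"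
    and "(\<integral>z. \<phi> (fst z) + \<psi> (snd z) \<partial>\<pi>) = dual_value \<phi> \<psi>"
proof -
  note c = coupling_props[OF \<pi>]
  have i1: "integrable \<pi> (\<lambda>z. \<phi> (fst z))"
    using integrable_distr[OF c(4), of \<phi>] integrable_mu[OF \<phi>] c(6) by simp
  have i2: "integrable \<pi> (\<lambda>z. \<psi> (snd z))"
    using integrable_distr[OF c(5), of \<psi>] integrable_nu[OF \<psi>] c(7) by simp
  show "integrable \<pi> (\<lambda>z. \<phi> (fst z) + \<psi> (snd z))" using i1 i2 by simp
  have "(\<integral>z. \<phi> (fst z) \<partial>\<pi>) = (\<integral>x. \<phi> x \<partial>\<mu>)"
    using integral_distr[OF c(4), of \<phi>] borel_measurable_integrable[OF integrable_mu[OF \<phi>]] c(6) by simp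
  moreover have "(\<integral>z. \<psi> (snd z) \<partial>\<pi>) = (\<integral>y. \<psi> y \<partial>\<nu>)"
    using integral_distr[OF c(5), of \<psi>] borel_measurable_integrable[OF integrable_nu[OF \<psi>]] c(7) by simp
  ultimately show "(\<integral>z. \<phi> (fst z) + \<psi> (snd z) \<partial>\<pi>) = dual_value \<phi> \<psi>"
    using i1 i2 by simp
qed

lemma sets_pair: "sets (\<mu> \<Otimes>\<^sub>M \<nu>) = sets borel"
  unfolding borel_prod[symmetric] by (rule sets_pair_measure_cong[OF sets_mu sets_nu])

lemma AE_pair_sections:
  assumes [measurable]: "C \<in> borel_measurable borel" and fin: "AE z in \<mu> \<Otimes>\<^sub>M \<nu>. C z \<noteq> (\<infinity>::ennreal)"
  shows "AE x in \<mu>. AE y in \<nu>. C (x, y) \<noteq> \<infinity>" "AE y in \<nu>. AE x in \<mu>. C (x, y) \<noteq> \<infinity>"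
proof -
  have [measurable]: "C \<in> borel_measurable (\<mu> \<Otimes>\<^sub>M \<nu>)"
    using assms(1) measurable_cong_sets[OF sets_pair refl] by blast
  show *: "AE x in \<mu>. AE y in \<nu>. C (x, y) \<noteq> \<infinity>" using AE_pair[OF fin] .
  show "AE y in \<nu>. AE x in \<mu>. C (x, y) \<noteq> \<infinity>"
    using * by (subst (asm) AE_commute) measurable
qed

text \<open>The lower bounds on \<open>\<Psi>\<close> come from the finite plan, the upper ones from the finiteness of
  \<open>C\<close> on the product; the normalization of \<open>\<Phi>\<close> excludes adding large constants to the pair.\<close>

lemma potentials_bdd_above:
  fixes \<Phi> :: "nat \<Rightarrow> 'a \<Rightarrow> real" and \<Psi> :: "nat \<Rightarrow> 'b \<Rightarrow> real"
  assumes \<pi>: "\<pi> \<in> couplings \<mu> \<nu>" and C[measurable]: "C \<in> borel_measurable borel"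
    and fin: "AE z in \<mu> \<Otimes>\<^sub>M \<nu>. C z \<noteq> (\<infinity>::ennreal)" and Cpi: "(\<integral>\<^sup>+z. C z \<partial>\<pi>) < \<infinity>"
    and \<Phi>: "\<And>n. \<Phi> n \<in> bounded_borel" and \<Psi>: "\<And>n. \<Psi> n \<in> bounded_borel"
    and le: "\<And>n x y. ennreal (\<Phi> n x + \<Psi> n y) \<le> C (x, y)"
    and t: "\<And>n. t \<le> dual_value (\<Phi> n) (\<Psi> n)"
    and med: "\<And>n. 1/2 \<le> measure \<mu> {x. \<Phi> n x \<le> 0}" "\<And>n. 1/2 \<le> measure \<mu> {x. -1 \<le> \<Phi> n x}"
  shows "AE x in \<mu>. bdd_above (range (\<lambda>n. \<Phi> n x))" "AE y in \<nu>. bdd_above (range (\<lambda>n. \<Psi> n y))"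
proof -
  note c = coupling_props[OF \<pi>]
  interpret \<pi>: prob_space \<pi> by (rule c(1))
  have [measurable]: "\<Phi> n \<in> borel_measurable borel" "\<Psi> n \<in> borel_measurable borel" for n
    using \<Phi> \<Psi> by (auto intro: bounded_borel_measurable)
  have [measurable]: "\<Phi> n \<in> borel_measurable \<mu>" "\<Psi> n \<in> borel_measurable \<nu>" for n
    using \<Phi> \<Psi> integrable_mu integrable_nu by (auto intro: borel_measurable_integrable)
  have [measurable]: "fst \<in> \<pi> \<rightarrow>\<^sub>M \<mu>" "snd \<in> \<pi> \<rightarrow>\<^sub>M \<nu>" by (rule c)+
  have Cb: "C \<in> borel_measurable (borel \<Otimes>\<^sub>M borel)" using C by (simp add: borel_prod)
  have C1: "(\<lambda>y. C (x, y)) \<in> borel_measurable \<nu>" for x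
    using measurable_compose[OF measurable_Pair1' Cb] sets_nu by (simp cong: measurable_cong_sets)
  have C2: "(\<lambda>x. C (x, y)) \<in> borel_measurable \<mu>" for y
    using measurable_compose[OF measurable_Pair2' Cb] sets_mu by (simp cong: measurable_cong_sets)
  \<comment> \<open>Here the normalization alone supplies the lower bound: \<open>\<Phi> n\<close>
    is at least -1 on half of the mass of \<mu>. Only the opposite bound, on \<Phi>, draws on the
    plan.\<close>
  show "AE y in \<nu>. bdd_above (range (\<lambda>n. \<Psi> n y))"
  proof (rule AE_bdd_above_sections[where N = \<mu> and c = "\<lambda>y x. C (x, y)" and \<Psi> = \<Phi> and d = "1/2" and K = 1])
    show "ennreal (\<Psi> n y + \<Phi> n x) \<le> C (x, y)" for n x y using le[of n x y] by (simp add: add.commute)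
  qed (use C2 AE_pair_sections(2)[OF C fin] med(2) M1.prob_space_axioms in \<open>auto simp: space_mu\<close>)
  define c0 where "c0 = enn2real (\<integral>\<^sup>+z. C z \<partial>\<pi>)"
  have c0: "(\<integral>\<^sup>+z. C z \<partial>\<pi>) = ennreal c0" "0 \<le> c0" using Cpi by (auto simp: c0_def less_top)
  \<comment> \<open>Under the plan, the sum \<open>q\<close> of the two potentials has a negative
    part with integral at most \<open>c0 - t\<close>, so Markov's inequality puts
    \<open>q < - K\<close> on mass at most 1/4. Removing this from the half where
    \<open>\<Phi> n\<close> is nonpositive leaves mass 1/4 on which \<open>\<Psi> n\<close> is at
    least \<open>- K\<close>. The maximum with 1 keeps \<open>K\<close> positive.\<close>
  define K where "K = 4 * max 1 (c0 - t)"
  have K: "K > 0" "c0 - t \<le> K / 4" unfolding K_def by auto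
  have low: "1/4 \<le> measure \<nu> {y \<in> space \<nu>. - K \<le> \<Psi> n y}" for n
  proof -
    define q where "q z = \<Phi> n (fst z) + \<Psi> n (snd z)" for z
    have qi: "integrable \<pi> q" and qt: "t \<le> (\<integral>z. q z \<partial>\<pi>)"
      unfolding q_def using coupling_integral[OF \<pi> \<Phi> \<Psi>, of n n] t[of n] by auto
    have [measurable]: "q \<in> borel_measurable \<pi>" using qi by auto
    have "ennreal (\<integral>z. max 0 (q z) \<partial>\<pi>) = (\<integral>\<^sup>+z. ennreal (max 0 (q z)) \<partial>\<pi>)"
      using qi by (intro nn_integral_eq_integral[symmetric]) auto
    also have "\<dots> \<le> (\<integral>\<^sup>+z. C z \<partial>\<pi>)"
      using le[of n "fst z" "snd z" for z] by (intro nn_integral_mono) (auto simp: q_def max_def ennreal_neg)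
    finally have qp: "(\<integral>z. max 0 (q z) \<partial>\<pi>) \<le> c0" using c0 by (simp add: ennreal_le_iff)
    have "{z \<in> space \<pi>. q z < - K} \<in> sets \<pi>" by measurable
    then have "integrable \<pi> (indicat_real {z \<in> space \<pi>. q z < - K})"
      by (intro integrable_real_indicator) (auto simp: less_top[symmetric])
    then have Ki: "integrable \<pi> (\<lambda>z. K * indicat_real {z \<in> space \<pi>. q z < - K} z)" by simp
    have "K * measure \<pi> {z \<in> space \<pi>. q z < - K} = (\<integral>z. K * indicator {z \<in> space \<pi>. q z < - K} z \<partial>\<pi>)"
      by simp
    also have "\<dots> \<le> (\<integral>z. max 0 (q z) - q z \<partial>\<pi>)"
      using K by (intro integral_mono Ki Bochner_Integration.integrable_diff integrable_max integrable_zero qi)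
        (auto simp: indicator_def)
    also have "\<dots> = (\<integral>z. max 0 (q z) \<partial>\<pi>) - (\<integral>z. q z \<partial>\<pi>)"
      using qi by (intro Bochner_Integration.integral_diff) auto
    also have "\<dots> \<le> K / 4" using qp qt K by simp
    finally have m1: "measure \<pi> {z \<in> space \<pi>. q z < - K} \<le> 1/4" using K(1) by (simp add: field_simps)
    have "measure \<mu> {x. \<Phi> n x \<le> 0} = measure (distr \<pi> \<mu> fst) {x \<in> space \<mu>. \<Phi> n x \<le> 0}"
      by (simp add: c(6) space_mu)
    also have "\<dots> = measure \<pi> {z \<in> space \<pi>. \<Phi> n (fst z) \<le> 0}"
      by (subst measure_distr) (auto simp: c(3) space_mu vimage_def)
    finally have m2: "1/2 \<le> measure \<pi> {z \<in> space \<pi>. \<Phi> n (fst z) \<le> 0}" using med(1)[of n] by simp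
    have "measure \<pi> {z \<in> space \<pi>. \<Phi> n (fst z) \<le> 0} \<le>
        measure \<pi> ({z \<in> space \<pi>. q z < - K} \<union> {z \<in> space \<pi>. - K \<le> \<Psi> n (snd z)})"
      by (intro \<pi>.finite_measure_mono) (auto simp: q_def)
    also have "\<dots> \<le> measure \<pi> {z \<in> space \<pi>. q z < - K} + measure \<pi> {z \<in> space \<pi>. - K \<le> \<Psi> n (snd z)}"
      by (intro measure_Un_le) auto
    finally have m3: "1/4 \<le> measure \<pi> {z \<in> space \<pi>. - K \<le> \<Psi> n (snd z)}" using m1 m2 by simp
    have "measure \<nu> {y \<in> space \<nu>. - K \<le> \<Psi> n y} = measure (distr \<pi> \<nu> snd) {y \<in> space \<nu>. - K \<le> \<Psi> n y}"
      by (simp add: c(7))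
    also have "\<dots> = measure \<pi> {z \<in> space \<pi>. - K \<le> \<Psi> n (snd z)}"
      by (subst measure_distr) (auto simp: c(3) space_nu vimage_def)
    finally show ?thesis using m3 by simp
  qed
  show "AE x in \<mu>. bdd_above (range (\<lambda>n. \<Phi> n x))"
    by (rule AE_bdd_above_sections[where N = \<nu> and c = "\<lambda>x y. C (x, y)" and \<Psi> = \<Psi> and d = "1/4" and K = K])
       (use C1 AE_pair_sections(1)[OF C fin] le low M2.prob_space_axioms in auto)
qed

end

text \<open>The midpoint convexity defect of exp is exactly a square in the variable exp(u/2). This
  is why convergence is later proved for exponentials of half the potentials.\<close>

lemma exp_half_diff_square:
  fixes u v w :: real
  shows "(exp ((u - w) / 2) - exp ((v - w) / 2))\<^sup>2 = exp (u - w) + exp (v - w) - 2 * exp ((u + v) / 2 - w)"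
proof -
  have "(exp ((u - w) / 2))\<^sup>2 = exp (u - w)" "(exp ((v - w) / 2))\<^sup>2 = exp (v - w)"
    by (simp_all flip: exp_double)
  moreover have "exp ((u - w) / 2) * exp ((v - w) / 2) = exp ((u + v) / 2 - w)"
    by (simp add: exp_add[symmetric] field_simps)
  ultimately show ?thesis by (simp add: power2_diff)
qed

text \<open>Since \<alpha> dominates both functions, all exponents are nonpositive almost everywhere
  and every term is integrable. A near-minimizer of the exponential integral is therefore close, in
  L2 of the half exponentials, to any other near-minimizer.\<close>

lemma exp_midpoint_identity:
  fixes \<phi> \<phi>' \<alpha> :: "'a \<Rightarrow> real"
  assumes "prob_space M"
    and [measurable]: "\<phi> \<in> borel_measurable M" "\<phi>' \<in> borel_measurable M" "\<alpha> \<in> borel_measurable M"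
    and le: "AE x in M. \<phi> x \<le> \<alpha> x" "AE x in M. \<phi>' x \<le> \<alpha> x"
  defines "d \<equiv> (\<integral>x. exp (\<phi> x - \<alpha> x) \<partial>M) + (\<integral>x. exp (\<phi>' x - \<alpha> x) \<partial>M) -
      2 * (\<integral>x. exp ((\<phi> x + \<phi>' x) / 2 - \<alpha> x) \<partial>M)"
  shows "0 \<le> d"
    and "(\<integral>\<^sup>+x. ennreal ((exp ((\<phi> x - \<alpha> x) / 2) - exp ((\<phi>' x - \<alpha> x) / 2))\<^sup>2) \<partial>M) = ennreal d"
proof -
  interpret prob_space M by fact
  have i: "integrable M (\<lambda>x. exp (g x - \<alpha> x))" if "g \<in> borel_measurable M" "AE x in M. g x \<le> \<alpha> x" for g
    using that by (intro integrable_const_bound[where B = 1]) auto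
  have "AE x in M. (\<phi> x + \<phi>' x) / 2 \<le> \<alpha> x" using le by eventually_elim simp
  then have int: "integrable M (\<lambda>x. exp (\<phi> x - \<alpha> x))" "integrable M (\<lambda>x. exp (\<phi>' x - \<alpha> x))"
    "integrable M (\<lambda>x. exp ((\<phi> x + \<phi>' x) / 2 - \<alpha> x))"
    using le i[of "\<lambda>x. (\<phi> x + \<phi>' x) / 2"] by (auto intro: i)
  have d: "d = (\<integral>x. (exp ((\<phi> x - \<alpha> x) / 2) - exp ((\<phi>' x - \<alpha> x) / 2))\<^sup>2 \<partial>M)"
    using int by (simp add: d_def exp_half_diff_square)
  then show "0 \<le> d" by simp
  have "integrable M (\<lambda>x. (exp ((\<phi> x - \<alpha> x) / 2) - exp ((\<phi>' x - \<alpha> x) / 2))\<^sup>2)"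
    using int by (simp add: exp_half_diff_square)
  then show "(\<integral>\<^sup>+x. ennreal ((exp ((\<phi> x - \<alpha> x) / 2) - exp ((\<phi>' x - \<alpha> x) / 2))\<^sup>2) \<partial>M) = ennreal d"
    unfolding d by (intro nn_integral_eq_integral) auto
qed

text \<open>A positive limit of the exponentials is undone by the logarithm, while the limit 0 means
  that \<open>u\<close> tends to -\<infinity>. The value \<infinity> cannot occur because the
  exponentials converge to a real number.\<close>

lemma ereal_tendsto_of_convergent_exp:
  fixes a :: real
  assumes "convergent (\<lambda>k. exp ((u k - a) / 2))"
  shows "\<exists>l < \<infinity>. (\<lambda>k. ereal (u k)) \<longlonglongrightarrow> l"
proof -
  obtain W where W: "(\<lambda>k. exp ((u k - a) / 2)) \<longlonglongrightarrow> W" using assms by (auto simp: convergent_def)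
  have W0: "0 \<le> W" by (rule LIMSEQ_le_const[OF W]) auto
  show ?thesis
  proof (cases "W = 0")
    case False
    then have "(\<lambda>k. 2 * ln (exp ((u k - a) / 2)) + a) \<longlonglongrightarrow> 2 * ln W + a"
      using W by (intro tendsto_intros) auto
    moreover have "(\<lambda>k. 2 * ln (exp ((u k - a) / 2)) + a) = u" by (rule ext) (simp add: field_simps)
    ultimately have "u \<longlonglongrightarrow> 2 * ln W + a" by simp
    then show ?thesis by (intro exI[of _ "ereal (2 * ln W + a)"]) auto
  next
    case True
    have "(\<lambda>k. ereal (u k)) \<longlonglongrightarrow> -\<infinity>"
      unfolding tendsto_MInfty
    proof
      fix r
      have "\<forall>\<^sub>F k in sequentially. exp ((u k - a) / 2) < exp ((r - a) / 2)"
        using W True by (intro order_tendstoD) auto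
      then show "\<forall>\<^sub>F k in sequentially. ereal (u k) < ereal r" by eventually_elim simp
    qed
    then show ?thesis by (intro exI[of _ "-\<infinity>"]) auto
  qed
qed

lemma le_real_SUP_ereal:
  fixes u :: "nat \<Rightarrow> real"
  assumes "bdd_above (range u)"
  shows "u n \<le> real_of_ereal (SUP n. ereal (u n))"
proof -
  obtain b where b: "\<And>n. u n \<le> b" using assms by (auto simp: bdd_above_def)
  have "(SUP n. ereal (u n)) \<le> ereal b" by (intro SUP_least) (simp add: b)
  moreover have "ereal (u n) \<le> (SUP n. ereal (u n))" by (intro SUP_upper) simp
  ultimately show ?thesis by (cases "SUP n. ereal (u n)") auto
qed

context polish_marginals
begin

lemma exists_AE_convergent_potentials:
  fixes \<Phi> :: "nat \<Rightarrow> 'a \<Rightarrow> real" and \<Psi> :: "nat \<Rightarrow> 'b \<Rightarrow> real" and f :: "nat \<Rightarrow> 'a \<times> 'b \<Rightarrow> ennreal"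
  assumes dec: "\<And>z. decseq (\<lambda>n. f n z)"
    and \<Phi>: "\<And>n. \<Phi> n \<in> bounded_borel" and \<Psi>: "\<And>n. \<Psi> n \<in> bounded_borel"
    and le: "\<And>n x y. ennreal (\<Phi> n x + \<Psi> n y) \<le> f n (x, y)"
    and t: "incseq t" "\<And>n. t n \<le> dual_value (\<Phi> n) (\<Psi> n)"
    and bdd: "AE x in \<mu>. bdd_above (range (\<lambda>n. \<Phi> n x))" "AE y in \<nu>. bdd_above (range (\<lambda>n. \<Psi> n y))"
  obtains \<phi> \<psi> where "\<And>k. \<phi> k \<in> bounded_borel" "\<And>k. \<psi> k \<in> bounded_borel"
    "\<And>k x y. ennreal (\<phi> k x + \<psi> k y) \<le> f k (x, y)"
    "\<And>k. t k \<le> dual_value (\<phi> k) (\<psi> k)"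
    "AE x in \<mu>. \<exists>l < \<infinity>. (\<lambda>k. ereal (\<phi> k x)) \<longlonglongrightarrow> l"
    "AE y in \<nu>. \<exists>l < \<infinity>. (\<lambda>k. ereal (\<psi> k y)) \<longlonglongrightarrow> l"
proof -
  \<comment> \<open>The pointwise supremum of the given potentials. Where it is infinite, which is a
    null set by the boundedness hypotheses, \<open>real_of_ereal\<close> returns 0.\<close>
  define \<alpha> where "\<alpha> x = real_of_ereal (SUP n. ereal (\<Phi> n x))" for x
  define \<beta> where "\<beta> y = real_of_ereal (SUP n. ereal (\<Psi> n y))" for y
  have bm: "g \<in> borel_measurable \<mu>" if "g \<in> bounded_borel" for g :: "'a \<Rightarrow> real"
    using integrable_mu[OF that] by auto
  have bn: "g \<in> borel_measurable \<nu>" if "g \<in> bounded_borel" for g :: "'b \<Rightarrow> real"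
    using integrable_nu[OF that] by auto
  note [measurable] = bm[OF \<Phi>] bn[OF \<Psi>]
  have [measurable]: "\<alpha> \<in> borel_measurable \<mu>" "\<beta> \<in> borel_measurable \<nu>"
    unfolding \<alpha>_def \<beta>_def by measurable
  have \<alpha>: "AE x in \<mu>. \<Phi> n x \<le> \<alpha> x" for n
    using bdd(1) unfolding \<alpha>_def by eventually_elim (rule le_real_SUP_ereal)
  have \<beta>: "AE y in \<nu>. \<Psi> n y \<le> \<beta> y" for n
    using bdd(2) unfolding \<beta>_def by eventually_elim (rule le_real_SUP_ereal)
  define S where "S n = {p. fst p \<in> bounded_borel \<and> snd p \<in> bounded_borel \<and>
      (\<forall>x y. ennreal (fst p x + snd p y) \<le> f n (x, y)) \<and>
      t n \<le> dual_value (fst p) (snd p) \<and>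
      (AE x in \<mu>. fst p x \<le> \<alpha> x) \<and> (AE y in \<nu>. snd p y \<le> \<beta> y)}" for n
  \<comment> \<open>Subtracting the suprema keeps the exponents nonpositive almost everywhere, so
    \<open>F\<close> is at most 2 on every \<open>S n\<close> although the potentials have no
    uniform bound. The minimal values \<open>I n\<close> then increase to a finite limit, because
    the sets \<open>S n\<close> shrink.\<close>
  define F where "F p = dual_value (\<lambda>x. exp (fst p x - \<alpha> x)) (\<lambda>y. exp (snd p y - \<beta> y))" for p
  define mid :: "('a \<Rightarrow> real) \<times> ('b \<Rightarrow> real) \<Rightarrow> _ \<Rightarrow> _"
    where "mid p q = ((\<lambda>x. (fst p x + fst q x) / 2), (\<lambda>y. (snd p y + snd q y) / 2))" for p q
  \<comment> \<open>The sets \<open>S n\<close> are themselves closed under midpoints, so near-minimizers of the strictly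
    convex \<open>F\<close> form a Cauchy sequence and no convex combinations of the given pairs are needed.\<close>
  have S_ne: "(\<Phi> n, \<Psi> n) \<in> S n" for n using \<Phi> \<Psi> le t \<alpha> \<beta> by (auto simp: S_def)
  have S_ne': "S n \<noteq> {}" for n using S_ne by blast
  have S_mono: "S n \<subseteq> S m" if "m \<le> n" for m n
    using order_trans[OF _ decseqD[OF dec that]] order_trans[OF incseqD[OF t(1) that]] by (auto simp: S_def)
  have S_mid: "mid p q \<in> S n" if p: "p \<in> S n" and q: "q \<in> S n" for p q n
  proof -
    have eq: "fst (mid p q) = (\<lambda>x. (1/2) * (fst p x + fst q x))" "snd (mid p q) = (\<lambda>y. (1/2) * (snd p y + snd q y))"
      by (auto simp: mid_def)
    have m: "ennreal (fst (mid p q) x + snd (mid p q) y) \<le> f n (x, y)" for x y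
    proof -
      have "fst (mid p q) x + snd (mid p q) y \<le> max (fst p x + snd p y) (fst q x + snd q y)"
        by (simp add: mid_def max_def field_simps)
      then have "ennreal (fst (mid p q) x + snd (mid p q) y) \<le> max (ennreal (fst p x + snd p y)) (ennreal (fst q x + snd q y))"
        by (auto simp: le_max_iff_disj intro: ennreal_leI)
      also have "\<dots> \<le> f n (x, y)" using p q by (auto simp: S_def)
      finally show ?thesis .
    qed
    have I: "dual_value (fst (mid p q)) (snd (mid p q)) =
       ((dual_value (fst p) (snd p)) + (dual_value (fst q) (snd q))) / 2"
      using p q integrable_mu integrable_nu unfolding eq by (simp add: S_def field_simps)
    have a: "AE x in \<mu>. fst (mid p q) x \<le> \<alpha> x"
    proof -
      have "AE x in \<mu>. fst p x \<le> \<alpha> x" "AE x in \<mu>. fst q x \<le> \<alpha> x" using p q by (auto simp: S_def)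
      then show ?thesis by eventually_elim (simp add: mid_def)
    qed
    have b: "AE x in \<nu>. snd (mid p q) x \<le> \<beta> x"
    proof -
      have "AE x in \<nu>. snd p x \<le> \<beta> x" "AE x in \<nu>. snd q x \<le> \<beta> x" using p q by (auto simp: S_def)
      then show ?thesis by eventually_elim (simp add: mid_def)
    qed
    have bb: "fst (mid p q) \<in> bounded_borel" "snd (mid p q) \<in> bounded_borel"
      unfolding eq by (intro bounded_borel_scale bounded_borel_add; use p q in \<open>simp add: S_def\<close>)+
    have "t n \<le> dual_value (fst p) (snd p)" "t n \<le> dual_value (fst q) (snd q)"
      using p q by (auto simp: S_def)
    then have "t n \<le> dual_value (fst (mid p q)) (snd (mid p q))" unfolding I by simp
    then show ?thesis using m a b bb unfolding S_def mem_Collect_eq by (intro conjI allI)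
  qed
  have S_meas: "fst p \<in> borel_measurable \<mu>" "snd p \<in> borel_measurable \<nu>" if "p \<in> S n" for p n
    using that bm bn by (auto simp: S_def)
  have F_bounds: "0 \<le> F p" "F p \<le> 2" if "p \<in> S n" for p n
  proof -
    note [measurable] = S_meas[OF that]
    have "AE x in \<mu>. fst p x \<le> \<alpha> x" "AE y in \<nu>. snd p y \<le> \<beta> y" using that by (auto simp: S_def)
    then have "AE x in \<mu>. exp (fst p x - \<alpha> x) \<le> 1" "AE y in \<nu>. exp (snd p y - \<beta> y) \<le> 1" by auto
    moreover from this have "integrable \<mu> (\<lambda>x. exp (fst p x - \<alpha> x))" "integrable \<nu> (\<lambda>y. exp (snd p y - \<beta> y))"
      by (auto intro!: M1.integrable_const_bound[where B = 1] M2.integrable_const_bound[where B = 1])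
    ultimately have "(\<integral>x. exp (fst p x - \<alpha> x) \<partial>\<mu>) \<le> 1" "(\<integral>y. exp (snd p y - \<beta> y) \<partial>\<nu>) \<le> 1"
      by (auto intro: M1.integral_le_const M2.integral_le_const)
    then show "F p \<le> 2" unfolding F_def by simp
    show "0 \<le> F p" unfolding F_def by (intro add_nonneg_nonneg integral_nonneg) auto
  qed
  define I where "I n = (INF p\<in>S n. F p)" for n
  have I_le: "I n \<le> F p" if "p \<in> S n" for p n
    unfolding I_def using F_bounds that by (intro cINF_lower bdd_belowI2[where m = 0]) auto
  have I_mono: "I m \<le> I n" if "m \<le> n" for m n
    unfolding I_def using F_bounds S_ne' S_mono[OF that]
    by (intro cINF_superset_mono bdd_belowI2[where m = 0]) auto
  have I2: "I n \<le> 2" for n using I_le[OF S_ne] F_bounds(2)[OF S_ne] by (rule order_trans)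
  define J where "J = (SUP n. I n)"
  have bddI: "bdd_above (range I)" using I2 by (intro bdd_aboveI2)
  have IJ: "I n \<le> J" for n unfolding J_def using bddI by (intro cSUP_upper) auto
  \<comment> \<open>Four such errors enter the midpoint estimate, so their sum is the
    \<open>(1/4)^k\<close> required for almost everywhere convergence.\<close>
  define \<delta> :: "nat \<Rightarrow> real" where "\<delta> k = (1/4)^k / 4" for k
  have \<delta>: "0 < \<delta> k" "\<delta> (Suc k) \<le> \<delta> k" for k unfolding \<delta>_def by auto
  \<comment> \<open>From the index \<open>N\<close> on, all minimal values lie within
    \<open>\<delta> k\<close> of their supremum \<open>J\<close>. Requiring \<open>k \<le> N\<close>
    makes the pair picked at stage \<open>k\<close> satisfy the constraints of stage
    \<open>k\<close>.\<close>
  have "\<exists>N\<ge>k. J - \<delta> k < I N" for k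
  proof -
    have "J - \<delta> k < J" using \<delta> by simp
    then obtain n where "J - \<delta> k < I n" using less_cSUP_iff[of UNIV I "J - \<delta> k"] bddI by (auto simp: J_def)
    then show ?thesis using I_mono[of n "max k n"] by (intro exI[of _ "max k n"]) auto
  qed
  then obtain N where N: "\<And>k. k \<le> N k" "\<And>k. J - \<delta> k < I (N k)" by metis
  have "\<exists>p\<in>S (N k). F p < I (N k) + \<delta> k" for k
  proof -
    have "I (N k) < I (N k) + \<delta> k" using \<delta> by simp
    then show ?thesis unfolding I_def
      using F_bounds by (subst (asm) cINF_less_iff[OF S_ne']) (auto intro!: bdd_belowI2[where m = 0])
  qed
  then obtain p where p: "\<And>k. p k \<in> S (N k)" "\<And>k. F (p k) < I (N k) + \<delta> k" by metis
  have gap: "F (p k) + F (p (Suc k)) - 2 * F (mid (p k) (p (Suc k))) \<le> (1/4)^k" for k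
  proof -
    \<comment> \<open>The two pairs come from different sets; as these decrease, both lie in the one
      with the smaller index. There the midpoint has value at least \<open>J - \<delta> k\<close>,
      while each pair has value at most \<open>J + \<delta> k\<close>.\<close>
    define m where "m = min (N k) (N (Suc k))"
    have "mid (p k) (p (Suc k)) \<in> S m"
      using p(1) S_mono unfolding m_def by (intro S_mid) (meson min.cobounded1 min.cobounded2 subsetD)+
    then have "I m \<le> F (mid (p k) (p (Suc k)))" by (rule I_le)
    moreover have "J - \<delta> k \<le> I m"
      using N(2)[of k] N(2)[of "Suc k"] \<delta>(2)[of k] unfolding m_def by (simp add: min_def)
    moreover have "F (p k) \<le> J + \<delta> k" "F (p (Suc k)) \<le> J + \<delta> k"
      using p(2)[of k] p(2)[of "Suc k"] IJ[of "N k"] IJ[of "N (Suc k)"] \<delta>(2)[of k] by auto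
    ultimately have "F (p k) + F (p (Suc k)) - 2 * F (mid (p k) (p (Suc k))) \<le> 4 * \<delta> k" by simp
    then show ?thesis by (simp add: \<delta>_def)
  qed
  define \<phi> where "\<phi> k = fst (p k)" for k
  define \<psi> where "\<psi> k = snd (p k)" for k
  have [measurable]: "\<phi> k \<in> borel_measurable \<mu>" "\<psi> k \<in> borel_measurable \<nu>" for k
    using S_meas[OF p(1)] by (auto simp: \<phi>_def \<psi>_def)
  have ab: "AE x in \<mu>. \<phi> k x \<le> \<alpha> x" "AE y in \<nu>. \<psi> k y \<le> \<beta> y" for k
    using p(1)[of k] by (auto simp: S_def \<phi>_def \<psi>_def)
  have sum_le: "(\<integral>\<^sup>+x. ennreal ((exp ((\<phi> (Suc k) x - \<alpha> x) / 2) - exp ((\<phi> k x - \<alpha> x) / 2))\<^sup>2) \<partial>\<mu>) +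
      (\<integral>\<^sup>+y. ennreal ((exp ((\<psi> (Suc k) y - \<beta> y) / 2) - exp ((\<psi> k y - \<beta> y) / 2))\<^sup>2) \<partial>\<nu>) \<le> ennreal ((1/4)^k)" for k
  proof -
    let ?a = "(\<integral>x. exp (\<phi> (Suc k) x - \<alpha> x) \<partial>\<mu>) + (\<integral>x. exp (\<phi> k x - \<alpha> x) \<partial>\<mu>) -
      2 * (\<integral>x. exp ((\<phi> (Suc k) x + \<phi> k x) / 2 - \<alpha> x) \<partial>\<mu>)"
    let ?b = "(\<integral>y. exp (\<psi> (Suc k) y - \<beta> y) \<partial>\<nu>) + (\<integral>y. exp (\<psi> k y - \<beta> y) \<partial>\<nu>) -
      2 * (\<integral>y. exp ((\<psi> (Suc k) y + \<psi> k y) / 2 - \<beta> y) \<partial>\<nu>)"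
    have nn: "0 \<le> ?a" "0 \<le> ?b"
      by (intro exp_midpoint_identity M1.prob_space_axioms M2.prob_space_axioms ab; measurable)+
    have eqs: "(\<integral>\<^sup>+x. ennreal ((exp ((\<phi> (Suc k) x - \<alpha> x) / 2) - exp ((\<phi> k x - \<alpha> x) / 2))\<^sup>2) \<partial>\<mu>) = ennreal ?a"
      "(\<integral>\<^sup>+y. ennreal ((exp ((\<psi> (Suc k) y - \<beta> y) / 2) - exp ((\<psi> k y - \<beta> y) / 2))\<^sup>2) \<partial>\<nu>) = ennreal ?b"
      by (intro exp_midpoint_identity M1.prob_space_axioms M2.prob_space_axioms ab; measurable)+
    have "?a + ?b = F (p k) + F (p (Suc k)) - 2 * F (mid (p k) (p (Suc k)))"
      by (simp add: F_def mid_def \<phi>_def \<psi>_def add.commute)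
    then have "?a + ?b \<le> (1/4)^k" using gap[of k] by simp
    then have "ennreal (?a + ?b) \<le> ennreal ((1/4)^k)" by (rule ennreal_leI)
    then show ?thesis unfolding eqs by (simp only: ennreal_plus[OF nn])
  qed
  have c1: "AE x in \<mu>. convergent (\<lambda>k. exp ((\<phi> k x - \<alpha> x) / 2))"
    by (intro AE_convergent_of_L2_differences[OF M1.prob_space_axioms] order_trans[OF _ sum_le]) auto
  have c2: "AE y in \<nu>. convergent (\<lambda>k. exp ((\<psi> k y - \<beta> y) / 2))"
    by (intro AE_convergent_of_L2_differences[OF M2.prob_space_axioms] order_trans[OF _ sum_le]) auto
  show ?thesis
  proof (rule that)
    show "\<phi> k \<in> bounded_borel" "\<psi> k \<in> bounded_borel" "t k \<le> dual_value (\<phi> k) (\<psi> k)" for k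
      using p(1)[of k] incseqD[OF t(1) N(1)[of k]] by (auto simp: S_def \<phi>_def \<psi>_def)
    show "ennreal (\<phi> k x + \<psi> k y) \<le> f k (x, y)" for k x y
      using p(1)[of k] S_mono[OF N(1)[of k]] by (auto simp: S_def \<phi>_def \<psi>_def)
    show "AE x in \<mu>. \<exists>l<\<infinity>. (\<lambda>k. ereal (\<phi> k x)) \<longlonglongrightarrow> l"
      using c1 by eventually_elim (rule ereal_tendsto_of_convergent_exp)
    show "AE y in \<nu>. \<exists>l<\<infinity>. (\<lambda>k. ereal (\<psi> k y)) \<longlonglongrightarrow> l"
      using c2 by eventually_elim (rule ereal_tendsto_of_convergent_exp)
  qed
qed

end

section \<open>Two-sided truncation of extended-valued potentials\<close>

definition clip :: "nat \<Rightarrow> ereal \<Rightarrow> real" where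
  "clip N a = real_of_ereal (max (- ereal (real N)) (min (ereal (real N)) a))"

lemma clip_ereal: "clip N (ereal r) = max (- real N) (min (real N) r)"
  unfolding clip_def by (simp add: max_def min_def)

lemma clip_MInf: "clip N (-\<infinity>) = - real N"
  unfolding clip_def by (simp add: max_def min_def)

lemma clip_PInf: "clip N \<infinity> = real N"
  unfolding clip_def by (simp add: max_def min_def)

lemma abs_clip_le: "\<bar>clip N a\<bar> \<le> real N"
  by (cases a) (auto simp: clip_ereal clip_MInf clip_PInf)

lemma clip_measurable [measurable]: "clip N \<in> borel_measurable borel"
  unfolding clip_def by measurable

lemma clip_bounded_borel: "\<phi> \<in> borel_measurable borel \<Longrightarrow> (\<lambda>x. clip N (\<phi> x)) \<in> bounded_borel"
  by (rule bounded_borelI[OF _ abs_clip_le]) measurable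

text \<open>Clipping can raise a sum, but only up to 0: for real arguments the clipped sum is at
  most the positive part of the sum, and if one argument is -\<infinity> it is at most
  \<open>- real N + real N\<close>. As costs are nonnegative, the constraint survives.\<close>

lemma clip_add_le:
  assumes "a < \<infinity>" "b < \<infinity>" "a + b \<le> enn2ereal c"
  shows "ennreal (clip N a + clip N b) \<le> c"
proof (cases "a = -\<infinity> \<or> b = -\<infinity>")
  case True
  then have "clip N a + clip N b \<le> 0"
    using abs_clip_le[of N a] abs_clip_le[of N b] by (auto simp: clip_MInf)
  then show ?thesis by (simp add: ennreal_neg)
next
  case False
  then obtain r s where rs: "a = ereal r" "b = ereal s" using assms by (cases a; cases b) auto
  have "clip N a + clip N b \<le> max 0 (r + s)"
    unfolding rs clip_ereal by (simp add: max_def min_def)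
  then have "ennreal (clip N a + clip N b) \<le> ennreal (max 0 (r + s))" by (rule ennreal_leI)
  also have "\<dots> \<le> c"
  proof (cases c)
    case (real d)
    then have "r + s \<le> d" using assms(3) rs by (simp add: enn2ereal_ennreal)
    then show ?thesis using real by (auto intro: ennreal_leI)
  qed simp
  finally show ?thesis .
qed

text \<open>\<open>clip N\<close> is odd on the reals and 1-Lipschitz, so the clipped sum is a
  difference of two clipped values whose arguments differ by r + s. This makes the sum of the
  potentials itself the dominating function, even if neither potential is integrable.\<close>

lemma abs_clip_add_le: "\<bar>clip N (ereal r) + clip N (ereal s)\<bar> \<le> \<bar>r + s\<bar>"
  unfolding clip_ereal by (simp add: max_def min_def)

lemma clip_tendsto: "(\<lambda>N. clip N (ereal r)) \<longlonglongrightarrow> r"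
proof (rule tendsto_eventually)
  obtain m :: nat where m: "\<bar>r\<bar> \<le> real m" using real_arch_simple by blast
  have "clip N (ereal r) = r" if "m \<le> N" for N
  proof -
    have "\<bar>r\<bar> \<le> real N" using m that by linarith
    then show ?thesis unfolding clip_ereal by (auto simp: max_def min_def)
  qed
  then show "\<forall>\<^sub>F N in sequentially. clip N (ereal r) = r" by (auto simp: eventually_sequentially)
qed

context polish_marginals
begin

text \<open>Dominated convergence applies to the sum as a whole. The approximating dual values
  involve the marginals only, so the limit is the same for every coupling under which the sum is
  finite almost everywhere and integrable.\<close>

lemma clip_integrals_tendsto:
  assumes \<pi>: "\<pi> \<in> couplings \<mu> \<nu>"
    and m: "\<phi> \<in> borel_measurable borel" "\<psi> \<in> borel_measurable borel"
    and fin: "AE z in \<pi>. \<bar>\<phi> (fst z) + \<psi> (snd z)\<bar> \<noteq> (\<infinity>::ereal)"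
    and int: "integrable \<pi> (\<lambda>z. real_of_ereal (\<phi> (fst z) + \<psi> (snd z)))"
  shows "(\<lambda>N. dual_value (\<lambda>x. clip N (\<phi> x)) (\<lambda>y. clip N (\<psi> y))) \<longlonglongrightarrow>
    (\<integral>z. real_of_ereal (\<phi> (fst z) + \<psi> (snd z)) \<partial>\<pi>)"
proof -
  note b = clip_bounded_borel[OF m(1)] clip_bounded_borel[OF m(2)]
  have reals: "\<exists>r s. \<phi> (fst z) = ereal r \<and> \<psi> (snd z) = ereal s" if "\<bar>\<phi> (fst z) + \<psi> (snd z)\<bar> \<noteq> \<infinity>" for z
    using that by (cases "\<phi> (fst z)"; cases "\<psi> (snd z)") auto
  have "(\<lambda>N. \<integral>z. clip N (\<phi> (fst z)) + clip N (\<psi> (snd z)) \<partial>\<pi>) \<longlonglongrightarrow>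
      (\<integral>z. real_of_ereal (\<phi> (fst z) + \<psi> (snd z)) \<partial>\<pi>)"
  proof (rule integral_dominated_convergence)
    show "integrable \<pi> (\<lambda>z. \<bar>real_of_ereal (\<phi> (fst z) + \<psi> (snd z))\<bar>)" using int by (rule integrable_abs)
    show "(\<lambda>z. clip N (\<phi> (fst z)) + clip N (\<psi> (snd z))) \<in> borel_measurable \<pi>" for N
      using coupling_integral(1)[OF \<pi> b(1)[of N] b(2)[of N]] by auto
    show "AE z in \<pi>. (\<lambda>N. clip N (\<phi> (fst z)) + clip N (\<psi> (snd z))) \<longlonglongrightarrow> real_of_ereal (\<phi> (fst z) + \<psi> (snd z))"
      using fin
    proof eventually_elim
      case (elim z)
      then obtain r s where "\<phi> (fst z) = ereal r" "\<psi> (snd z) = ereal s" using reals[OF elim] by blast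
      then show ?case by (auto intro: tendsto_add clip_tendsto)
    qed
    show "AE z in \<pi>. norm (clip N (\<phi> (fst z)) + clip N (\<psi> (snd z))) \<le> \<bar>real_of_ereal (\<phi> (fst z) + \<psi> (snd z))\<bar>" for N
      using fin
    proof eventually_elim
      case (elim z)
      then obtain r s where "\<phi> (fst z) = ereal r" "\<psi> (snd z) = ereal s" using reals[OF elim] by blast
      then show ?case using abs_clip_add_le by simp
    qed
  qed (use int in auto)
  then show ?thesis by (simp add: coupling_integral(2)[OF \<pi> b])
qed

text \<open>Fatou's lemma for the nonnegative slack \<open>C\<close> minus the sum of potentials
  does two things: dual values cannot drop in the limit, and the limit sum is not -\<infinity> on a
  set of positive plan measure. Both need \<open>C\<close> to have finite integral under the
  plan.\<close>

lemma exists_limit_potentials: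
  fixes \<Phi> :: "nat \<Rightarrow> 'a \<Rightarrow> real" and \<Psi> :: "nat \<Rightarrow> 'b \<Rightarrow> real" and f :: "nat \<Rightarrow> 'a \<times> 'b \<Rightarrow> ennreal"
  assumes \<pi>: "\<pi> \<in> couplings \<mu> \<nu>" and C: "C \<in> borel_measurable borel"
    and fin: "AE z in \<mu> \<Otimes>\<^sub>M \<nu>. C z \<noteq> (\<infinity>::ennreal)" and Cpi: "(\<integral>\<^sup>+z. C z \<partial>\<pi>) < \<infinity>"
    and dec: "\<And>z. decseq (\<lambda>n. f n z)" and fC: "\<And>z. f 0 z \<le> C z"
    and \<Phi>: "\<And>n. \<Phi> n \<in> bounded_borel" and \<Psi>: "\<And>n. \<Psi> n \<in> bounded_borel"
    and le: "\<And>n x y. ennreal (\<Phi> n x + \<Psi> n y) \<le> f n (x, y)"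
    and t: "incseq t" "\<And>n. t n \<le> dual_value (\<Phi> n) (\<Psi> n)"
  obtains \<phi> :: "'a \<Rightarrow> ereal" and \<psi> :: "'b \<Rightarrow> ereal"
  where "\<phi> \<in> borel_measurable borel" "\<psi> \<in> borel_measurable borel" "\<And>x. \<phi> x < \<infinity>" "\<And>y. \<psi> y < \<infinity>"
    "\<And>n x y. \<phi> x + \<psi> y \<le> enn2ereal (f n (x, y))"
    "AE z in \<pi>. \<bar>\<phi> (fst z) + \<psi> (snd z)\<bar> \<noteq> \<infinity>"
    "integrable \<pi> (\<lambda>z. real_of_ereal (\<phi> (fst z) + \<psi> (snd z)))"
    "\<And>n. t n \<le> (\<integral>z. real_of_ereal (\<phi> (fst z) + \<psi> (snd z)) \<partial>\<pi>)"
proof -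
  note cp = coupling_props[OF \<pi>]
  interpret \<pi>: prob_space \<pi> by (rule cp(1))
  have fCn: "f n z \<le> C z" for n z using decseqD[OF dec, of 0 n z] fC[of z] by (auto intro: order_trans)
  obtain s where s: "\<And>n. 1/2 \<le> measure \<mu> {x. \<Phi> n x \<le> s n}" "\<And>n. 1/2 \<le> measure \<mu> {x. s n - 1 \<le> \<Phi> n x}"
    using exists_approx_median[OF M1.prob_space_axioms sets_mu \<Phi>] by metis
  \<comment> \<open>Moving the approximate median from one potential to the other leaves the sum and
    the dual value unchanged and provides the normalization used for the upper bounds.\<close>
  define \<Phi>' where "\<Phi>' n x = - s n + \<Phi> n x" for n x
  define \<Psi>' where "\<Psi>' n y = s n + \<Psi> n y" for n y
  have \<Phi>': "\<Phi>' n \<in> bounded_borel" and \<Psi>': "\<Psi>' n \<in> bounded_borel" for n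
    unfolding \<Phi>'_def \<Psi>'_def by (intro bounded_borel_add bounded_borel_const \<Phi> \<Psi>)+
  have le': "ennreal (\<Phi>' n x + \<Psi>' n y) \<le> f n (x, y)" for n x y using le[of n x y] by (simp add: \<Phi>'_def \<Psi>'_def)
  have t': "t n \<le> dual_value (\<Phi>' n) (\<Psi>' n)" for n
    using t(2)[of n] integrable_mu[OF \<Phi>, of n] integrable_nu[OF \<Psi>, of n]
    by (simp add: \<Phi>'_def \<Psi>'_def M1.prob_space M2.prob_space)
  have s1: "{x. \<Phi>' n x \<le> 0} = {x. \<Phi> n x \<le> s n}" "{x. - 1 \<le> \<Phi>' n x} = {x. s n - 1 \<le> \<Phi> n x}" for n
    unfolding \<Phi>'_def by auto
  have bdd: "AE x in \<mu>. bdd_above (range (\<lambda>n. \<Phi>' n x))" "AE y in \<nu>. bdd_above (range (\<lambda>n. \<Psi>' n y))"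
    by (rule potentials_bdd_above[OF \<pi> C fin Cpi \<Phi>' \<Psi>' order_trans[OF le' fCn] order_trans[OF incseqD[OF t(1) le0] t']];
        use s in \<open>simp add: s1\<close>)+
  obtain u v where u: "\<And>k. u k \<in> bounded_borel" and v: "\<And>k. v k \<in> bounded_borel"
    and uv: "\<And>k x y. ennreal (u k x + v k y) \<le> f k (x, y)"
    and uvt: "\<And>k. t k \<le> dual_value (u k) (v k)"
    and lim: "AE x in \<mu>. \<exists>l < \<infinity>. (\<lambda>k. ereal (u k x)) \<longlonglongrightarrow> l"
      "AE y in \<nu>. \<exists>l < \<infinity>. (\<lambda>k. ereal (v k y)) \<longlonglongrightarrow> l"
    by (rule exists_AE_convergent_potentials[OF dec \<Phi>' \<Psi>' le' t(1) t' bdd]) blast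
  \<comment> \<open>The limit where it exists and is not \<infinity>, and -\<infinity> elsewhere.
    The default satisfies any upper constraint, so admissibility holds at every point and not just
    almost everywhere; upper and lower limits keep the result measurable.\<close>
  define L :: "(nat \<Rightarrow> real) \<Rightarrow> ereal" where
    "L w = (if limsup (\<lambda>k. ereal (w k)) = liminf (\<lambda>k. ereal (w k)) \<and> limsup (\<lambda>k. ereal (w k)) < \<infinity>
        then limsup (\<lambda>k. ereal (w k)) else -\<infinity>)" for w
  have L_less: "L w < \<infinity>" for w by (auto simp: L_def)
  have L_eq: "L w = l" if "(\<lambda>k. ereal (w k)) \<longlonglongrightarrow> l" "l < \<infinity>" for w l
    using that lim_imp_Limsup[OF _ that(1)] lim_imp_Liminf[OF _ that(1)] by (simp add: L_def)
  have L_tendsto: "w \<longlonglongrightarrow> r" if "L w = ereal r" for w r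
  proof -
    have "limsup (\<lambda>k. ereal (w k)) = ereal r" "liminf (\<lambda>k. ereal (w k)) = ereal r"
      using that by (auto simp: L_def split: if_splits)
    then have "(\<lambda>k. ereal (w k)) \<longlonglongrightarrow> ereal r" by (intro Liminf_eq_Limsup) auto
    then show ?thesis by simp
  qed
  define \<phi> where "\<phi> x = L (\<lambda>k. u k x)" for x
  define \<psi> where "\<psi> y = L (\<lambda>k. v k y)" for y
  note [measurable] = bounded_borel_measurable[OF u] bounded_borel_measurable[OF v]
  have m[measurable]: "\<phi> \<in> borel_measurable borel" "\<psi> \<in> borel_measurable borel"
    unfolding \<phi>_def \<psi>_def L_def by measurable
  have less: "\<phi> x < \<infinity>" "\<psi> y < \<infinity>" for x y unfolding \<phi>_def \<psi>_def by (rule L_less)+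
  have adm: "\<phi> x + \<psi> y \<le> enn2ereal (f n (x, y))" for n x y
  proof (cases "\<phi> x = -\<infinity> \<or> \<psi> y = -\<infinity>")
    case True
    then have "\<phi> x + \<psi> y = -\<infinity>"
      using less(1)[of x] less(2)[of y] by (cases "\<phi> x"; cases "\<psi> y") auto
    then show ?thesis by (rule ssubst) simp
  next
    case False
    then obtain r q where rq: "\<phi> x = ereal r" "\<psi> y = ereal q" using less(1)[of x] less(2)[of y] by (cases "\<phi> x"; cases "\<psi> y") auto
    have lims: "(\<lambda>k. u k x + v k y) \<longlonglongrightarrow> r + q"
      using rq unfolding \<phi>_def \<psi>_def by (intro tendsto_add L_tendsto)
    show ?thesis
    proof (cases "f n (x, y)")
      case (real d)
      have "u k x + v k y \<le> d" if "n \<le> k" for k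
      proof -
        have "ennreal (u k x + v k y) \<le> ennreal d"
          using order_trans[OF uv[of k x y] decseqD[OF dec that, of "(x, y)"]] real by simp
        then show ?thesis using real by (simp add: ennreal_le_iff)
      qed
      then have "r + q \<le> d" by (intro LIMSEQ_le_const2[OF lims]) auto
      then show ?thesis using rq real by (simp add: enn2ereal_ennreal)
    qed (simp add: rq)
  qed
  have piC: "C \<in> borel_measurable \<pi>" using C cp(2) by (simp cong: measurable_cong_sets)
  have [measurable]: "fst \<in> \<pi> \<rightarrow>\<^sub>M borel" "snd \<in> \<pi> \<rightarrow>\<^sub>M borel"
    using cp(4,5) measurable_cong_sets[OF refl sets_mu] measurable_cong_sets[OF refl sets_nu] by blast+
  define Cr where "Cr z = enn2real (C z)" for z
  have CAE: "AE z in \<pi>. C z \<noteq> \<infinity>" using piC Cpi by (intro nn_integral_PInf_AE) auto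
  have Cri: "integrable \<pi> Cr"
    unfolding Cr_def using Cpi piC by (intro integrableI_nonneg) (auto simp: ennreal_enn2real_if nn_integral_mono order.strict_trans1[rotated, OF _ nn_integral_mono])
  have [measurable]: "Cr \<in> borel_measurable \<pi>" using Cri by auto
  define g where "g k z = Cr z - (u k (fst z) + v k (snd z))" for k z
  have gi: "integrable \<pi> (g k)" for k
    unfolding g_def by (intro Bochner_Integration.integrable_diff Cri coupling_integral(1)[OF \<pi> u v])
  have g_int: "(\<integral>z. g k z \<partial>\<pi>) \<le> (\<integral>z. Cr z \<partial>\<pi>) - t k" for k
    unfolding g_def using uvt[of k] coupling_integral[OF \<pi> u v, of k k] Cri by simp
  have g0: "AE z in \<pi>. 0 \<le> g k z" for k using CAE
  proof eventually_elim
    case (elim z)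
    then have "ennreal (u k (fst z) + v k (snd z)) \<le> ennreal (Cr z)"
      using order_trans[OF uv fCn, of k "fst z" "snd z"] by (simp add: Cr_def less_top)
    then show ?case by (simp add: g_def Cr_def ennreal_le_iff)
  qed
  define G where "G z = liminf (\<lambda>k. ennreal (g k z))" for z
  have [measurable]: "g k \<in> borel_measurable \<pi>" for k using gi by auto
  \<comment> \<open>From index \<open>n\<close> on the dual values are at least \<open>t n\<close>,
    and a lower limit sees only such tails; hence the bound for each \<open>n\<close>
    separately.\<close>
  have G_int: "(\<integral>\<^sup>+z. G z \<partial>\<pi>) \<le> ennreal ((\<integral>z. Cr z \<partial>\<pi>) - t n)" for n
  proof -
    have "(\<integral>\<^sup>+z. G z \<partial>\<pi>) \<le> liminf (\<lambda>k. \<integral>\<^sup>+z. ennreal (g k z) \<partial>\<pi>)"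
      unfolding G_def by (intro nn_integral_liminf) auto
    also have "\<dots> \<le> liminf (\<lambda>k::nat. ennreal ((\<integral>z. Cr z \<partial>\<pi>) - t n))"
    proof (intro Liminf_mono eventually_sequentiallyI[of n])
      fix k assume "n \<le> k"
      then have "(\<integral>z. g k z \<partial>\<pi>) \<le> (\<integral>z. Cr z \<partial>\<pi>) - t n" using g_int[of k] incseqD[OF t(1), of n k] by simp
      then show "(\<integral>\<^sup>+z. ennreal (g k z) \<partial>\<pi>) \<le> ennreal ((\<integral>z. Cr z \<partial>\<pi>) - t n)"
        using nn_integral_eq_integral[OF gi g0, of k] by (simp add: ennreal_leI)
    qed
    finally show ?thesis by (simp add: Liminf_const)
  qed
  have [measurable]: "G \<in> borel_measurable \<pi>" unfolding G_def by measurable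
  have G_fin: "AE z in \<pi>. G z \<noteq> \<infinity>"
    using G_int[of 0] by (intro nn_integral_PInf_AE) (auto simp: top_unique)
  \<comment> \<open>Null sets of the marginals are null for the plan, so both limits exist there
    almost everywhere. A sum tending to -\<infinity> would drive the slack to \<infinity>,
    contradicting the finiteness of \<open>G\<close>; otherwise the slack converges and
    \<open>G\<close> is its limit.\<close>
  have key: "AE z in \<pi>. \<bar>\<phi> (fst z) + \<psi> (snd z)\<bar> \<noteq> \<infinity> \<and>
      ennreal (Cr z - real_of_ereal (\<phi> (fst z) + \<psi> (snd z))) = G z \<and> real_of_ereal (\<phi> (fst z) + \<psi> (snd z)) \<le> Cr z"
    using coupling_AE(1)[OF \<pi> lim(1)] coupling_AE(2)[OF \<pi> lim(2)] CAE G_fin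
  proof eventually_elim
    case (elim z)
    define x where "x = fst z"
    define y where "y = snd z"
    have lu: "(\<lambda>k. ereal (u k x)) \<longlonglongrightarrow> \<phi> x" and lv: "(\<lambda>k. ereal (v k y)) \<longlonglongrightarrow> \<psi> y"
      using elim(1,2) L_eq unfolding \<phi>_def \<psi>_def x_def y_def by metis+
    have ninf: "\<phi> x + \<psi> y \<noteq> -\<infinity>"
    proof
      assume inf: "\<phi> x + \<psi> y = -\<infinity>"
      have "(\<lambda>k. ereal (u k x) + ereal (v k y)) \<longlonglongrightarrow> \<phi> x + \<psi> y"
        using lu lv less(1)[of x] less(2)[of y] by (intro tendsto_add_ereal_general) auto
      then have ev: "\<forall>\<^sub>F k in sequentially. u k x + v k y < r" for r
        unfolding inf tendsto_MInfty by simp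
      have "(\<lambda>k. ennreal (g k z)) \<longlonglongrightarrow> \<infinity>"
      proof (rule order_tendstoI)
        fix a :: ennreal assume "a < \<infinity>"
        then obtain r where r: "a = ennreal r" "0 \<le> r" by (cases a) auto
        show "\<forall>\<^sub>F k in sequentially. a < ennreal (g k z)"
          using ev[of "Cr z - r"] by eventually_elim (simp add: r g_def x_def y_def ennreal_less_iff)
      qed simp
      then have "G z = \<infinity>" unfolding G_def by (intro lim_imp_Liminf) auto
      then show False using elim(4) by simp
    qed
    then obtain r q where rq: "\<phi> x = ereal r" "\<psi> y = ereal q"
      using less(1)[of x] less(2)[of y] by (cases "\<phi> x"; cases "\<psi> y") auto
    have lims: "u k x + v k y \<le> Cr z" for k
    proof -
      have "ennreal (u k x + v k y) \<le> ennreal (Cr z)"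
        using order_trans[OF uv fCn, of k x y] elim(3) by (simp add: Cr_def less_top x_def y_def)
      then show ?thesis by (simp add: Cr_def ennreal_le_iff)
    qed
    have l: "(\<lambda>k. u k x + v k y) \<longlonglongrightarrow> r + q" using lu lv unfolding rq by (intro tendsto_add) auto
    have "r + q \<le> Cr z" by (intro LIMSEQ_le_const2[OF l]) (use lims in auto)
    moreover have "(\<lambda>k. ennreal (g k z)) \<longlonglongrightarrow> ennreal (Cr z - (r + q))"
      unfolding g_def x_def[symmetric] y_def[symmetric] by (intro tendsto_ennrealI tendsto_diff tendsto_const l)
    then have "G z = ennreal (Cr z - (r + q))" unfolding G_def by (intro lim_imp_Liminf) auto
    ultimately show ?case by (simp add: rq x_def[symmetric] y_def[symmetric])
  qed
  define q where "q z = real_of_ereal (\<phi> (fst z) + \<psi> (snd z))" for z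
  have [measurable]: "q \<in> borel_measurable \<pi>" unfolding q_def by measurable
  have d0: "AE z in \<pi>. 0 \<le> Cr z - q z" using key by eventually_elim (simp add: q_def)
  have dG: "(\<integral>\<^sup>+z. ennreal (Cr z - q z) \<partial>\<pi>) = (\<integral>\<^sup>+z. G z \<partial>\<pi>)"
  proof (rule nn_integral_cong_AE)
    show "AE z in \<pi>. ennreal (Cr z - q z) = G z" using key by eventually_elim (simp add: q_def)
  qed
  have di: "integrable \<pi> (\<lambda>z. Cr z - q z)"
    using d0 dG G_int[of 0] by (intro integrableI_nonneg) (auto simp: top_unique less_top[symmetric])
  have qi: "integrable \<pi> q"
    using Bochner_Integration.integrable_diff[OF Cri di] by simp
  have "t n \<le> (\<integral>z. q z \<partial>\<pi>)" for n
  proof -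
    have "0 \<le> (\<integral>z. g n z \<partial>\<pi>)" using g0 by (intro integral_nonneg_AE)
    then have nn: "0 \<le> (\<integral>z. Cr z \<partial>\<pi>) - t n" using g_int[of n] by simp
    have "ennreal (\<integral>z. Cr z - q z \<partial>\<pi>) \<le> ennreal ((\<integral>z. Cr z \<partial>\<pi>) - t n)"
      using nn_integral_eq_integral[OF di d0] dG G_int[of n] by simp
    then have "(\<integral>z. Cr z - q z \<partial>\<pi>) \<le> (\<integral>z. Cr z \<partial>\<pi>) - t n" using nn by (simp add: ennreal_le_iff)
    then show ?thesis using Cri qi by simp
  qed
  moreover have "AE z in \<pi>. \<bar>\<phi> (fst z) + \<psi> (snd z)\<bar> \<noteq> \<infinity>" using key by eventually_elim simp
  ultimately show ?thesis using that[OF m less adm] qi unfolding q_def by blast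
qed

end

section \<open>Suslin representation of Borel costs\<close>

lemma rect_fun_SUP_finite:
  fixes k :: "'i \<Rightarrow> 'a::topological_space \<times> 'b::topological_space \<Rightarrow> ennreal"
  assumes "finite I" "\<And>i. i \<in> I \<Longrightarrow> rect_fun (k i)"
  shows "rect_fun (\<lambda>z. SUP i\<in>I. k i z)"
  using assms
proof (induction I)
  case empty show ?case by (simp add: rect_fun_const)
next
  case (insert i I)
  then show ?case using rect_fun_compose2[of "k i" "\<lambda>z. SUP i\<in>I. k i z" sup] by simp
qed

lemma rect_fun_INF_finite:
  fixes K :: "('a::topological_space \<times> 'b::topological_space \<Rightarrow> ennreal) set"
  assumes "finite K" "\<And>k. k \<in> K \<Longrightarrow> rect_fun k"
  shows "rect_fun (\<lambda>z. INF k\<in>K. k z)"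
  using assms
proof (induction K)
  case empty show ?case by (simp add: rect_fun_const)
next
  case (insert k K)
  then show ?case using rect_fun_compose2[of k "\<lambda>z. INF k\<in>K. k z" inf] by simp
qed

text \<open>The number \<open>N n\<close> bounds the coordinates of \<open>\<omega>\<close> on which \<open>g n\<close> depends. Compared with the
  usual Suslin operation, suprema and infima are interchanged because costs are minimized.\<close>

definition suslin_scheme ::
  "(nat \<Rightarrow> (nat \<Rightarrow> nat) \<Rightarrow> 'a::topological_space \<times> 'b::topological_space \<Rightarrow> ennreal) \<Rightarrow> (nat \<Rightarrow> nat) \<Rightarrow>
    ('a \<times> 'b \<Rightarrow> ennreal) \<Rightarrow> bool" where
  "suslin_scheme g N f \<longleftrightarrow> (\<forall>n \<omega>. rect_fun (g n \<omega>)) \<and>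
      (\<forall>n \<omega> \<omega>'. (\<forall>i<N n. \<omega> i = \<omega>' i) \<longrightarrow> g n \<omega> = g n \<omega>') \<and> (\<forall>z. f z = (INF \<omega>. SUP n. g n \<omega> z))"

lemma suslin_schemeD:
  assumes "suslin_scheme g N f"
  shows "rect_fun (g n \<omega>)" "(\<And>i. i < N n \<Longrightarrow> \<omega> i = \<omega>' i) \<Longrightarrow> g n \<omega> = g n \<omega>'"
    "f z = (INF \<omega>. SUP n. g n \<omega> z)"
  using assms unfolding suslin_scheme_def by blast+

definition suslin_rect :: "('a::topological_space \<times> 'b::topological_space \<Rightarrow> ennreal) \<Rightarrow> bool" where
  "suslin_rect f \<longleftrightarrow> (\<exists>g N. suslin_scheme g N f)"

lemma suslin_rectI:
  fixes g :: "nat \<Rightarrow> (nat \<Rightarrow> nat) \<Rightarrow> 'a::topological_space \<times> 'b::topological_space \<Rightarrow> ennreal"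
  assumes "\<And>n \<omega>. rect_fun (g n \<omega>)" "\<And>n \<omega> \<omega>'. (\<And>i. i < N n \<Longrightarrow> \<omega> i = \<omega>' i) \<Longrightarrow> g n \<omega> = g n \<omega>'"
    "\<And>z. f z = (INF \<omega>. SUP n. g n \<omega> z)"
  shows "suslin_rect f"
  unfolding suslin_rect_def suslin_scheme_def
proof (intro exI[of _ g] exI[of _ N] conjI allI impI)
  show "g n \<omega> = g n \<omega>'" if "\<forall>i<N n. \<omega> i = \<omega>' i" for n \<omega> \<omega>' using that assms(2) by blast
qed (rule assms)+

lemma suslin_rect_rect_fun: "rect_fun k \<Longrightarrow> suslin_rect k"
  by (rule suslin_rectI[of "\<lambda>_ _. k" "\<lambda>_. 0"]) auto

text \<open>Coordinate 0 of the sequence selects the index \<open>m\<close>, and the shifted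
  sequence feeds the scheme of \<open>F m\<close>. Levels belonging to other indices return 0, which
  is neutral for the supremum. The extra coordinate accounts for the \<open>Suc\<close> in
  \<open>Nh\<close>.\<close>

lemma suslin_rect_INF:
  fixes F :: "nat \<Rightarrow> 'a::topological_space \<times> 'b::topological_space \<Rightarrow> ennreal"
  assumes "\<And>m. suslin_rect (F m)"
  shows "suslin_rect (\<lambda>z. INF m. F m z)"
proof -
  obtain g N where gN: "\<And>m. suslin_scheme (g m) (N m) (F m)"
    using assms unfolding suslin_rect_def by metis
  note g = suslin_schemeD[OF gN]
  define h where "h p \<omega> = (if \<omega> 0 = fst (prod_decode p)
      then g (fst (prod_decode p)) (snd (prod_decode p)) (\<lambda>i. \<omega> (Suc i)) else (\<lambda>_. 0))" for p and \<omega> :: "nat \<Rightarrow> nat"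
  define Nh where "Nh p = Suc (N (fst (prod_decode p)) (snd (prod_decode p)))" for p
  have hs: "(SUP p. h p \<omega> z) = (SUP n. g (\<omega> 0) n (\<lambda>i. \<omega> (Suc i)) z)" for \<omega> z
  proof (rule antisym)
    show "(SUP p. h p \<omega> z) \<le> (SUP n. g (\<omega> 0) n (\<lambda>i. \<omega> (Suc i)) z)"
      by (rule SUP_least) (auto simp: h_def intro: SUP_upper)
    show "(SUP n. g (\<omega> 0) n (\<lambda>i. \<omega> (Suc i)) z) \<le> (SUP p. h p \<omega> z)"
    proof (rule SUP_least)
      fix n
      have "g (\<omega> 0) n (\<lambda>i. \<omega> (Suc i)) z = h (prod_encode (\<omega> 0, n)) \<omega> z" by (simp add: h_def)
      then show "g (\<omega> 0) n (\<lambda>i. \<omega> (Suc i)) z \<le> (SUP p. h p \<omega> z)"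
        by (intro SUP_upper2[of "prod_encode (\<omega> 0, n)"]) auto
    qed
  qed
  show ?thesis
  proof (rule suslin_rectI[of h Nh])
    show "rect_fun (h p \<omega>)" for p \<omega> by (auto simp: h_def g(1) rect_fun_const)
    show "h p \<omega> = h p \<omega>'" if "\<And>i. i < Nh p \<Longrightarrow> \<omega> i = \<omega>' i" for p \<omega> \<omega>'
    proof -
      have "\<omega> 0 = \<omega>' 0" using that[of 0] by (simp add: Nh_def)
      moreover have "g (fst (prod_decode p)) (snd (prod_decode p)) (\<lambda>i. \<omega> (Suc i)) =
          g (fst (prod_decode p)) (snd (prod_decode p)) (\<lambda>i. \<omega>' (Suc i))"
        by (rule g(2)) (use that in \<open>auto simp: Nh_def\<close>)
      ultimately show ?thesis by (simp add: h_def)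
    qed
    show "(INF m. F m z) = (INF \<omega>. SUP p. h p \<omega> z)" for z
      unfolding hs g(3)
    proof (rule antisym)
      show "(INF m. INF \<omega>. SUP n. g m n \<omega> z) \<le> (INF \<omega>. SUP n. g (\<omega> 0) n (\<lambda>i. \<omega> (Suc i)) z)"
      proof (rule INF_greatest)
        fix \<omega> :: "nat \<Rightarrow> nat"
        have "(INF m. INF \<omega>. SUP n. g m n \<omega> z) \<le> (INF \<omega>'. SUP n. g (\<omega> 0) n \<omega>' z)"
          by (rule INF_lower) simp
        also have "\<dots> \<le> (SUP n. g (\<omega> 0) n (\<lambda>i. \<omega> (Suc i)) z)" by (rule INF_lower) simp
        finally show "(INF m. INF \<omega>. SUP n. g m n \<omega> z) \<le> (SUP n. g (\<omega> 0) n (\<lambda>i. \<omega> (Suc i)) z)" .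
      qed
      show "(INF \<omega>. SUP n. g (\<omega> 0) n (\<lambda>i. \<omega> (Suc i)) z) \<le> (INF m. INF \<omega>. SUP n. g m n \<omega> z)"
      proof (intro INF_greatest)
        fix m and \<omega> :: "nat \<Rightarrow> nat"
        have "(INF \<omega>. SUP n. g (\<omega> 0) n (\<lambda>i. \<omega> (Suc i)) z) \<le>
            (SUP n. g (case_nat m \<omega> 0) n (\<lambda>i. case_nat m \<omega> (Suc i)) z)"
          by (rule INF_lower) simp
        then show "(INF \<omega>. SUP n. g (\<omega> 0) n (\<lambda>i. \<omega> (Suc i)) z) \<le> (SUP n. g m n \<omega> z)" by simp
      qed
    qed
  qed
qed

text \<open>One sequence is split by the pairing function into countably many independent ones, one
  for each \<open>F m\<close>. Independence allows the sequences to be chosen separately for all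
  \<open>m\<close>, which is how an infimum of suprema over a common sequence reduces to a supremum
  of infima.\<close>

lemma suslin_rect_SUP:
  fixes F :: "nat \<Rightarrow> 'a::topological_space \<times> 'b::topological_space \<Rightarrow> ennreal"
  assumes "\<And>m. suslin_rect (F m)"
  shows "suslin_rect (\<lambda>z. SUP m. F m z)"
proof -
  obtain g N where gN: "\<And>m. suslin_scheme (g m) (N m) (F m)"
    using assms unfolding suslin_rect_def by metis
  note g = suslin_schemeD[OF gN]
  define h where "h p \<omega> = g (fst (prod_decode p)) (snd (prod_decode p))
      (\<lambda>i. \<omega> (prod_encode (fst (prod_decode p), i)))" for p and \<omega> :: "nat \<Rightarrow> nat"
  \<comment> \<open>The sum dominates every coded position that the scheme reads; the successor
    turns this into the strict inequality demanded of prefixes.\<close>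
  define Nh where "Nh p = Suc (\<Sum>i<N (fst (prod_decode p)) (snd (prod_decode p)). prod_encode (fst (prod_decode p), i))" for p
  show ?thesis
  proof (rule suslin_rectI[of h Nh])
    show "rect_fun (h p \<omega>)" for p \<omega> by (simp add: h_def g(1))
    show "h p \<omega> = h p \<omega>'" if *: "\<And>i. i < Nh p \<Longrightarrow> \<omega> i = \<omega>' i" for p \<omega> \<omega>'
      unfolding h_def
    proof (rule g(2), intro allI impI *)
      fix i assume "i < N (fst (prod_decode p)) (snd (prod_decode p))"
      then have "prod_encode (fst (prod_decode p), i) \<le>
          (\<Sum>i<N (fst (prod_decode p)) (snd (prod_decode p)). prod_encode (fst (prod_decode p), i))"
        by (intro member_le_sum[where f = "\<lambda>i. prod_encode (fst (prod_decode p), i)"]) auto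
      then show "prod_encode (fst (prod_decode p), i) < Nh p" by (simp add: Nh_def)
    qed
    show "(SUP m. F m z) = (INF \<omega>. SUP p. h p \<omega> z)" for z
    proof (rule antisym)
      show "(SUP m. F m z) \<le> (INF \<omega>. SUP p. h p \<omega> z)"
      proof (intro SUP_least INF_greatest)
        fix m and \<omega> :: "nat \<Rightarrow> nat"
        have "F m z \<le> (SUP n. g m n (\<lambda>i. \<omega> (prod_encode (m, i))) z)"
          unfolding g(3) by (rule INF_lower) simp
        also have "\<dots> \<le> (SUP p. h p \<omega> z)"
        proof (rule SUP_least)
          fix n
          have "g m n (\<lambda>i. \<omega> (prod_encode (m, i))) z = h (prod_encode (m, n)) \<omega> z" by (simp add: h_def)
          then show "g m n (\<lambda>i. \<omega> (prod_encode (m, i))) z \<le> (SUP p. h p \<omega> z)"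
            by (intro SUP_upper2[of "prod_encode (m, n)"]) auto
        qed
        finally show "F m z \<le> (SUP p. h p \<omega> z)" .
      qed
      show "(INF \<omega>. SUP p. h p \<omega> z) \<le> (SUP m. F m z)"
      proof (rule dense_ge)
        \<comment> \<open>The infimum defining \<open>F m z\<close> need not be attained; the strict
          bound \<open>v\<close> leaves room to choose a sequence for each \<open>m\<close>.\<close>
        fix v assume v: "(SUP m. F m z) < v"
        have "\<exists>\<omega>. (SUP n. g m n \<omega> z) < v" for m
        proof -
          have "F m z < v" using v SUP_upper[of m UNIV "\<lambda>m. F m z"] by (meson UNIV_I le_less_trans)
          then show ?thesis unfolding g(3) by (simp add: INF_less_iff)
        qed
        then obtain W where W: "\<And>m. (SUP n. g m n (W m) z) < v" by metis
        define \<omega> where "\<omega> i = W (fst (prod_decode i)) (snd (prod_decode i))" for i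
        have "(SUP p. h p \<omega> z) \<le> v"
        proof (rule SUP_least)
          fix p
          have "h p \<omega> z = g (fst (prod_decode p)) (snd (prod_decode p)) (W (fst (prod_decode p))) z"
            by (simp add: h_def \<omega>_def)
          also have "\<dots> \<le> (SUP n. g (fst (prod_decode p)) n (W (fst (prod_decode p))) z)" by (rule SUP_upper) simp
          finally show "h p \<omega> z \<le> v" using W[of "fst (prod_decode p)"] by simp
        qed
        then show "(INF \<omega>. SUP p. h p \<omega> z) \<le> v" by (intro INF_lower2[of \<omega>]) auto
      qed
    qed
  qed
qed

text \<open>The class is closed under countable suprema and infima but comes with no closure under
  complements, so the induction on the generated sigma-algebra treats a set and its complement
  simultaneously.\<close>

lemma suslin_rect_indicator:
  fixes E :: "('a::polish_space \<times> 'b::polish_space) set"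
  assumes "E \<in> sets borel"
  shows "suslin_rect (\<lambda>z. r * indicator E z)"
proof -
  have "E \<in> sigma_sets UNIV {a \<times> b |a b. a \<in> sets (borel :: 'a measure) \<and> b \<in> sets (borel :: 'b measure)}"
    using assms unfolding borel_prod[symmetric] sets_pair_measure by simp
  then have "suslin_rect (\<lambda>z. r * indicator E z) \<and> suslin_rect (\<lambda>z. r * indicator (- E) z)"
  proof (induction E rule: sigma_sets.induct)
    case (Basic E)
    then have E: "rect_fun (\<lambda>z. z \<in> E)" using rect_fun_Times by blast
    have "rect_fun (\<lambda>z. r * indicator E z)" "rect_fun (\<lambda>z. r * indicator (- E) z)"
      using rect_fun_compose[OF E, of "\<lambda>b. r * of_bool b"] rect_fun_compose[OF E, of "\<lambda>b. r * of_bool (\<not> b)"]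
      by (auto simp: indicator_def)
    then show ?case by (auto intro: suslin_rect_rect_fun)
  next
    case Empty
    show ?case by (auto intro!: suslin_rect_rect_fun simp: rect_fun_const)
  next
    case (Compl E)
    then show ?case by (simp add: Compl_eq_Diff_UNIV[symmetric])
  next
    case (Union E)
    have u: "r * indicator (\<Union>i. E i) z = (SUP i. r * indicator (E i) z)" for z
    proof (rule antisym)
      show "r * indicator (\<Union>i. E i) z \<le> (SUP i. r * indicator (E i) z)"
      proof (cases "z \<in> (\<Union>i. E i)")
        case True
        then obtain i where "z \<in> E i" by blast
        then show ?thesis using True by (intro SUP_upper2[of i]) auto
      qed auto
    qed (auto intro!: SUP_least simp: indicator_def)
    have i: "r * indicator (- (\<Union>i. E i)) z = (INF i. r * indicator (- E i) z)" for z
    proof (rule antisym)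
      show "(INF i. r * indicator (- E i) z) \<le> r * indicator (- (\<Union>i. E i)) z"
      proof (cases "z \<in> (\<Union>i. E i)")
        case True
        then obtain i where "z \<in> E i" by blast
        then show ?thesis by (intro INF_lower2[of i]) auto
      next
        case False
        then show ?thesis by (intro INF_lower2[of 0]) (auto simp: indicator_def)
      qed
    qed (auto intro!: INF_greatest simp: indicator_def)
    show ?case unfolding u i using Union.IH by (intro conjI suslin_rect_SUP suslin_rect_INF) blast+
  qed
  then show ?thesis ..
qed

text \<open>A nonnegative function is the supremum, over rational levels, of the level times the
  indicator of the set where the level is reached. Negative rationals become 0 and contribute
  nothing.\<close>

lemma suslin_rect_borel:
  fixes f :: "'a::polish_space \<times> 'b::polish_space \<Rightarrow> ennreal"
  assumes [measurable]: "f \<in> borel_measurable borel"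
  shows "suslin_rect f"
proof -
  define r where "r n = ennreal (real_of_rat (from_nat n))" for n :: nat
  have eq: "f z = (SUP n. r n * indicator {z \<in> space borel. r n \<le> f z} z)" for z
  proof (rule antisym)
    show "f z \<le> (SUP n. r n * indicator {z \<in> space borel. r n \<le> f z} z)"
    proof (rule dense_le)
      fix v assume "v < f z"
      then obtain q where q: "v < ennreal (real_of_rat q)" "ennreal (real_of_rat q) < f z"
        using ennreal_rat_dense by blast
      obtain n where n: "q = from_nat n" using surj_from_nat by (metis surjD)
      show "v \<le> (SUP n. r n * indicator {z \<in> space borel. r n \<le> f z} z)"
        by (rule SUP_upper2[of n]) (use q n in \<open>auto simp: r_def\<close>)
    qed
  qed (auto intro!: SUP_least simp: indicator_def)
  have "suslin_rect (\<lambda>z. SUP n. r n * indicator {z \<in> space borel. r n \<le> f z} z)"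
    by (intro suslin_rect_SUP suslin_rect_indicator) measurable
  moreover have "f = (\<lambda>z. SUP n. r n * indicator {z \<in> space borel. r n \<le> f z} z)" by (rule ext) (rule eq)
  ultimately show ?thesis by (rule ssubst[rotated])
qed

text \<open>Stage \<open>n\<close> alters coordinate \<open>n\<close> only, so coordinate
  \<open>i\<close> is final from stage \<open>Suc i\<close> on. The diagonal of the stages agrees
  with stage \<open>n\<close> on the first \<open>n\<close> coordinates, and \<open>P n\<close>
  looks no further.\<close>

lemma exists_sequence_from_prefixes:
  fixes P :: "nat \<Rightarrow> (nat \<Rightarrow> nat) \<Rightarrow> bool"
  assumes "P 0 b0" and step: "\<And>n b. P n b \<Longrightarrow> \<exists>m. P (Suc n) (b(n := m))"
    and prefix: "\<And>n b b'. P n b \<Longrightarrow> (\<And>i. i < n \<Longrightarrow> b i = b' i) \<Longrightarrow> P n b'"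
  shows "\<exists>b. \<forall>n. P n b"
proof -
  have "\<exists>B. \<forall>n. P n (B n) \<and> (\<exists>m. B (Suc n) = (B n)(n := m))"
  proof (rule dependent_nat_choice)
    show "\<exists>b. P 0 b" using assms(1) by blast
    show "\<exists>b'. P (Suc n) b' \<and> (\<exists>m. b' = b(n := m))" if "P n b" for b n using step[OF that] by blast
  qed
  then obtain B where B: "\<And>n. P n (B n)" "\<And>n. \<exists>m. B (Suc n) = (B n)(n := m)" by blast
  have agree: "B (Suc i) i = B (i + Suc d) i" for i d
  proof (induction d)
    case (Suc d)
    obtain m where "B (Suc (i + Suc d)) = (B (i + Suc d))(i + Suc d := m)" using B(2) by blast
    then show ?case using Suc by simp
  qed simp
  have "P n (\<lambda>i. B (Suc i) i)" for n
  proof (rule prefix[OF B(1)])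
    fix i assume "i < n"
    then obtain d where "n = i + Suc d" using less_imp_Suc_add by auto
    then show "B n i = B (Suc i) i" using agree by simp
  qed
  then show ?thesis by blast
qed

text \<open>Compactness of a product of finite sets, in combinatorial form: among infinitely many
  sequences sharing a prefix, the pigeonhole principle finds infinitely many sharing the next value
  as well, since that value is at most \<open>b n\<close>.\<close>

lemma bounded_sequences_cluster:
  fixes w :: "nat \<Rightarrow> nat \<Rightarrow> nat"
  assumes "\<And>j i. w j i \<le> b i"
  shows "\<exists>\<omega>. \<forall>n. infinite {j. \<forall>i<n. w j i = \<omega> i}"
proof (rule exists_sequence_from_prefixes[where P = "\<lambda>n \<omega>. infinite {j. \<forall>i<n. w j i = \<omega> i}"])
  show "infinite {j. \<forall>i<0. w j i = (\<lambda>_. 0) i}" by simp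
  show "\<exists>m. infinite {j. \<forall>i<Suc n. w j i = fun_upd \<omega> n m i}"
    if inf: "infinite {j. \<forall>i<n. w j i = \<omega> i}" for n \<omega>
  proof -
    let ?A = "{j. \<forall>i<n. w j i = \<omega> i}"
    have "finite ((\<lambda>j. w j n) ` ?A)"
      by (rule finite_subset[of _ "{..b n}"]) (use assms in auto)
    then obtain j0 where "infinite {j \<in> ?A. w j n = w j0 n}"
      using pigeonhole_infinite[OF inf] by blast
    moreover have "{j \<in> ?A. w j n = w j0 n} = {j. \<forall>i<Suc n. w j i = fun_upd \<omega> n (w j0 n) i}"
      by (auto simp: less_Suc_eq)
    ultimately have "infinite {j. \<forall>i<Suc n. w j i = fun_upd \<omega> n (w j0 n) i}" by (simp only: simp_thms)
    then show ?thesis by (rule exI)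
  qed
  show "infinite {j. \<forall>i<n. w j i = b' i}"
    if "infinite {j. \<forall>i<n. w j i = b i}" "\<And>i. i < n \<Longrightarrow> b i = b' i" for n b b'
    using that by simp
qed

section \<open>Capacitability of the dual value\<close>

lemma rect_fun_Union_lessThan:
  fixes R :: "nat \<Rightarrow> ('a::topological_space \<times> 'b::topological_space) set"
  assumes "\<And>i. rect_fun (\<lambda>z. z \<in> R i)"
  shows "rect_fun (\<lambda>z. z \<in> (\<Union>i<j. R i))"
proof (induction j)
  case (Suc j)
  show ?case using rect_fun_compose2[OF Suc assms[of j], of "(\<or>)"] by (simp add: lessThan_Suc disj_commute)
qed (simp add: rect_fun_const)

lemma rect_fun_sum:
  fixes k :: "'i \<Rightarrow> 'a::topological_space \<times> 'b::topological_space \<Rightarrow> ennreal"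
  assumes "\<And>i. rect_fun (k i)"
  shows "rect_fun (\<lambda>z. \<Sum>i\<in>I. k i z)"
proof (induction I rule: infinite_finite_induct)
  case (insert i I)
  then show ?case using rect_fun_compose2[OF assms[of i] insert.IH, of "(+)"] by simp
qed (simp_all add: rect_fun_const)

lemma open_eq_Union_rectangles:
  fixes U :: "('a::polish_space \<times> 'b::polish_space) set"
  assumes "open U"
  obtains R where "\<And>i::nat. rect_fun (\<lambda>z. z \<in> R i)" "U = (\<Union>i. R i)"
proof -
  obtain A :: "'a set set" where A: "countable A" "topological_basis A" using ex_countable_basis by blast
  obtain B :: "'b set set" where B: "countable B" "topological_basis B" using ex_countable_basis by blast
  have "topological_basis ((\<lambda>(a, b). a \<times> b) ` (A \<times> B))" by (rule topological_basis_prod[OF A(2) B(2)])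
  then obtain D where D: "D \<subseteq> (\<lambda>(a, b). a \<times> b) ` (A \<times> B)" "\<Union>D = U"
    using assms unfolding topological_basis_def by meson
  \<comment> \<open>The empty set is added so that the enumeration also makes sense when
    \<open>D\<close> is empty.\<close>
  have cD: "countable (insert {} D)"
    using countable_subset[OF D(1)] A(1) B(1) by simp
  define R where "R = from_nat_into (insert {} D)"
  have rR: "range R = insert {} D" unfolding R_def by (intro range_from_nat_into cD) simp
  have "rect_fun (\<lambda>z. z \<in> R i)" for i
  proof (cases "R i = {}")
    case True then show ?thesis by (simp add: rect_fun_const)
  next
    case False
    then have "R i \<in> D" using rR by blast
    then obtain a b where "R i = a \<times> b" "a \<in> A" "b \<in> B" using D(1) by auto
    then show ?thesis
      using topological_basis_open[OF A(2)] topological_basis_open[OF B(2)] by (simp only:) (intro rect_fun_Times borel_open)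
  qed
  moreover have "U = (\<Union>i. R i)" using D(2) rR by auto
  ultimately show ?thesis by (rule that)
qed

lemma open_outer_approx:
  fixes M :: "'a::{second_countable_topology, complete_space} measure"
  assumes "finite_measure M" "sets M = sets borel" "B \<in> sets borel" "0 < (e::real)"
  shows "\<exists>U. open U \<and> B \<subseteq> U \<and> emeasure M (U - B) \<le> ennreal e"
proof -
  have "- B \<in> sets borel" using assms(3) by auto
  then obtain K where K: "compact K" "K \<subseteq> - B" "emeasure M (- B - K) \<le> ennreal e"
    using compact_inner_approx[OF assms(1,2) _ assms(4)] by blast
  have "- B - K = - K - B" by auto
  then show ?thesis using K compact_imp_closed[OF K(1)] by (intro exI[of _ "- K"]) auto
qed

text \<open>The induction also carries the bound of the count by \<open>n\<close>: when
  \<open>n\<close> itself lies below \<open>r\<close>, the new count is at most n + 1, hence at most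
  r + 1.\<close>

lemma sum_indicator_less_le:
  "(\<Sum>m<n. if of_nat m < (r::ennreal) then 1 else 0) \<le> r + (1::ennreal)"
proof -
  have "(\<Sum>m<n. if of_nat m < r then 1 else 0) \<le> (of_nat n :: ennreal) \<and> (\<Sum>m<n. if of_nat m < r then 1 else 0) \<le> r + (1::ennreal)"
  proof (induction n)
    case (Suc n)
    show ?case
    proof (cases "of_nat n < r")
      case True
      have "(\<Sum>m<Suc n. if of_nat m < r then 1 else 0) \<le> of_nat n + (1::ennreal)"
        using Suc True by (auto simp: add.commute intro: add_mono)
      moreover have "of_nat n + 1 \<le> r + (1::ennreal)" using True by (intro add_right_mono) simp
      ultimately show ?thesis by (auto simp: add.commute intro: order_trans)
    next
      case False
      have "of_nat n \<le> (of_nat (Suc n) :: ennreal)" by simp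
      then show ?thesis using False Suc by (auto intro: order_trans)
    qed
  qed simp
  then show ?thesis ..
qed

context polish_marginals
begin

text \<open>The majorant keeps the decreasing sequences of the capacitability argument below one
  function to which the compactness of dual potentials applies.\<close>

lemma exists_rect_majorant:
  assumes c[measurable]: "c \<in> borel_measurable borel" and fin: "AE z in \<mu> \<Otimes>\<^sub>M \<nu>. c z \<noteq> (\<infinity>::ennreal)"
    and \<pi>: "\<pi> \<in> couplings \<mu> \<nu>" and cpi: "(\<integral>\<^sup>+z. c z \<partial>\<pi>) < \<infinity>"
  obtains \<kappa> where "\<And>j. rect_fun (\<kappa> j)" "\<And>j z. \<kappa> j z < (\<infinity>::ennreal)" "\<And>z. incseq (\<lambda>j. \<kappa> j z)"
    "\<And>z. c z \<le> (SUP j. \<kappa> j z)" "(\<lambda>z. SUP j. \<kappa> j z) \<in> borel_measurable borel"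
    "AE z in \<mu> \<Otimes>\<^sub>M \<nu>. (SUP j. \<kappa> j z) \<noteq> \<infinity>" "(\<integral>\<^sup>+z. (SUP j. \<kappa> j z) \<partial>\<pi>) < \<infinity>"
proof -
  note cp = coupling_props[OF \<pi>]
  interpret \<pi>: prob_space \<pi> by (rule cp(1))
  \<comment> \<open>A layer cake with integer levels: the indicators of all \<open>E m\<close> add
    up to at least \<open>c z\<close> and at most \<open>c z + 1\<close>. Enlarging the levels to
    open sets makes them countable unions of rectangles.\<close>
  define E where "E m = {z. of_nat m < c z}" for m :: nat
  have E: "E m \<in> sets borel" for m
  proof -
    have "{z \<in> space borel. of_nat m < c z} \<in> sets borel" by measurable
    then show ?thesis by (simp add: E_def)
  qed
  \<comment> \<open>The excess is controlled under two measures, which may be mutually singular: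
    under the product for almost everywhere finiteness, under the plan for the finite integral. The
    bounds \<open>(1/2)^m\<close> are summable, so the total excess \<open>S\<close> has finite
    integral under both.\<close>
  have "\<exists>U. open U \<and> E m \<subseteq> U \<and> emeasure (\<mu> \<Otimes>\<^sub>M \<nu>) (U - E m) \<le> ennreal ((1/2)^m) \<and>
      emeasure \<pi> (U - E m) \<le> ennreal ((1/2)^m)" for m
  proof -
    obtain U where U: "open U" "E m \<subseteq> U" "emeasure (\<mu> \<Otimes>\<^sub>M \<nu>) (U - E m) \<le> ennreal ((1/2)^m)"
      using open_outer_approx[OF finite_measure_axioms sets_pair E, of "(1/2)^m"] by auto
    obtain V where V: "open V" "E m \<subseteq> V" "emeasure \<pi> (V - E m) \<le> ennreal ((1/2)^m)"
      using open_outer_approx[OF \<pi>.finite_measure_axioms cp(2) E, of "(1/2)^m"] by auto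
    have "emeasure (\<mu> \<Otimes>\<^sub>M \<nu>) (U \<inter> V - E m) \<le> emeasure (\<mu> \<Otimes>\<^sub>M \<nu>) (U - E m)"
      using U(1) E by (intro emeasure_mono) (auto simp: sets_pair)
    moreover have "emeasure \<pi> (U \<inter> V - E m) \<le> emeasure \<pi> (V - E m)"
      using V(1) E by (intro emeasure_mono) (auto simp: cp(2))
    ultimately show ?thesis using U V by (intro exI[of _ "U \<inter> V"]) (auto intro: order_trans)
  qed
  then obtain U where U: "\<And>m. open (U m)" "\<And>m. E m \<subseteq> U m"
    "\<And>m. emeasure (\<mu> \<Otimes>\<^sub>M \<nu>) (U m - E m) \<le> ennreal ((1/2)^m)" "\<And>m. emeasure \<pi> (U m - E m) \<le> ennreal ((1/2)^m)"
    by metis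
  have "\<exists>R::nat \<Rightarrow> _. (\<forall>i. rect_fun (\<lambda>z. z \<in> R i)) \<and> U m = (\<Union>i. R i)" for m
    using open_eq_Union_rectangles[OF U(1)] by metis
  then obtain R :: "nat \<Rightarrow> nat \<Rightarrow> ('a \<times> 'b) set" where R: "\<And>m i. rect_fun (\<lambda>z. z \<in> R m i)" "\<And>m. U m = (\<Union>i. R m i)" by metis
  \<comment> \<open>The index \<open>j\<close> limits both the number of levels and the number of
    rectangles in each, which makes every \<open>\<kappa> j\<close> finite and the sequence
    increasing.\<close>
  define \<kappa> where "\<kappa> j z = (\<Sum>m<j. indicator (\<Union>i<j. R m i) z :: ennreal)" for j z
  define S where "S z = (\<Sum>m. indicator (U m - E m) z :: ennreal)" for z
  have rect: "rect_fun (\<kappa> j)" for j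
  proof -
    have "rect_fun (\<lambda>z. indicator (\<Union>i<j. R m i) z :: ennreal)" for m
      using rect_fun_compose[OF rect_fun_Union_lessThan[of "R m" j, OF R(1)], of "of_bool :: bool \<Rightarrow> ennreal"]
      by (simp add: indicator_def)
    then show ?thesis unfolding \<kappa>_def by (rule rect_fun_sum)
  qed
  have finite: "\<kappa> j z < \<infinity>" for j z
  proof -
    have "\<kappa> j z \<le> (\<Sum>m<j. 1)" unfolding \<kappa>_def by (intro sum_mono) (auto simp: indicator_def)
    also have "\<dots> < \<infinity>" by (simp add: of_nat_less_top)
    finally show ?thesis .
  qed
  have inc: "incseq (\<lambda>j. \<kappa> j z)" for z
  proof (rule incseq_SucI)
    fix j
    have "(\<Sum>m<j. indicator (\<Union>i<j. R m i) z :: ennreal) \<le> (\<Sum>m<j. indicator (\<Union>i<Suc j. R m i) z)"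
      by (intro sum_mono) (auto simp: indicator_def less_Suc_eq)
    also have "\<dots> \<le> (\<Sum>m<Suc j. indicator (\<Union>i<Suc j. R m i) z)" by simp
    finally show "\<kappa> j z \<le> \<kappa> (Suc j) z" unfolding \<kappa>_def .
  qed
  have upper: "(SUP j. \<kappa> j z) \<le> c z + 1 + S z" for z
  proof (rule SUP_least)
    fix j
    have "\<kappa> j z \<le> (\<Sum>m<j. indicator (U m) z)"
      unfolding \<kappa>_def by (intro sum_mono) (auto simp: indicator_def R(2))
    also have "\<dots> = (\<Sum>m<j. indicator (E m) z + indicator (U m - E m) z)"
      using U(2) by (intro sum.cong) (auto simp: indicator_def)
    also have "\<dots> = (\<Sum>m<j. if of_nat m < c z then 1 else 0) + (\<Sum>m<j. indicator (U m - E m) z)"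
      by (simp add: sum.distrib E_def indicator_def of_bool_def)
    also have "\<dots> \<le> c z + 1 + S z"
      unfolding S_def by (intro add_mono sum_indicator_less_le sum_le_suminf) auto
    finally show "\<kappa> j z \<le> c z + 1 + S z" .
  qed
  have lower: "c z \<le> (SUP j. \<kappa> j z)" for z
  proof (rule ccontr)
    assume "\<not> ?thesis"
    then have less: "(SUP j. \<kappa> j z) < c z" by simp
    then have "(SUP j. \<kappa> j z) < top" by (meson le_less_trans order_less_le_trans top_greatest)
    then obtain r where r: "0 \<le> r" "(SUP j. \<kappa> j z) = ennreal r" by (auto simp: less_top_ennreal)
    \<comment> \<open>All levels below \<open>M\<close> are at most \<open>r\<close>, hence below
      \<open>c z\<close>, so \<open>z\<close> lies in \<open>M\<close> of the open sets. Once
      \<open>j\<close> captures the relevant rectangles, \<open>\<kappa> j\<close> counts to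
      \<open>M\<close>, which exceeds \<open>r\<close>.\<close>
    define M where "M = Suc (nat \<lfloor>r\<rfloor>)"
    have rM: "r < real M" unfolding M_def using r(1) by linarith
    have "z \<in> U m" if "m < M" for m
    proof -
      have "real m \<le> real (nat \<lfloor>r\<rfloor>)" using that by (simp add: M_def)
      also have "\<dots> \<le> r" by (rule of_nat_floor[OF r(1)])
      finally have "ennreal (real m) \<le> ennreal r" by (rule ennreal_leI)
      then have "ennreal (real m) < c z" using less unfolding r(2) by (rule le_less_trans)
      then have "of_nat m < c z" by (simp add: ennreal_of_nat_eq_real_of_nat)
      then show ?thesis using U(2) by (auto simp: E_def)
    qed
    then have "\<exists>i. z \<in> R m i" if "m < M" for m using R(2) that by blast
    then obtain I where I: "\<And>m. m < M \<Longrightarrow> z \<in> R m (I m)" by metis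
    define j where "j = Suc (M + (\<Sum>m<M. I m))"
    have "I m < j" if "m < M" for m
    proof -
      have "I m \<le> (\<Sum>m<M. I m)" using that by (intro member_le_sum) auto
      then show ?thesis unfolding j_def by simp
    qed
    then have "z \<in> (\<Union>i<j. R m i)" if "m < M" for m using I[OF that] that by blast
    then have "ennreal (real M) = (\<Sum>m<M. indicator (\<Union>i<j. R m i) z)"
      by (simp add: ennreal_of_nat_eq_real_of_nat)
    also have "\<dots> \<le> \<kappa> j z" unfolding \<kappa>_def by (intro sum_mono2) (auto simp: j_def)
    also have "\<dots> \<le> ennreal r" unfolding r(2)[symmetric] by (rule SUP_upper) simp
    finally show False using rM r(1) by (simp add: ennreal_le_iff)
  qed
  have [measurable]: "U m - E m \<in> sets borel" for m using U(1) E by auto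
  have S_int: "(\<integral>\<^sup>+z. S z \<partial>M) < \<infinity>"
    if M: "sets M = sets borel" "\<And>m. emeasure M (U m - E m) \<le> ennreal ((1/2)^m)" for M
  proof -
    have "U m - E m \<in> sets M" for m unfolding M(1) by measurable
    then have "(\<integral>\<^sup>+z. S z \<partial>M) = (\<Sum>m. emeasure M (U m - E m))"
      unfolding S_def by (subst nn_integral_suminf) auto
    also have "\<dots> \<le> (\<Sum>m. ennreal ((1/2)^m))" by (intro suminf_le M) auto
    also have "\<dots> = ennreal (\<Sum>m. (1/2)^m)" by (intro suminf_ennreal2 summable_geometric) auto
    also have "\<dots> < \<infinity>" by simp
    finally show ?thesis .
  qed
  have Sm: "S \<in> borel_measurable borel" unfolding S_def by measurable
  have mb: "f \<in> borel_measurable M" if "f \<in> borel_measurable borel" "sets M = sets borel"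
    for f :: "'a \<times> 'b \<Rightarrow> ennreal" and M using that by (simp cong: measurable_cong_sets)
  show ?thesis
  proof (rule that[OF rect finite inc lower])
    have "\<kappa> j \<in> borel_measurable borel" for j
    proof -
      have "(\<lambda>z. id (\<kappa> j z)) \<in> borel_measurable borel"
        by (rule measurable_compose[OF rect_fun_measurable[OF rect]]) simp
      then show ?thesis by simp
    qed
    then show "(\<lambda>z. SUP j. \<kappa> j z) \<in> borel_measurable borel" by measurable
    have "AE z in \<mu> \<Otimes>\<^sub>M \<nu>. S z \<noteq> \<infinity>"
      using S_int[OF sets_pair U(3)] by (intro nn_integral_PInf_AE mb[OF Sm sets_pair]) auto
    with fin show "AE z in \<mu> \<Otimes>\<^sub>M \<nu>. (SUP j. \<kappa> j z) \<noteq> \<infinity>"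
    proof eventually_elim
      case (elim z)
      then have "c z + 1 + S z < top" by (simp add: less_top)
      then have "(SUP j. \<kappa> j z) < top" by (rule le_less_trans[OF upper])
      then show ?case by (metis infinity_ennreal_def less_irrefl)
    qed
    have "(\<integral>\<^sup>+z. (SUP j. \<kappa> j z) \<partial>\<pi>) \<le> (\<integral>\<^sup>+z. c z + 1 + S z \<partial>\<pi>)" by (intro nn_integral_mono upper)
    also have "\<dots> = (\<integral>\<^sup>+z. c z \<partial>\<pi>) + 1 + (\<integral>\<^sup>+z. S z \<partial>\<pi>)"
      using mb[OF c cp(2)] mb[OF Sm cp(2)] by (simp add: nn_integral_add \<pi>.emeasure_space_1)
    also have "\<dots> < \<infinity>" using cpi S_int[OF cp(2) U(4)] by simp
    finally show "(\<integral>\<^sup>+z. (SUP j. \<kappa> j z) \<partial>\<pi>) < \<infinity>" .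
  qed
qed

text \<open>A predicate in place of a supremum of dual values: no finiteness of that supremum has to
  be settled, and strict slack between bounds can be handled with real numbers.\<close>

definition dual_bound :: "('a \<times> 'b \<Rightarrow> ennreal) \<Rightarrow> real \<Rightarrow> bool" where
  "dual_bound f t \<longleftrightarrow> (\<forall>\<phi>\<in>bounded_borel. \<forall>\<psi>\<in>bounded_borel.
      (\<forall>x y. ennreal (\<phi> x + \<psi> y) \<le> f (x, y)) \<longrightarrow> dual_value \<phi> \<psi> \<le> t)"

lemma dual_boundD:
  "dual_bound f t \<Longrightarrow> \<phi> \<in> bounded_borel \<Longrightarrow> \<psi> \<in> bounded_borel \<Longrightarrow> (\<And>x y. ennreal (\<phi> x + \<psi> y) \<le> f (x, y)) \<Longrightarrow>
    dual_value \<phi> \<psi> \<le> t"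
  unfolding dual_bound_def by blast

text \<open>Were the dual values to stay above \<open>t'\<close> along the sequence, the limit of
  such pairs would be admissible for every \<open>f n\<close> and hence for their infimum. Its
  truncations would be bounded pairs whose dual values converge to at least \<open>t'\<close>, past
  the bound \<open>t\<close>.\<close>

lemma dual_bound_decseq:
  fixes f :: "nat \<Rightarrow> 'a \<times> 'b \<Rightarrow> ennreal"
  assumes \<pi>: "\<pi> \<in> couplings \<mu> \<nu>" and C: "C \<in> borel_measurable borel"
    and fin: "AE z in \<mu> \<Otimes>\<^sub>M \<nu>. C z \<noteq> (\<infinity>::ennreal)" and Cpi: "(\<integral>\<^sup>+z. C z \<partial>\<pi>) < \<infinity>"
    and dec: "\<And>z. decseq (\<lambda>n. f n z)" and fC: "\<And>z. f 0 z \<le> C z"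
    and bound: "dual_bound (\<lambda>z. INF n. f n z) t" and "t < t'"
  shows "\<exists>n. dual_bound (f n) t'"
proof (rule ccontr)
  assume "\<not> ?thesis"
  then have "\<forall>n. \<exists>\<phi> \<psi>. \<phi> \<in> bounded_borel \<and> \<psi> \<in> bounded_borel \<and> (\<forall>x y. ennreal (\<phi> x + \<psi> y) \<le> f n (x, y)) \<and>
      t' < dual_value \<phi> \<psi>"
    unfolding dual_bound_def by (meson not_le)
  then obtain \<Phi> \<Psi> where P: "\<And>n. \<Phi> n \<in> bounded_borel" "\<And>n. \<Psi> n \<in> bounded_borel"
    "\<And>n x y. ennreal (\<Phi> n x + \<Psi> n y) \<le> f n (x, y)" "\<And>n. t' < dual_value (\<Phi> n) (\<Psi> n)"
    by metis
  obtain \<phi> :: "'a \<Rightarrow> ereal" and \<psi> :: "'b \<Rightarrow> ereal" where lim: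
    "\<phi> \<in> borel_measurable borel" "\<psi> \<in> borel_measurable borel" "\<And>x. \<phi> x < \<infinity>" "\<And>y. \<psi> y < \<infinity>"
    "\<And>n x y. \<phi> x + \<psi> y \<le> enn2ereal (f n (x, y))"
    "AE z in \<pi>. \<bar>\<phi> (fst z) + \<psi> (snd z)\<bar> \<noteq> \<infinity>"
    "integrable \<pi> (\<lambda>z. real_of_ereal (\<phi> (fst z) + \<psi> (snd z)))"
    "t' \<le> (\<integral>z. real_of_ereal (\<phi> (fst z) + \<psi> (snd z)) \<partial>\<pi>)"
    by (rule exists_limit_potentials[OF \<pi> C fin Cpi dec fC P(1-3), of "\<lambda>_. t'"]) (use less_imp_le[OF P(4)] in \<open>auto simp: incseq_def\<close>)
  have "dual_value (\<lambda>x. clip N (\<phi> x)) (\<lambda>y. clip N (\<psi> y)) \<le> t" for N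
    using bound clip_bounded_borel[OF lim(1)] clip_bounded_borel[OF lim(2)]
    by (rule dual_boundD) (intro INF_greatest clip_add_le lim)
  then have "(\<integral>z. real_of_ereal (\<phi> (fst z) + \<psi> (snd z)) \<partial>\<pi>) \<le> t"
    by (intro LIMSEQ_le_const2[OF clip_integrals_tendsto[OF \<pi> lim(1,2,6,7)]]) auto
  then show False using lim(8) \<open>t < t'\<close> by simp
qed


text \<open>Choquet's capacitability argument: the best dual value is continuous along decreasing
  sequences, so the Suslin representation of \<open>c\<close> can be cut down to compact boxes without
  raising the dual value much. On boxes only functions on finite partitions occur.\<close>

lemma Pcost_le_of_dual_bound:
  assumes c: "c \<in> borel_measurable borel" and fin: "AE z in \<mu> \<Otimes>\<^sub>M \<nu>. c z \<noteq> (\<infinity>::ennreal)"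
    and \<pi>: "\<pi> \<in> couplings \<mu> \<nu>" and cpi: "(\<integral>\<^sup>+z. c z \<partial>\<pi>) < \<infinity>"
    and bound: "dual_bound c t"
  shows "Pcost \<mu> \<nu> c \<le> ennreal t"
proof -
  obtain \<kappa> where \<kappa>: "\<And>j. rect_fun (\<kappa> j)" "\<And>j z. \<kappa> j z < (\<infinity>::ennreal)" "\<And>z. incseq (\<lambda>j. \<kappa> j z)"
    "\<And>z. c z \<le> (SUP j. \<kappa> j z)" and Cm: "(\<lambda>z. SUP j. \<kappa> j z) \<in> borel_measurable borel"
    and Cfin: "AE z in \<mu> \<Otimes>\<^sub>M \<nu>. (SUP j. \<kappa> j z) \<noteq> \<infinity>" and Cpi: "(\<integral>\<^sup>+z. (SUP j. \<kappa> j z) \<partial>\<pi>) < \<infinity>"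
    by (rule exists_rect_majorant[OF c fin \<pi> cpi]) blast
  define C where "C z = (SUP j. \<kappa> j z)" for z
  obtain g N where gN: "suslin_scheme g N c" using suslin_rect_borel[OF c] unfolding suslin_rect_def by blast
  note g = suslin_schemeD[OF gN]
  have gz: "g n \<omega> z = g n \<omega>' z" if "\<And>i. i < N n \<Longrightarrow> \<omega> i = \<omega>' i" for n \<omega> \<omega>' z
    using g(2)[of n \<omega> \<omega>'] that by simp
  define box where "box n b = {\<omega> :: nat \<Rightarrow> nat. \<forall>i<n. \<omega> i \<le> b i}" for n :: nat and b :: "nat \<Rightarrow> nat"
  \<comment> \<open>Capping by the majorant \<open>C\<close> gives the decreasing sequences the
    common upper function that continuity requires. At the start the cap has no effect, as
    \<open>c\<close> lies below \<open>C\<close>.\<close>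
  define F where "F n b z = min (C z) (INF \<omega>\<in>box n b. SUP m. g m \<omega> z)" for n b z
  \<comment> \<open>As the bound \<open>m\<close> on the next coordinate grows, the boxes increase
    to the previous box and the costs decrease to \<open>F n b\<close>. Raising the dual bound only
    to the midpoint of \<open>s\<close> and \<open>T\<close> keeps it strictly below
    \<open>T\<close>, so the step can be repeated forever.\<close>
  have step: "\<exists>m. \<exists>s<T. dual_bound (F (Suc n) (b(n := m))) s" if s: "s < T" "dual_bound (F n b) s" for n b s T
  proof -
    have mono: "box (Suc n) (b(n := m)) \<subseteq> box (Suc n) (b(n := m'))" if "m \<le> m'" for m m'
      using that by (auto simp: box_def less_Suc_eq)
    have un: "(\<Union>m. box (Suc n) (b(n := m))) = box n b"
    proof (intro subset_antisym subsetI)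
      fix \<omega> assume "\<omega> \<in> box n b"
      then have "\<omega> \<in> box (Suc n) (b(n := \<omega> n))" by (auto simp: box_def less_Suc_eq)
      then show "\<omega> \<in> (\<Union>m. box (Suc n) (b(n := m)))" by blast
    qed (auto simp: box_def less_Suc_eq)
    have "(INF m. F (Suc n) (b(n := m)) z) = F n b z" for z
    proof -
      have "(INF m. F (Suc n) (b(n := m)) z) =
          min (C z) (INF m. INF \<omega>\<in>box (Suc n) (b(n := m)). SUP i. g i \<omega> z)"
        unfolding F_def inf_min[symmetric] by (simp add: INF_inf_distrib[symmetric])
      also have "(INF m. INF \<omega>\<in>box (Suc n) (b(n := m)). SUP i. g i \<omega> z) = (INF \<omega>\<in>box n b. SUP i. g i \<omega> z)"
        unfolding un[symmetric]
      proof (intro antisym INF_greatest)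
        fix \<omega> assume "\<omega> \<in> (\<Union>m. box (Suc n) (b(n := m)))"
        then obtain m where m: "\<omega> \<in> box (Suc n) (b(n := m))" by blast
        have "(INF m. INF \<omega>\<in>box (Suc n) (b(n := m)). SUP i. g i \<omega> z) \<le>
            (INF \<omega>\<in>box (Suc n) (b(n := m)). SUP i. g i \<omega> z)" by (rule INF_lower) simp
        also have "\<dots> \<le> (SUP i. g i \<omega> z)" by (rule INF_lower[OF m])
        finally show "(INF m. INF \<omega>\<in>box (Suc n) (b(n := m)). SUP i. g i \<omega> z) \<le> (SUP i. g i \<omega> z)" .
      qed (auto intro!: INF_lower)
      finally show ?thesis by (simp only: F_def)
    qed
    then have "dual_bound (\<lambda>z. INF m. F (Suc n) (b(n := m)) z) s" using s(2) by simp
    moreover have "decseq (\<lambda>m. F (Suc n) (b(n := m)) z)" for z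
      unfolding F_def decseq_def by (intro allI impI min.mono INF_superset_mono mono) auto
    moreover have "F (Suc n) (b(n := 0)) z \<le> (SUP j. \<kappa> j z)" for z by (simp add: F_def C_def)
    moreover have "s < (s + T) / 2" using s(1) by simp
    ultimately obtain m where "dual_bound (F (Suc n) (b(n := m))) ((s + T) / 2)"
      using dual_bound_decseq[OF \<pi> Cm Cfin Cpi, of "\<lambda>m. F (Suc n) (b(n := m))"] by blast
    moreover have "(s + T) / 2 < T" using s(1) by simp
    ultimately show ?thesis by blast
  qed
  have main: "\<exists>\<pi>'\<in>couplings \<mu> \<nu>. (\<integral>\<^sup>+z. c z \<partial>\<pi>') \<le> ennreal T" if tT: "t < T" for T
  proof -
    have "\<exists>b. \<forall>n. \<exists>s<T. dual_bound (F n b) s"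
    proof (rule exists_sequence_from_prefixes[where P = "\<lambda>n b. \<exists>s<T. dual_bound (F n b) s"])
      have "F 0 (\<lambda>_. 0) = c"
        unfolding F_def using \<kappa>(4) g(3) by (intro ext) (simp add: box_def C_def min_absorb2)
      then show "\<exists>s<T. dual_bound (F 0 (\<lambda>_. 0)) s" using bound tT by auto
      show "\<exists>m. \<exists>s<T. dual_bound (F (Suc n) (b(n := m))) s" if "\<exists>s<T. dual_bound (F n b) s" for n b
        using step that by blast
      show "\<exists>s<T. dual_bound (F n b') s" if "\<exists>s<T. dual_bound (F n b) s" "\<And>i. i < n \<Longrightarrow> b i = b' i" for n b b'
      proof -
        have "box n b = box n b'" using that(2) by (auto simp: box_def)
        then have "F n b = F n b'" by (simp add: F_def fun_eq_iff)
        then show ?thesis using that(1) by simp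
      qed
    qed
    then obtain b where b: "\<And>n. \<exists>s<T. dual_bound (F n b) s" by blast
    \<comment> \<open>The limit of the boxes: a product of finite sets, the compact set of Choquet's
      argument.\<close>
    define \<Omega> where "\<Omega> = {\<omega> :: nat \<Rightarrow> nat. \<forall>i. \<omega> i \<le> b i}"
    define h where "h j \<omega> z = (SUP m\<in>{..<j}. g m \<omega> z)" for j \<omega> z
    define K where "K j z = (INF \<omega>\<in>\<Omega>. h j \<omega> z)" for j z
    define L where "L j = (\<Sum>m<j. N m)" for j
    have NL: "N m \<le> L j" if "m < j" for m j unfolding L_def using that by (intro member_le_sum) auto
    \<comment> \<open>The functions \<open>g m\<close> with m < j read only the first
      \<open>L j\<close> coordinates, so zeroing the others does not affect \<open>h j\<close>. It
      leaves finitely many functions \<open>h j \<omega>\<close> on \<open>\<Omega>\<close> and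
      carries any sequence in \<open>box (L j) b\<close> into \<open>\<Omega>\<close>.\<close>
    define cut where "cut j \<omega> i = (if i < L j then \<omega> i else 0)" for j and \<omega> :: "nat \<Rightarrow> nat" and i
    have h_cut: "h j (cut j \<omega>) = h j \<omega>" for j \<omega>
    proof -
      have "g m (cut j \<omega>) z = g m \<omega> z" if "m < j" for m z
        by (rule gz) (use NL[OF that] in \<open>auto simp: cut_def\<close>)
      then show ?thesis unfolding h_def by (intro ext SUP_cong) auto
    qed
    have ne: "\<Omega> \<noteq> {}" by (auto simp: \<Omega>_def intro: exI[of _ "\<lambda>_. 0"])
    have fin_h: "finite (h j ` \<Omega>)" for j
    proof -
      have "cut j ` \<Omega> \<subseteq> {f. \<forall>i. (i \<in> {..<L j} \<longrightarrow> f i \<in> {..\<Sum>i<L j. b i}) \<and> (i \<notin> {..<L j} \<longrightarrow> f i = 0)}"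
      proof (intro subsetI CollectI allI conjI impI)
        fix f i assume f: "f \<in> cut j ` \<Omega>" "i \<in> {..<L j}"
        then have "f i \<le> b i" by (auto simp: cut_def \<Omega>_def)
        also have "b i \<le> (\<Sum>i<L j. b i)" using f(2) by (intro member_le_sum) auto
        finally show "f i \<in> {..\<Sum>i<L j. b i}" by simp
      qed (auto simp: cut_def)
      then have "finite (cut j ` \<Omega>)" by (rule finite_subset) (intro finite_set_of_finite_funs; simp)
      then have "finite (h j ` cut j ` \<Omega>)" by (rule finite_imageI)
      then show ?thesis by (simp add: image_image h_cut)
    qed
    have rect_K: "rect_fun (K j)" for j
    proof -
      have "rect_fun (\<lambda>z. INF k\<in>h j ` \<Omega>. k z)"
      proof (rule rect_fun_INF_finite[OF fin_h])
        fix k assume "k \<in> h j ` \<Omega>"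
        then obtain \<omega> where "k = h j \<omega>" by blast
        then show "rect_fun k" unfolding h_def by (simp add: rect_fun_SUP_finite g(1))
      qed
      then show ?thesis unfolding K_def by (simp add: image_image)
    qed
    have K_inc: "incseq (\<lambda>j. K j z)" for z
      unfolding K_def h_def incseq_def by (intro allI impI INF_mono' SUP_subset_mono) auto
    have K_le: "K j z \<le> (INF \<omega>\<in>box (L j) b. SUP m. g m \<omega> z)" for j z
    proof (rule INF_greatest)
      fix \<omega> assume "\<omega> \<in> box (L j) b"
      then have "cut j \<omega> \<in> \<Omega>" by (auto simp: box_def \<Omega>_def cut_def)
      then have "K j z \<le> h j (cut j \<omega>) z" unfolding K_def by (rule INF_lower)
      also have "\<dots> \<le> (SUP m. g m \<omega> z)" unfolding h_cut unfolding h_def by (intro SUP_subset_mono) auto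
      finally show "K j z \<le> (SUP m. g m \<omega> z)" .
    qed
    \<comment> \<open>This exchanges the supremum over \<open>j\<close> with the infimum over
      \<open>\<Omega>\<close>. Finiteness provides a minimizer \<open>w j\<close> for each
      \<open>j\<close>; a cluster sequence of the minimizers shares every prefix with infinitely
      many of them, and each \<open>g m\<close> depends on a prefix only.\<close>
    have c_le: "c z \<le> (SUP j. K j z)" for z
    proof -
      have "\<exists>\<omega>\<in>\<Omega>. h j \<omega> z = K j z" for j
      proof -
        have "finite ((\<lambda>\<omega>. h j \<omega> z) ` \<Omega>)"
          using finite_imageI[OF fin_h[of j], of "\<lambda>k. k z"] by (simp add: image_image)
        then have "K j z = Min ((\<lambda>\<omega>. h j \<omega> z) ` \<Omega>)" unfolding K_def using ne by (simp add: cInf_eq_Min)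
        then have "K j z \<in> (\<lambda>\<omega>. h j \<omega> z) ` \<Omega>"
          using Min_in[OF \<open>finite ((\<lambda>\<omega>. h j \<omega> z) ` \<Omega>)\<close>] ne by simp
        then show ?thesis by auto
      qed
      then obtain w where w: "\<And>j. w j \<in> \<Omega>" "\<And>j. h j (w j) z = K j z" by metis
      obtain \<omega> where \<omega>: "\<And>n. infinite {j. \<forall>i<n. w j i = \<omega> i}"
        using bounded_sequences_cluster[of w b] w(1) unfolding \<Omega>_def by blast
      have "g m \<omega> z \<le> (SUP j. K j z)" for m
      proof -
        obtain j where j: "m < j" "\<forall>i<N m. w j i = \<omega> i"
          using \<omega>[of "N m"] unfolding infinite_nat_iff_unbounded by blast
        have "g m \<omega> z = g m (w j) z" by (rule gz) (use j in auto)
        also have "\<dots> \<le> h j (w j) z" unfolding h_def using j(1) by (intro SUP_upper) simp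
        also have "\<dots> \<le> (SUP j. K j z)" unfolding w(2) by (rule SUP_upper) simp
        finally show ?thesis .
      qed
      then have "(SUP m. g m \<omega> z) \<le> (SUP j. K j z)" by (intro SUP_least)
      then show ?thesis unfolding g(3) by (intro INF_lower2[of \<omega>]) auto
    qed
    \<comment> \<open>The minimum with \<open>\<kappa> j\<close> makes the function real-valued. In
      the limit nothing is lost, since both increasing sequences have suprema above
      \<open>c\<close>.\<close>
    define k where "k j z = min (K j z) (\<kappa> j z)" for j z
    have k_fin: "k j z < top" for j z using \<kappa>(2)[of j z] by (simp add: k_def min_less_iff_disj)
    have k_inc: "incseq (\<lambda>j. k j z)" for z
      unfolding k_def incseq_def by (intro allI impI min.mono incseqD[OF K_inc] incseqD[OF \<kappa>(3)])
    have k_real: "ennreal (enn2real (k j z)) = k j z" for j z using k_fin by simp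
    have "\<exists>\<pi>'\<in>couplings \<mu> \<nu>. \<forall>j. (\<integral>\<^sup>+z. ennreal (enn2real (k j z)) \<partial>\<pi>') \<le> ennreal T"
    proof (rule exists_coupling_le)
      show "rect_fun (\<lambda>z. enn2real (k j z))" for j
        unfolding k_def by (intro rect_fun_compose2[OF rect_K \<kappa>(1)])
      show "incseq (\<lambda>j. enn2real (k j z))" for z
        using k_inc[of z] k_fin[of _ z] by (auto simp: incseq_def intro!: enn2real_mono)
      fix j \<phi> \<psi> assume p: "\<phi> \<in> bounded_borel" "\<psi> \<in> bounded_borel" "\<And>x y. \<phi> x + \<psi> y \<le> enn2real (k j (x, y))"
      obtain s where s: "s < T" "dual_bound (F (L j) b) s" using b by blast
      have "ennreal (\<phi> x + \<psi> y) \<le> F (L j) b (x, y)" for x y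
      proof -
        have "ennreal (\<phi> x + \<psi> y) \<le> k j (x, y)" using ennreal_leI[OF p(3)[of x y]] by (simp add: k_real)
        also have "\<dots> \<le> F (L j) b (x, y)"
          unfolding k_def F_def using K_le[of j "(x, y)"] SUP_upper[of j UNIV "\<lambda>j. \<kappa> j (x, y)"]
          by (auto simp: C_def min_le_iff_disj)
        finally show ?thesis .
      qed
      then have "dual_value \<phi> \<psi> \<le> s" by (rule dual_boundD[OF s(2) p(1,2)])
      then show "dual_value \<phi> \<psi> \<le> T" using s(1) by simp
    qed simp
    then obtain \<pi>' where \<pi>': "\<pi>' \<in> couplings \<mu> \<nu>" "\<And>j. (\<integral>\<^sup>+z. k j z \<partial>\<pi>') \<le> ennreal T"
      unfolding k_real by blast
    have c_le_k: "c z \<le> (SUP j. k j z)" for z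
    proof -
      have "(\<lambda>j. k j z) \<longlonglongrightarrow> min (SUP j. K j z) (SUP j. \<kappa> j z)"
        unfolding k_def by (intro tendsto_min LIMSEQ_SUP K_inc \<kappa>(3))
      moreover have "(\<lambda>j. k j z) \<longlonglongrightarrow> (SUP j. k j z)" by (intro LIMSEQ_SUP k_inc)
      ultimately have "(SUP j. k j z) = min (SUP j. K j z) (SUP j. \<kappa> j z)" by (rule LIMSEQ_unique[rotated])
      then show ?thesis using c_le \<kappa>(4) by simp
    qed
    have km: "k j \<in> borel_measurable \<pi>'" for j
    proof -
      have "rect_fun (k j)" unfolding k_def by (intro rect_fun_compose2[OF rect_K \<kappa>(1)])
      then have "(\<lambda>z. id (k j z)) \<in> borel_measurable borel"
        by (intro measurable_compose[OF rect_fun_measurable]) simp_all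
      then show ?thesis using coupling_props(2)[OF \<pi>'(1)] by (simp cong: measurable_cong_sets)
    qed
    have "(\<integral>\<^sup>+z. c z \<partial>\<pi>') \<le> (\<integral>\<^sup>+z. (SUP j. k j z) \<partial>\<pi>')" by (intro nn_integral_mono c_le_k)
    also have "\<dots> = (SUP j. \<integral>\<^sup>+z. k j z \<partial>\<pi>')"
      using k_inc by (intro nn_integral_monotone_convergence_SUP km) (auto simp: incseq_def le_fun_def)
    also have "\<dots> \<le> ennreal T" by (intro SUP_least \<pi>'(2))
    finally show ?thesis using \<pi>'(1) by blast
  qed
  have t0: "0 \<le> t"
    using dual_boundD[OF bound bounded_borel_const[of 0] bounded_borel_const[of 0]] by simp
  show ?thesis
  proof (rule ennreal_le_epsilon)
    fix e :: real assume "0 < e"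
    then obtain \<pi>' where "\<pi>' \<in> couplings \<mu> \<nu>" "(\<integral>\<^sup>+z. c z \<partial>\<pi>') \<le> ennreal (t + e)" using main[of "t + e"] by auto
    then have "Pcost \<mu> \<nu> c \<le> ennreal (t + e)" unfolding Pcost_def by (intro INF_lower2)
    then show "Pcost \<mu> \<nu> c \<le> ennreal t + ennreal e" using t0 \<open>0 < e\<close> by simp
  qed
qed

end

section \<open>The relaxed transport problem\<close>

lemma ereal_int_upper_eq:
  assumes [measurable]: "q \<in> borel_measurable M"
    and fin: "AE x in M. \<bar>q x\<bar> \<noteq> \<infinity>" and int: "integrable M (\<lambda>x. real_of_ereal (q x))"
  shows "ereal_int_upper M q = ereal (\<integral>x. real_of_ereal (q x) \<partial>M)"
proof -
  have p: "(\<integral>\<^sup>+x. e2ennreal (q x) \<partial>M) = (\<integral>\<^sup>+x. ennreal (real_of_ereal (q x)) \<partial>M)"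
    using fin by (intro nn_integral_cong_AE) (auto simp: ennreal_def elim!: eventually_mono)
  have n: "(\<integral>\<^sup>+x. e2ennreal (- q x) \<partial>M) = (\<integral>\<^sup>+x. ennreal (- real_of_ereal (q x)) \<partial>M)"
    using fin by (intro nn_integral_cong_AE) (auto simp: ennreal_def elim!: eventually_mono)
  have fin: "(\<integral>\<^sup>+x. ennreal (real_of_ereal (q x)) \<partial>M) \<noteq> \<infinity>" "(\<integral>\<^sup>+x. ennreal (- real_of_ereal (q x)) \<partial>M) \<noteq> \<infinity>"
    using int by (auto simp: real_integrable_def)
  obtain a b where "(\<integral>\<^sup>+x. ennreal (real_of_ereal (q x)) \<partial>M) = ennreal a" "0 \<le> a"
    "(\<integral>\<^sup>+x. ennreal (- real_of_ereal (q x)) \<partial>M) = ennreal b" "0 \<le> b"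
    using fin by (metis ennreal_cases infinity_ennreal_def)
  then show ?thesis
    unfolding ereal_int_upper_def p n by (simp add: real_lebesgue_integral_def[OF int] enn2ereal_ennreal)
qed

lemma ereal_int_upper_finite:
  assumes [measurable]: "q \<in> borel_measurable M"
    and p: "(\<integral>\<^sup>+x. e2ennreal (q x) \<partial>M) \<noteq> \<infinity>" and n: "(\<integral>\<^sup>+x. e2ennreal (- q x) \<partial>M) \<noteq> \<infinity>"
  shows "AE x in M. \<bar>q x\<bar> \<noteq> \<infinity>" "integrable M (\<lambda>x. real_of_ereal (q x))"
proof -
  have "AE x in M. e2ennreal (q x) \<noteq> \<infinity>" by (intro nn_integral_PInf_AE p) measurable
  moreover have "AE x in M. e2ennreal (- q x) \<noteq> \<infinity>" by (intro nn_integral_PInf_AE n) measurable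
  ultimately show fin: "AE x in M. \<bar>q x\<bar> \<noteq> \<infinity>"
  proof eventually_elim
    case (elim x)
    then show ?case by (cases "q x") auto
  qed
  have "(\<integral>\<^sup>+x. e2ennreal (q x) \<partial>M) = (\<integral>\<^sup>+x. ennreal (real_of_ereal (q x)) \<partial>M)"
    using fin by (intro nn_integral_cong_AE) (auto simp: ennreal_def elim!: eventually_mono)
  moreover have "(\<integral>\<^sup>+x. e2ennreal (- q x) \<partial>M) = (\<integral>\<^sup>+x. ennreal (- real_of_ereal (q x)) \<partial>M)"
    using fin by (intro nn_integral_cong_AE) (auto simp: ennreal_def elim!: eventually_mono)
  ultimately show "integrable M (\<lambda>x. real_of_ereal (q x))"
    using p n by (simp add: real_integrable_def)
qed

lemma partial_plans_mono: "\<epsilon> \<le> \<epsilon>' \<Longrightarrow> partial_plans \<mu> \<nu> \<epsilon> \<subseteq> partial_plans \<mu> \<nu> \<epsilon>'"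
proof
  fix \<pi> assume "\<epsilon> \<le> \<epsilon>'" and \<pi>: "\<pi> \<in> partial_plans \<mu> \<nu> \<epsilon>"
  then have "ennreal (1 - \<epsilon>') \<le> ennreal (1 - \<epsilon>)" by (intro ennreal_leI) simp
  also have "\<dots> \<le> emeasure \<pi> UNIV" using \<pi> by (simp add: partial_plans_def)
  finally show "\<pi> \<in> partial_plans \<mu> \<nu> \<epsilon>'" using \<pi> by (simp add: partial_plans_def)
qed

lemma Peps_antimono: "\<epsilon> \<le> \<epsilon>' \<Longrightarrow> Peps \<mu> \<nu> c \<epsilon>' \<le> Peps \<mu> \<nu> c \<epsilon>"
  unfolding Peps_def by (intro INF_superset_mono partial_plans_mono) auto

text \<open>Shrinking \<epsilon> shrinks the set of competitors, so the limit is monotone. Values of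
  \<epsilon> above 1 only contribute smaller terms to the supremum.\<close>

lemma Prel_eq_SUP: "Prel \<mu> \<nu> c = (SUP \<epsilon>\<in>{0<..}. Peps \<mu> \<nu> c \<epsilon>)"
  unfolding Prel_def
proof (rule tendsto_Lim)
  show "(Peps \<mu> \<nu> c \<longlongrightarrow> (SUP \<epsilon>\<in>{0<..}. Peps \<mu> \<nu> c \<epsilon>)) (at_right 0)"
  proof (rule order_tendstoI)
    fix a assume "a < (SUP \<epsilon>\<in>{0<..}. Peps \<mu> \<nu> c \<epsilon>)"
    then obtain \<epsilon> where \<epsilon>: "0 < \<epsilon>" "a < Peps \<mu> \<nu> c \<epsilon>" by (auto simp: less_SUP_iff)
    show "\<forall>\<^sub>F x in at_right 0. a < Peps \<mu> \<nu> c x"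
      unfolding eventually_at_right_field
      by (intro exI[of _ \<epsilon>] conjI allI impI \<epsilon> less_le_trans[OF \<epsilon>(2) Peps_antimono]) simp
  next
    fix a assume a: "(SUP \<epsilon>\<in>{0<..}. Peps \<mu> \<nu> c \<epsilon>) < a"
    have "Peps \<mu> \<nu> c x < a" if "0 < x" for x
      by (rule le_less_trans[OF SUP_upper a]) (simp add: that)
    then show "\<forall>\<^sub>F x in at_right 0. Peps \<mu> \<nu> c x < a"
      unfolding eventually_at_right_field by (intro exI[of _ 1] conjI allI impI) simp_all
  qed
qed simp

context polish_marginals
begin

lemma couplings_subset_partial_plans: "0 \<le> \<epsilon> \<Longrightarrow> couplings \<mu> \<nu> \<subseteq> partial_plans \<mu> \<nu> \<epsilon>"
proof
  fix \<pi> assume "0 \<le> \<epsilon>" and \<pi>: "\<pi> \<in> couplings \<mu> \<nu>"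
  then interpret prob_space \<pi> by (auto dest: coupling_props)
  have "emeasure \<pi> UNIV = 1" using emeasure_space_1 coupling_props(3)[OF \<pi>] by simp
  then show "\<pi> \<in> partial_plans \<mu> \<nu> \<epsilon>"
    using \<pi> \<open>0 \<le> \<epsilon>\<close> unfolding couplings_def partial_plans_def by (auto simp: ennreal_le_1)
qed

lemma Prel_le_cost: "\<pi> \<in> couplings \<mu> \<nu> \<Longrightarrow> Prel \<mu> \<nu> c \<le> (\<integral>\<^sup>+z. c z \<partial>\<pi>)"
  unfolding Prel_eq_SUP Peps_def by (intro SUP_least INF_lower subsetD[OF couplings_subset_partial_plans]) auto

text \<open>\<open>B - \<phi> x\<close> is nonnegative, so its integral can only fall when \<mu> is
  replaced by the smaller first marginal of the partial plan. Solving for the integral of \<phi>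
  loses \<open>B\<close> times the missing mass, which is at most \<epsilon>; the second potential
  loses as much.\<close>

lemma integral_partial_plan_ge:
  assumes \<pi>: "\<pi> \<in> partial_plans \<mu> \<nu> \<epsilon>"
    and \<phi>: "\<phi> \<in> bounded_borel" "\<And>x. \<bar>\<phi> x\<bar> \<le> B" and \<psi>: "\<psi> \<in> bounded_borel" "\<And>y. \<bar>\<psi> y\<bar> \<le> B"
    and le: "\<And>x y. ennreal (\<phi> x + \<psi> y) \<le> c (x, y)"
  shows "ennreal (dual_value \<phi> \<psi> - 2 * B * \<epsilon>) \<le> (\<integral>\<^sup>+z. c z \<partial>\<pi>)"
proof -
  have s: "sets \<pi> = sets borel" using \<pi> by (simp add: partial_plans_def)
  have sp: "space \<pi> = UNIV" using sets_eq_imp_space_eq[OF s] by simp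
  have sb: "sets \<pi> = sets (borel \<Otimes>\<^sub>M borel)" unfolding borel_prod by (rule s)
  have f: "fst \<in> \<pi> \<rightarrow>\<^sub>M \<mu>" and g: "snd \<in> \<pi> \<rightarrow>\<^sub>M \<nu>"
    using measurable_fst measurable_snd measurable_cong_sets[OF sb sets_mu] measurable_cong_sets[OF sb sets_nu] by blast+
  have le1: "distr \<pi> \<mu> fst \<le> \<mu>"
  proof (subst le_measure)
    show "\<forall>A\<in>sets (distr \<pi> \<mu> fst). emeasure (distr \<pi> \<mu> fst) A \<le> emeasure \<mu> A"
    proof
      fix A assume "A \<in> sets (distr \<pi> \<mu> fst)"
      then have A: "A \<in> sets \<mu>" by simp
      have "emeasure (distr \<pi> \<mu> fst) A = emeasure \<pi> (A \<times> UNIV)"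
        using f A by (subst emeasure_distr) (auto intro!: arg_cong[where f = "emeasure \<pi>"] simp: sp)
      then show "emeasure (distr \<pi> \<mu> fst) A \<le> emeasure \<mu> A" using \<pi> A by (simp add: partial_plans_def sets_mu)
    qed
  qed simp
  have le2: "distr \<pi> \<nu> snd \<le> \<nu>"
  proof (subst le_measure)
    show "\<forall>A\<in>sets (distr \<pi> \<nu> snd). emeasure (distr \<pi> \<nu> snd) A \<le> emeasure \<nu> A"
    proof
      fix A assume "A \<in> sets (distr \<pi> \<nu> snd)"
      then have A: "A \<in> sets \<nu>" by simp
      have "emeasure (distr \<pi> \<nu> snd) A = emeasure \<pi> (UNIV \<times> A)"
        using g A by (subst emeasure_distr) (auto intro!: arg_cong[where f = "emeasure \<pi>"] simp: sp)
      then show "emeasure (distr \<pi> \<nu> snd) A \<le> emeasure \<nu> A" using \<pi> A by (simp add: partial_plans_def sets_nu)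
    qed
  qed simp
  have "\<forall>A\<in>sets borel. emeasure \<pi> (A \<times> UNIV) \<le> emeasure \<mu> A" using \<pi> by (simp add: partial_plans_def)
  then have "emeasure \<pi> (UNIV \<times> UNIV) \<le> emeasure \<mu> UNIV" by (rule bspec) simp
  then have "emeasure \<pi> (space \<pi>) \<le> 1" using M1.emeasure_space_1 by (simp add: sp space_mu)
  then interpret \<pi>: finite_measure \<pi> by (intro finite_measureI) (auto simp: top_unique)
  have mass: "1 - \<epsilon> \<le> measure \<pi> UNIV"
  proof -
    have "ennreal (1 - \<epsilon>) \<le> ennreal (measure \<pi> UNIV)"
      using \<pi> \<pi>.emeasure_eq_measure[of UNIV] by (simp add: partial_plans_def)
    then show ?thesis by (simp add: ennreal_le_iff)
  qed
  have B0: "0 \<le> B" using \<phi>(2)[of undefined] by linarith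
  note [measurable] = bounded_borel_measurable[OF \<phi>(1)] bounded_borel_measurable[OF \<psi>(1)]
  note bm = borel_measurable_integrable[OF integrable_mu[OF \<phi>(1)]] borel_measurable_integrable[OF integrable_nu[OF \<psi>(1)]]
  have m1: "(\<lambda>z. \<phi> (fst z)) \<in> borel_measurable \<pi>" by (rule measurable_compose[OF f bm(1)])
  have m2: "(\<lambda>z. \<psi> (snd z)) \<in> borel_measurable \<pi>" by (rule measurable_compose[OF g bm(2)])
  have i1: "integrable \<pi> (\<lambda>z. \<phi> (fst z))" using m1 \<phi>(2) by (intro \<pi>.integrable_const_bound[where B = B]) auto
  have i2: "integrable \<pi> (\<lambda>z. \<psi> (snd z))" using m2 \<psi>(2) by (intro \<pi>.integrable_const_bound[where B = B]) auto
  have b1: "0 \<le> B - \<phi> x" and b2: "0 \<le> B - \<psi> y" for x y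
    using \<phi>(2)[of x] \<psi>(2)[of y] by auto
  have "ennreal (\<integral>z. B - \<phi> (fst z) \<partial>\<pi>) = (\<integral>\<^sup>+z. ennreal (B - \<phi> (fst z)) \<partial>\<pi>)"
    using i1 b1 by (intro nn_integral_eq_integral[symmetric]) auto
  also have "\<dots> = (\<integral>\<^sup>+x. ennreal (B - \<phi> x) \<partial>distr \<pi> \<mu> fst)"
    using bm(1) by (intro nn_integral_distr[symmetric] f) measurable
  also have "\<dots> \<le> (\<integral>\<^sup>+x. ennreal (B - \<phi> x) \<partial>\<mu>)" by (intro nn_integral_mono_measure le1) simp
  also have "\<dots> = ennreal (\<integral>x. B - \<phi> x \<partial>\<mu>)"
    using integrable_mu[OF \<phi>(1)] b1 by (intro nn_integral_eq_integral) auto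
  finally have "(\<integral>z. B - \<phi> (fst z) \<partial>\<pi>) \<le> (\<integral>x. B - \<phi> x \<partial>\<mu>)"
    using b1 by (simp add: ennreal_le_iff integral_nonneg)
  then have e1: "B * measure \<pi> UNIV - B + (\<integral>x. \<phi> x \<partial>\<mu>) \<le> (\<integral>z. \<phi> (fst z) \<partial>\<pi>)"
    using i1 integrable_mu[OF \<phi>(1)] by (simp add: M1.prob_space sp mult.commute)
  have "ennreal (\<integral>z. B - \<psi> (snd z) \<partial>\<pi>) = (\<integral>\<^sup>+z. ennreal (B - \<psi> (snd z)) \<partial>\<pi>)"
    using i2 b2 by (intro nn_integral_eq_integral[symmetric]) auto
  also have "\<dots> = (\<integral>\<^sup>+x. ennreal (B - \<psi> x) \<partial>distr \<pi> \<nu> snd)"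
    using bm(2) by (intro nn_integral_distr[symmetric] g) measurable
  also have "\<dots> \<le> (\<integral>\<^sup>+x. ennreal (B - \<psi> x) \<partial>\<nu>)" by (intro nn_integral_mono_measure le2) simp
  also have "\<dots> = ennreal (\<integral>x. B - \<psi> x \<partial>\<nu>)"
    using integrable_nu[OF \<psi>(1)] b2 by (intro nn_integral_eq_integral) auto
  finally have "(\<integral>z. B - \<psi> (snd z) \<partial>\<pi>) \<le> (\<integral>x. B - \<psi> x \<partial>\<nu>)"
    using b2 by (simp add: ennreal_le_iff integral_nonneg)
  then have e2: "B * measure \<pi> UNIV - B + (\<integral>x. \<psi> x \<partial>\<nu>) \<le> (\<integral>z. \<psi> (snd z) \<partial>\<pi>)"
    using i2 integrable_nu[OF \<psi>(1)] by (simp add: M2.prob_space sp mult.commute)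
  have "B * (1 - \<epsilon>) \<le> B * measure \<pi> UNIV" using mass B0 by (rule mult_left_mono)
  then have "dual_value \<phi> \<psi> - 2 * B * \<epsilon> \<le> (\<integral>z. \<phi> (fst z) \<partial>\<pi>) + (\<integral>z. \<psi> (snd z) \<partial>\<pi>)"
    using e1 e2 by (simp add: algebra_simps)
  also have "\<dots> = (\<integral>z. \<phi> (fst z) + \<psi> (snd z) \<partial>\<pi>)" using i1 i2 by simp
  also have "\<dots> \<le> (\<integral>z. max 0 (\<phi> (fst z) + \<psi> (snd z)) \<partial>\<pi>)"
    using i1 i2 by (intro integral_mono) auto
  finally have "ennreal (dual_value \<phi> \<psi> - 2 * B * \<epsilon>) \<le>
      ennreal (\<integral>z. max 0 (\<phi> (fst z) + \<psi> (snd z)) \<partial>\<pi>)" by (rule ennreal_leI)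
  also have "\<dots> = (\<integral>\<^sup>+z. ennreal (max 0 (\<phi> (fst z) + \<psi> (snd z))) \<partial>\<pi>)"
    using i1 i2 by (intro nn_integral_eq_integral[symmetric]) auto
  also have "\<dots> \<le> (\<integral>\<^sup>+z. c z \<partial>\<pi>)"
    using le[of "fst z" "snd z" for z] by (intro nn_integral_mono) (auto simp: max_def ennreal_neg)
  finally show ?thesis .
qed

lemma dual_le_Prel:
  assumes \<phi>: "\<phi> \<in> bounded_borel" and \<psi>: "\<psi> \<in> bounded_borel" and le: "\<And>x y. ennreal (\<phi> x + \<psi> y) \<le> c (x, y)"
  shows "ennreal (dual_value \<phi> \<psi>) \<le> Prel \<mu> \<nu> c"
proof -
  obtain B1 B2 where B1: "\<And>x. \<bar>\<phi> x\<bar> \<le> B1" and B2: "\<And>y. \<bar>\<psi> y\<bar> \<le> B2"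
    using bounded_borelE[OF \<phi>] bounded_borelE[OF \<psi>] by metis
  define B where "B = max B1 B2"
  have B: "\<bar>\<phi> x\<bar> \<le> B" "\<bar>\<psi> y\<bar> \<le> B" for x y using B1[of x] B2[of y] by (auto simp: B_def)
  let ?I = "dual_value \<phi> \<psi>"
  have "ennreal (?I - 2 * B * inverse (real (Suc n))) \<le> Prel \<mu> \<nu> c" for n
  proof -
    have "ennreal (?I - 2 * B * inverse (real (Suc n))) \<le> Peps \<mu> \<nu> c (inverse (real (Suc n)))"
      unfolding Peps_def by (intro INF_greatest integral_partial_plan_ge \<phi> \<psi> B le)
    also have "\<dots> \<le> Prel \<mu> \<nu> c" unfolding Prel_eq_SUP by (rule SUP_upper) simp
    finally show ?thesis .
  qed
  moreover have "(\<lambda>n. ennreal (?I - 2 * B * inverse (real (Suc n)))) \<longlonglongrightarrow> ennreal (?I - 2 * B * 0)"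
    by (intro tendsto_ennrealI tendsto_diff tendsto_mult tendsto_const LIMSEQ_inverse_real_of_nat)
  ultimately show ?thesis by (intro LIMSEQ_le_const2) auto
qed

lemma dual_bound_of_Prel:
  assumes "Prel \<mu> \<nu> c \<le> ennreal r" "0 \<le> r" "\<And>z. f z \<le> c z"
  shows "dual_bound f r"
  unfolding dual_bound_def
proof (intro ballI impI)
  fix \<phi> \<psi> assume b: "\<phi> \<in> bounded_borel" "\<psi> \<in> bounded_borel" and le: "\<forall>x y. ennreal (\<phi> x + \<psi> y) \<le> f (x, y)"
  have "ennreal (\<phi> x + \<psi> y) \<le> c (x, y)" for x y
    by (rule order_trans[OF _ assms(3)[of "(x, y)"]]) (use le in blast)
  then have "ennreal (dual_value \<phi> \<psi>) \<le> Prel \<mu> \<nu> c" by (rule dual_le_Prel[OF b])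
  also note assms(1)
  finally show "dual_value \<phi> \<psi> \<le> r" using assms(2) by (simp add: ennreal_le_iff)
qed

lemma Pcost_min_le_Prel:
  assumes [measurable]: "c \<in> borel_measurable borel" "h \<in> borel_measurable borel"
    and plan: "finite_cost_plan \<mu> \<nu> c \<pi>" and fin: "AE z in \<mu> \<Otimes>\<^sub>M \<nu>. h z \<noteq> \<infinity>"
  shows "Pcost \<mu> \<nu> (\<lambda>z. min (c z) (h z)) \<le> Prel \<mu> \<nu> c"
proof -
  have \<pi>: "\<pi> \<in> couplings \<mu> \<nu>" and cpi: "(\<integral>\<^sup>+z. c z \<partial>\<pi>) < \<infinity>" using plan by (auto simp: finite_cost_plan_def)
  have "Prel \<mu> \<nu> c < \<infinity>" using Prel_le_cost[OF \<pi>, of c] cpi by (rule le_less_trans)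
  then obtain r where r: "Prel \<mu> \<nu> c = ennreal r" "0 \<le> r" by (auto simp: less_top_ennreal)
  show ?thesis unfolding r(1)
  proof (rule Pcost_le_of_dual_bound[OF _ _ \<pi>])
    show "AE z in \<mu> \<Otimes>\<^sub>M \<nu>. min (c z) (h z) \<noteq> \<infinity>" using fin
      by eventually_elim (metis infinity_ennreal_def less_top min_less_iff_disj)
    have "(\<integral>\<^sup>+z. min (c z) (h z) \<partial>\<pi>) \<le> (\<integral>\<^sup>+z. c z \<partial>\<pi>)" by (intro nn_integral_mono) simp
    then show "(\<integral>\<^sup>+z. min (c z) (h z) \<partial>\<pi>) < \<infinity>" using cpi by (rule le_less_trans)
    show "dual_bound (\<lambda>z. min (c z) (h z)) r" using r by (intro dual_bound_of_Prel[of c]) auto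
  qed measurable
qed

text \<open>Below the level \<open>m\<close> the truncated cost is \<open>c\<close> itself, because
  \<open>u\<close> is at least \<open>m\<close>; at or above it the truncated cost is at least
  \<open>m\<close>. Markov's inequality therefore bounds the mass removed by restricting to the
  lower part by \<open>L / m\<close>.\<close>

lemma Peps_le_of_truncation:
  assumes [measurable]: "c \<in> borel_measurable borel" "u \<in> borel_measurable borel"
    and \<pi>: "\<pi> \<in> couplings \<mu> \<nu>" and m: "0 < m" "\<And>z. ennreal m \<le> u z" and "0 \<le> L"
    and le: "(\<integral>\<^sup>+z. min (c z) (u z) \<partial>\<pi>) \<le> ennreal L"
  shows "Peps \<mu> \<nu> c (L / m) \<le> ennreal L"
proof -
  note cp = coupling_props[OF \<pi>]
  interpret \<pi>: prob_space \<pi> by (rule cp(1))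
  define S where "S = {z. c z < ennreal m}"
  have Sb: "S \<in> sets borel"
  proof -
    have "{z \<in> space borel. c z < ennreal m} \<in> sets borel" by measurable
    then show ?thesis by (simp add: S_def)
  qed
  have S: "S \<in> sets \<pi>" using Sb cp(2) by simp
  have mc: "c \<in> borel_measurable \<pi>" "u \<in> borel_measurable \<pi>" using cp(2) by (simp_all cong: measurable_cong_sets)
  define \<rho> where "\<rho> = density \<pi> (indicator S)"
  have em: "emeasure \<rho> A = emeasure \<pi> (S \<inter> A)" if "A \<in> sets borel" for A
  proof -
    have A: "A \<in> sets \<pi>" using that cp(2) by simp
    have "emeasure \<rho> A = (\<integral>\<^sup>+z. indicator S z * indicator A z \<partial>\<pi>)"
      unfolding \<rho>_def using S A by (intro emeasure_density) auto
    also have "\<dots> = (\<integral>\<^sup>+z. indicator (S \<inter> A) z \<partial>\<pi>)" by (simp add: indicator_inter_arith)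
    finally show ?thesis using S A by simp
  qed
  have mass: "ennreal (1 - L / m) \<le> emeasure \<pi> S"
  proof -
    have "ennreal m * emeasure \<pi> (space \<pi> - S) = (\<integral>\<^sup>+z. ennreal m * indicator (space \<pi> - S) z \<partial>\<pi>)"
      using S by (intro nn_integral_cmult_indicator[symmetric]) auto
    also have "\<dots> \<le> (\<integral>\<^sup>+z. min (c z) (u z) \<partial>\<pi>)"
      using m(2) by (intro nn_integral_mono) (auto simp: indicator_def S_def not_less)
    also note le
    finally have "ennreal (m * measure \<pi> (space \<pi> - S)) \<le> ennreal L"
      using m(1) by (simp add: \<pi>.emeasure_eq_measure ennreal_mult)
    then have "m * measure \<pi> (space \<pi> - S) \<le> L" using \<open>0 \<le> L\<close> by (simp add: ennreal_le_iff)
    then have "measure \<pi> (space \<pi> - S) \<le> L / m" using m(1) by (simp add: field_simps)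
    then have "1 - L / m \<le> measure \<pi> S" using \<pi>.prob_compl[OF S] by simp
    then show ?thesis by (simp add: \<pi>.emeasure_eq_measure ennreal_leI)
  qed
  have "\<rho> \<in> partial_plans \<mu> \<nu> (L / m)"
    unfolding partial_plans_def
  proof (intro CollectI conjI ballI)
    show "sets \<rho> = sets borel" by (simp add: \<rho>_def cp(2))
    show "ennreal (1 - L / m) \<le> emeasure \<rho> UNIV" using mass em[of UNIV] by simp
    show "emeasure \<rho> (A \<times> UNIV) \<le> emeasure \<mu> A" if "A \<in> sets borel" for A
    proof -
      have AU: "A \<times> UNIV \<in> sets (borel :: ('a \<times> 'b) measure)" using that by (intro borel_Times) auto
      then have "emeasure \<rho> (A \<times> UNIV) \<le> emeasure \<pi> (A \<times> UNIV)"
        unfolding em[OF AU] by (intro emeasure_mono) (auto simp: cp(2))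
      then show ?thesis using \<pi> that by (simp add: couplings_def)
    qed
    show "emeasure \<rho> (UNIV \<times> A) \<le> emeasure \<nu> A" if "A \<in> sets borel" for A
    proof -
      have AU: "UNIV \<times> A \<in> sets (borel :: ('a \<times> 'b) measure)" using that by (intro borel_Times) auto
      then have "emeasure \<rho> (UNIV \<times> A) \<le> emeasure \<pi> (UNIV \<times> A)"
        unfolding em[OF AU] by (intro emeasure_mono) (auto simp: cp(2))
      then show ?thesis using \<pi> that by (simp add: couplings_def)
    qed
  qed
  then have "Peps \<mu> \<nu> c (L / m) \<le> (\<integral>\<^sup>+z. c z \<partial>\<rho>)" unfolding Peps_def by (rule INF_lower)
  also have "\<dots> = (\<integral>\<^sup>+z. indicator S z * c z \<partial>\<pi>)"
    unfolding \<rho>_def using S mc by (intro nn_integral_density) auto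
  also have "\<dots> \<le> (\<integral>\<^sup>+z. min (c z) (u z) \<partial>\<pi>)"
    using m(2) by (intro nn_integral_mono) (auto simp: indicator_def S_def intro: order_trans less_imp_le)
  also note le
  finally show ?thesis .
qed

end

lemma le_enn2ereal_e2ennreal: "x \<le> enn2ereal (e2ennreal x)"
proof (cases "0 \<le> x")
  case False
  then show ?thesis using enn2ereal_nonneg[of "e2ennreal x"] by (auto intro: order_trans[of x 0])
qed (simp add: enn2ereal_e2ennreal)

section \<open>Convergence of truncated costs and attainment of the dual value\<close>

context polish_marginals
begin

lemma truncated_Pcost_tendsto:
  assumes c: "c \<in> borel_measurable borel" and plan: "finite_cost_plan \<mu> \<nu> c \<pi>"
    and h: "\<And>n. h n \<in> borel_measurable borel" and fin: "\<And>n. AE z in \<mu> \<Otimes>\<^sub>M \<nu>. h n z \<noteq> \<infinity>"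
    and inc: "\<And>n z. h n z \<le> h (Suc n) z"
    and unif: "\<And>m::real. m \<ge> 0 \<Longrightarrow> \<exists>N. \<forall>n\<ge>N. \<forall>z. ennreal m \<le> h n z"
  shows "incseq (\<lambda>n. Pcost \<mu> \<nu> (\<lambda>z. min (c z) (h n z)))"
    and "(\<lambda>n. Pcost \<mu> \<nu> (\<lambda>z. min (c z) (h n z))) \<longlonglongrightarrow> Prel \<mu> \<nu> c"
proof -
  define P where "P n = Pcost \<mu> \<nu> (\<lambda>z. min (c z) (h n z))" for n
  have incP: "incseq P"
    unfolding P_def Pcost_def
    by (intro incseq_SucI INF_mono' nn_integral_mono min.mono order_refl inc)
  then show "incseq (\<lambda>n. Pcost \<mu> \<nu> (\<lambda>z. min (c z) (h n z)))" unfolding P_def .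
  have \<pi>: "\<pi> \<in> couplings \<mu> \<nu>" and cpi: "(\<integral>\<^sup>+z. c z \<partial>\<pi>) < \<infinity>" using plan by (auto simp: finite_cost_plan_def)
  have upper: "P n \<le> Prel \<mu> \<nu> c" for n unfolding P_def by (rule Pcost_min_le_Prel[OF c h plan fin])
  have "(SUP n. P n) \<le> Prel \<mu> \<nu> c" by (intro SUP_least upper)
  also have "\<dots> < \<infinity>" using Prel_le_cost[OF \<pi>] cpi by (rule le_less_trans)
  finally obtain L where L: "(SUP n. P n) = ennreal L" "0 \<le> L" by (auto simp: less_top_ennreal)
  have lower: "Prel \<mu> \<nu> c \<le> (SUP n. P n)"
    unfolding L(1)
  proof (rule ennreal_le_epsilon)
    fix d :: real assume d: "0 < d"
    have "Peps \<mu> \<nu> c \<epsilon> \<le> ennreal (L + d)" if \<epsilon>: "0 < \<epsilon>" for \<epsilon>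
    proof -
      \<comment> \<open>Chosen so that the mass lost by cutting at level \<open>m\<close> a plan of
        cost at most \<open>L + d\<close> is bounded by the prescribed \<epsilon>.\<close>
      define m where "m = (L + d) / \<epsilon>"
      have m: "0 < m" "(L + d) / m = \<epsilon>" using \<epsilon> d L(2) by (auto simp: m_def)
      obtain N where N: "\<And>z. ennreal m \<le> h N z" using unif[of m] m(1) by auto
      have "P N \<le> ennreal L" unfolding L(1)[symmetric] by (rule SUP_upper) simp
      also have "\<dots> < ennreal (L + d)" using d L(2) by (simp add: ennreal_less_iff)
      finally obtain \<pi>' where "\<pi>' \<in> couplings \<mu> \<nu>" "(\<integral>\<^sup>+z. min (c z) (h N z) \<partial>\<pi>') < ennreal (L + d)"
        unfolding P_def Pcost_def by (auto simp: INF_less_iff)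
      then have "Peps \<mu> \<nu> c ((L + d) / m) \<le> ennreal (L + d)"
        using L(2) d by (intro Peps_le_of_truncation[OF c h[of N] _ m(1) N]) auto
      then show ?thesis by (simp add: m(2))
    qed
    then have "Prel \<mu> \<nu> c \<le> ennreal (L + d)" unfolding Prel_eq_SUP by (intro SUP_least) auto
    then show "Prel \<mu> \<nu> c \<le> ennreal L + ennreal d" using L(2) d by simp
  qed
  have "(\<lambda>n. P n) \<longlonglongrightarrow> (SUP n. P n)" by (rule LIMSEQ_SUP[OF incP])
  then show "(\<lambda>n. Pcost \<mu> \<nu> (\<lambda>z. min (c z) (h n z))) \<longlonglongrightarrow> Prel \<mu> \<nu> c"
    using antisym[OF lower SUP_least[OF upper]] by (simp add: P_def)
qed

text \<open>With only the sum integrable, the pair itself need not compete in the dual problem. Its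
  truncations do, being bounded, and their dual values converge to \<open>J\<close>; both upper
  bounds pass to the limit.\<close>

lemma integral_potentials_le:
  assumes \<pi>: "\<pi> \<in> couplings \<mu> \<nu>"
    and m: "\<phi> \<in> borel_measurable borel" "\<psi> \<in> borel_measurable borel" and adm: "admissible c \<phi> \<psi>"
    and fin: "AE z in \<pi>. \<bar>\<phi> (fst z) + \<psi> (snd z)\<bar> \<noteq> \<infinity>"
    and int: "integrable \<pi> (\<lambda>z. real_of_ereal (\<phi> (fst z) + \<psi> (snd z)))"
  defines "J \<equiv> \<integral>z. real_of_ereal (\<phi> (fst z) + \<psi> (snd z)) \<partial>\<pi>"
  shows "ereal J \<le> Dual \<mu> \<nu> c" and "ennreal J \<le> Prel \<mu> \<nu> c"
proof -
  note b = clip_bounded_borel[OF m(1)] clip_bounded_borel[OF m(2)]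
  define I where "I N = dual_value (\<lambda>x. clip N (\<phi> x)) (\<lambda>y. clip N (\<psi> y))" for N
  have I: "I \<longlonglongrightarrow> J"
    unfolding I_def J_def by (rule clip_integrals_tendsto[OF \<pi> m fin int])
  have le: "ennreal (clip N (\<phi> x) + clip N (\<psi> y)) \<le> c (x, y)" for N x y
    using adm by (intro clip_add_le) (auto simp: admissible_def)
  have "ennreal (I N) \<le> Prel \<mu> \<nu> c" for N unfolding I_def by (intro dual_le_Prel b le)
  then show "ennreal J \<le> Prel \<mu> \<nu> c" by (intro LIMSEQ_le_const2[OF tendsto_ennrealI[OF I]]) auto
  have "ereal (I N) \<le> Dual \<mu> \<nu> c" for N
  proof -
    let ?\<phi> = "\<lambda>x. ereal (clip N (\<phi> x))" and ?\<psi> = "\<lambda>y. ereal (clip N (\<psi> y))"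
    have bm: "(\<lambda>x. clip N (\<phi> x)) \<in> borel_measurable \<mu>" "(\<lambda>y. clip N (\<psi> y)) \<in> borel_measurable \<nu>"
      using integrable_mu[OF b(1)] integrable_nu[OF b(2)] by auto
    have "ereal_integrable \<mu> ?\<phi>" "ereal_integrable \<nu> ?\<psi>"
      using bm integrable_mu[OF b(1)] integrable_nu[OF b(2)] by (auto simp: ereal_integrable_def)
    moreover have "admissible c ?\<phi> ?\<psi>"
      unfolding admissible_def
    proof (intro conjI allI)
      fix x y
      have "ereal (clip N (\<phi> x) + clip N (\<psi> y)) \<le> enn2ereal (ennreal (clip N (\<phi> x) + clip N (\<psi> y)))"
        unfolding e2ennreal_ereal[symmetric] by (rule le_enn2ereal_e2ennreal)
      also have "\<dots> \<le> enn2ereal (c (x, y))" using le[of N x y] by (simp add: less_eq_ennreal.rep_eq)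
      finally show "?\<phi> x + ?\<psi> y \<le> enn2ereal (c (x, y))" by simp
    qed auto
    ultimately have "ereal_integral \<mu> ?\<phi> + ereal_integral \<nu> ?\<psi> \<le> Dual \<mu> \<nu> c"
      unfolding Dual_def by (intro SUP_upper2[of "(?\<phi>, ?\<psi>)"]) auto
    then show ?thesis by (simp add: ereal_integral_def I_def)
  qed
  then show "ereal J \<le> Dual \<mu> \<nu> c"
    using I by (intro LIMSEQ_le_const2[of "\<lambda>N. ereal (I N)" "ereal J"]) auto
qed

text \<open>Competitors in the dual problem are integrable but possibly unbounded, whereas the bound
  by the relaxed cost is direct for bounded ones only. A coupling merges the two marginal integrals
  into one integral of the sum, which is then reached by truncation.\<close>

lemma Dual_le_Prel:
  assumes \<pi>: "\<pi> \<in> couplings \<mu> \<nu>"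
  shows "Dual \<mu> \<nu> c \<le> enn2ereal (Prel \<mu> \<nu> c)"
  unfolding Dual_def
proof (rule SUP_least, clarify)
  fix \<phi> \<psi> assume \<phi>: "ereal_integrable \<mu> \<phi>" and \<psi>: "ereal_integrable \<nu> \<psi>" and adm: "admissible c \<phi> \<psi>"
  note cp = coupling_props[OF \<pi>]
  have m: "\<phi> \<in> borel_measurable borel" "\<psi> \<in> borel_measurable borel"
    using \<phi> \<psi> measurable_cong_sets[OF sets_mu refl] measurable_cong_sets[OF sets_nu refl]
    by (auto simp: ereal_integrable_def)
  have i1: "integrable \<pi> (\<lambda>z. real_of_ereal (\<phi> (fst z)))"
    using integrable_distr[OF cp(4), of "\<lambda>x. real_of_ereal (\<phi> x)"] \<phi> cp(6) by (simp add: ereal_integrable_def)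
  have i2: "integrable \<pi> (\<lambda>z. real_of_ereal (\<psi> (snd z)))"
    using integrable_distr[OF cp(5), of "\<lambda>y. real_of_ereal (\<psi> y)"] \<psi> cp(7) by (simp add: ereal_integrable_def)
  have I1: "(\<integral>z. real_of_ereal (\<phi> (fst z)) \<partial>\<pi>) = (\<integral>x. real_of_ereal (\<phi> x) \<partial>\<mu>)"
    using integral_distr[OF cp(4), of "\<lambda>x. real_of_ereal (\<phi> x)"] \<phi> cp(6)
    by (simp add: ereal_integrable_def borel_measurable_integrable)
  have I2: "(\<integral>z. real_of_ereal (\<psi> (snd z)) \<partial>\<pi>) = (\<integral>y. real_of_ereal (\<psi> y) \<partial>\<nu>)"
    using integral_distr[OF cp(5), of "\<lambda>y. real_of_ereal (\<psi> y)"] \<psi> cp(7)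
    by (simp add: ereal_integrable_def borel_measurable_integrable)
  have "AE z in \<pi>. \<bar>\<phi> (fst z)\<bar> \<noteq> \<infinity>" using \<phi> by (intro coupling_AE(1)[OF \<pi>]) (simp add: ereal_integrable_def)
  moreover have "AE z in \<pi>. \<bar>\<psi> (snd z)\<bar> \<noteq> \<infinity>" using \<psi> by (intro coupling_AE(2)[OF \<pi>]) (simp add: ereal_integrable_def)
  ultimately have ae: "AE z in \<pi>. \<bar>\<phi> (fst z) + \<psi> (snd z)\<bar> \<noteq> \<infinity> \<and>
      real_of_ereal (\<phi> (fst z)) + real_of_ereal (\<psi> (snd z)) = real_of_ereal (\<phi> (fst z) + \<psi> (snd z))"
  proof eventually_elim
    case (elim z)
    then show ?case by (cases "\<phi> (fst z)"; cases "\<psi> (snd z)") auto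
  qed
  have [measurable]: "fst \<in> \<pi> \<rightarrow>\<^sub>M borel" "snd \<in> \<pi> \<rightarrow>\<^sub>M borel"
    using cp(4,5) measurable_cong_sets[OF refl sets_mu] measurable_cong_sets[OF refl sets_nu] by blast+
  note [measurable] = m
  have qm: "(\<lambda>z. real_of_ereal (\<phi> (fst z) + \<psi> (snd z))) \<in> borel_measurable \<pi>" by measurable
  have ae2: "AE z in \<pi>. real_of_ereal (\<phi> (fst z)) + real_of_ereal (\<psi> (snd z)) = real_of_ereal (\<phi> (fst z) + \<psi> (snd z))"
    using ae by eventually_elim simp
  have qi: "integrable \<pi> (\<lambda>z. real_of_ereal (\<phi> (fst z) + \<psi> (snd z)))"
    by (rule integrable_cong_AE_imp[OF Bochner_Integration.integrable_add[OF i1 i2] qm]) (use ae2 in eventually_elim, simp)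
  define J where "J = (\<integral>z. real_of_ereal (\<phi> (fst z) + \<psi> (snd z)) \<partial>\<pi>)"
  have "J = (\<integral>z. real_of_ereal (\<phi> (fst z)) + real_of_ereal (\<psi> (snd z)) \<partial>\<pi>)"
    unfolding J_def using ae2 i1 i2 qm by (intro integral_cong_AE) (auto elim: eventually_mono)
  then have J: "J = dual_value (\<lambda>x. real_of_ereal (\<phi> x)) (\<lambda>y. real_of_ereal (\<psi> y))"
    using i1 i2 I1 I2 by simp
  have "ennreal J \<le> Prel \<mu> \<nu> c"
    unfolding J_def using ae by (intro integral_potentials_le(2)[OF \<pi> m adm _ qi]) (auto elim: eventually_mono)
  then have "enn2ereal (ennreal J) \<le> enn2ereal (Prel \<mu> \<nu> c)" by (simp add: less_eq_ennreal.rep_eq)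
  moreover have "ereal J \<le> enn2ereal (ennreal J)"
    unfolding e2ennreal_ereal[symmetric] by (rule le_enn2ereal_e2ennreal)
  ultimately show "ereal_integral \<mu> \<phi> + ereal_integral \<nu> \<psi> \<le> enn2ereal (Prel \<mu> \<nu> c)"
    unfolding ereal_integral_def by (simp add: J)
qed

text \<open>The positive part of \<phi> + \<psi> lies below \<open>c\<close> and is finite
  everywhere, so truncating \<open>c\<close> by it yields this function itself. Every coupling gives
  it an integral no smaller than the dual values of the truncated pair, whose limit is the relaxed
  cost.\<close>

lemma dual_attained_imp_truncation:
  assumes c: "c \<in> borel_measurable borel" and ex: "\<exists>\<pi>. finite_cost_plan \<mu> \<nu> c \<pi>"
    and m: "\<phi> \<in> borel_measurable borel" "\<psi> \<in> borel_measurable borel" and adm: "admissible c \<phi> \<psi>"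
    and att: "enn2ereal (Prel \<mu> \<nu> c) = Jc \<mu> \<nu> c \<phi> \<psi>"
  shows "\<exists>h. h \<in> borel_measurable borel \<and> (AE z in \<mu> \<Otimes>\<^sub>M \<nu>. h z \<noteq> \<infinity>) \<and>
    Prel \<mu> \<nu> c = Pcost \<mu> \<nu> (\<lambda>z. min (c z) (h z))"
proof -
  define \<pi> where "\<pi> = (SOME \<pi>. finite_cost_plan \<mu> \<nu> c \<pi>)"
  have plan: "finite_cost_plan \<mu> \<nu> c \<pi>" unfolding \<pi>_def by (rule someI_ex[OF ex])
  then have \<pi>: "\<pi> \<in> couplings \<mu> \<nu>" and cpi: "(\<integral>\<^sup>+z. c z \<partial>\<pi>) < \<infinity>" by (auto simp: finite_cost_plan_def)
  note cp = coupling_props[OF \<pi>]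
  have less: "\<phi> x < \<infinity>" "\<psi> y < \<infinity>" and le: "\<phi> x + \<psi> y \<le> enn2ereal (c (x, y))" for x y
    using adm by (auto simp: admissible_def)
  have [measurable]: "fst \<in> borel_measurable (borel :: ('a \<times> 'b) measure)" "snd \<in> borel_measurable (borel :: ('a \<times> 'b) measure)"
    unfolding borel_prod[symmetric] by measurable
  note [measurable] = m
  define q where "q z = \<phi> (fst z) + \<psi> (snd z)" for z
  have qb: "q \<in> borel_measurable borel" unfolding q_def by measurable
  then have qm[measurable]: "q \<in> borel_measurable \<pi>" using cp(2) by (simp cong: measurable_cong_sets)
  have q_fin: "q z < \<infinity>" for z
    unfolding q_def using less(1)[of "fst z"] less(2)[of "snd z"] by (cases "\<phi> (fst z)"; cases "\<psi> (snd z)") auto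
  have qc: "e2ennreal (q z) \<le> c z" for z
  proof -
    have "e2ennreal (q z) \<le> e2ennreal (enn2ereal (c (fst z, snd z)))"
      unfolding q_def by (intro e2ennreal_mono le)
    then show ?thesis by simp
  qed
  have J: "enn2ereal (Prel \<mu> \<nu> c) = ereal_int_upper \<pi> q"
    using att unfolding Jc_def \<pi>_def[symmetric] q_def by (simp add: case_prod_unfold)
  have "(\<integral>\<^sup>+z. e2ennreal (q z) \<partial>\<pi>) \<le> (\<integral>\<^sup>+z. c z \<partial>\<pi>)" by (intro nn_integral_mono qc)
  then have p: "(\<integral>\<^sup>+z. e2ennreal (q z) \<partial>\<pi>) < \<infinity>" using cpi by (rule le_less_trans)
  \<comment> \<open>Attainment makes the sum integrable: an infinite negative part would give the
    value -\<infinity>, while the relaxed cost is nonnegative.\<close>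
  have n: "(\<integral>\<^sup>+z. e2ennreal (- q z) \<partial>\<pi>) \<noteq> \<infinity>"
  proof
    assume inf: "(\<integral>\<^sup>+z. e2ennreal (- q z) \<partial>\<pi>) = \<infinity>"
    obtain a where "(\<integral>\<^sup>+z. e2ennreal (q z) \<partial>\<pi>) = ennreal a" "0 \<le> a" using p by (auto simp: less_top_ennreal)
    then have "enn2ereal (Prel \<mu> \<nu> c) = ereal a - \<infinity>"
      unfolding J ereal_int_upper_def inf by (simp add: enn2ereal_ennreal top_ereal_def)
    then have "enn2ereal (Prel \<mu> \<nu> c) = -\<infinity>" by simp
    then show False using enn2ereal_nonneg[of "Prel \<mu> \<nu> c"] by simp
  qed
  note fin = ereal_int_upper_finite[OF qm less_imp_neq[OF p] n]
  define j where "j = (\<integral>z. real_of_ereal (q z) \<partial>\<pi>)"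
  have Pj: "enn2ereal (Prel \<mu> \<nu> c) = ereal j"
    unfolding J j_def by (rule ereal_int_upper_eq[OF qm fin])
  then have "e2ennreal (enn2ereal (Prel \<mu> \<nu> c)) = e2ennreal (ereal j)" by (rule arg_cong)
  then have Pj': "Prel \<mu> \<nu> c = ennreal j" by simp
  define h where "h z = e2ennreal (q z)" for z
  have hm: "h \<in> borel_measurable borel" unfolding h_def using qb by measurable
  have h_fin: "h z \<noteq> \<infinity>" for z
    using q_fin[of z] by (cases "q z") (auto simp: h_def e2ennreal_neg)
  have minh: "(\<lambda>z. min (c z) (h z)) = h" using qc by (auto simp: h_def fun_eq_iff min_absorb2)
  have "Prel \<mu> \<nu> c \<le> (\<integral>\<^sup>+z. h z \<partial>\<pi>')" if \<pi>': "\<pi>' \<in> couplings \<mu> \<nu>" for \<pi>'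
  proof -
    note b = clip_bounded_borel[OF m(1)] clip_bounded_borel[OF m(2)]
    have "ennreal (dual_value (\<lambda>x. clip N (\<phi> x)) (\<lambda>y. clip N (\<psi> y))) \<le> (\<integral>\<^sup>+z. h z \<partial>\<pi>')" for N
    proof -
      have "ennreal (clip N (\<phi> x) + clip N (\<psi> y)) \<le> h (x, y)" for x y
        using le_enn2ereal_e2ennreal[of "q (x, y)"] by (intro clip_add_le less) (simp add: h_def q_def)
      \<comment> \<open>The relaxed problem with cost \<open>h\<close> is only an intermediary: full
        couplings compete in it, so each of them costs at least the dual value.\<close>
      then have "ennreal (dual_value (\<lambda>x. clip N (\<phi> x)) (\<lambda>y. clip N (\<psi> y))) \<le> Prel \<mu> \<nu> h"
        by (intro dual_le_Prel b)
      also have "\<dots> \<le> (\<integral>\<^sup>+z. h z \<partial>\<pi>')" by (rule Prel_le_cost[OF \<pi>'])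
      finally show ?thesis .
    qed
    moreover have "(\<lambda>N. dual_value (\<lambda>x. clip N (\<phi> x)) (\<lambda>y. clip N (\<psi> y))) \<longlonglongrightarrow> j"
      unfolding j_def q_def using clip_integrals_tendsto[OF \<pi> m] fin by (simp add: q_def)
    ultimately have "ennreal j \<le> (\<integral>\<^sup>+z. h z \<partial>\<pi>')"
      by (intro LIMSEQ_le_const2[OF tendsto_ennrealI]) auto
    then show ?thesis by (simp add: Pj')
  qed
  then have "Prel \<mu> \<nu> c \<le> Pcost \<mu> \<nu> h" unfolding Pcost_def by (intro INF_greatest)
  moreover have "Pcost \<mu> \<nu> (\<lambda>z. min (c z) (h z)) \<le> Prel \<mu> \<nu> c"
    by (rule Pcost_min_le_Prel[OF c hm plan AE_I2[OF h_fin]])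
  ultimately show ?thesis using hm h_fin by (intro exI[of _ h]) (auto simp: minh)
qed

text \<open>Since the truncated cost is finite almost everywhere on the product, its near-optimal
  bounded potentials come arbitrarily close to its transport cost, which is the relaxed cost by
  hypothesis. Compactness along the constant sequence gives a limit pair of at least this value, and
  both the dual value and the relaxed cost of \<open>c\<close> close the chain.\<close>

lemma truncation_imp_dual_attained:
  assumes c: "c \<in> borel_measurable borel" and ex: "\<exists>\<pi>. finite_cost_plan \<mu> \<nu> c \<pi>"
    and h: "h \<in> borel_measurable borel" "AE z in \<mu> \<Otimes>\<^sub>M \<nu>. h z \<noteq> \<infinity>"
    and eq: "Prel \<mu> \<nu> c = Pcost \<mu> \<nu> (\<lambda>z. min (c z) (h z))"
  shows "\<exists>\<phi> \<psi>. \<phi> \<in> borel_measurable borel \<and> \<psi> \<in> borel_measurable borel \<and> admissible c \<phi> \<psi> \<and>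
    enn2ereal (Prel \<mu> \<nu> c) = Dual \<mu> \<nu> c \<and> Dual \<mu> \<nu> c = Jc \<mu> \<nu> c \<phi> \<psi>"
proof -
  \<comment> \<open>The plan selected in the definition of \<open>Jc\<close>, so that finiteness and
    integrability of the limit pair are obtained under the very measure that evaluates it.\<close>
  define \<pi> where "\<pi> = (SOME \<pi>. finite_cost_plan \<mu> \<nu> c \<pi>)"
  have plan: "finite_cost_plan \<mu> \<nu> c \<pi>" unfolding \<pi>_def by (rule someI_ex[OF ex])
  then have \<pi>: "\<pi> \<in> couplings \<mu> \<nu>" and cpi: "(\<integral>\<^sup>+z. c z \<partial>\<pi>) < \<infinity>" by (auto simp: finite_cost_plan_def)
  note cp = coupling_props[OF \<pi>]
  define c' where "c' z = min (c z) (h z)" for z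
  have c'm: "c' \<in> borel_measurable borel" unfolding c'_def using c h(1) by measurable
  have c'fin: "AE z in \<mu> \<Otimes>\<^sub>M \<nu>. c' z \<noteq> \<infinity>"
    unfolding c'_def using h(2) by eventually_elim (metis infinity_ennreal_def less_top min_less_iff_disj)
  have "(\<integral>\<^sup>+z. c' z \<partial>\<pi>) \<le> (\<integral>\<^sup>+z. c z \<partial>\<pi>)" unfolding c'_def by (intro nn_integral_mono) simp
  then have c'pi: "(\<integral>\<^sup>+z. c' z \<partial>\<pi>) < \<infinity>" using cpi by (rule le_less_trans)
  have "Prel \<mu> \<nu> c < \<infinity>" using Prel_le_cost[OF \<pi>] cpi by (rule le_less_trans)
  then obtain r where r: "Prel \<mu> \<nu> c = ennreal r" "0 \<le> r" by (auto simp: less_top_ennreal)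
  have "\<exists>\<phi> \<psi>. \<phi> \<in> bounded_borel \<and> \<psi> \<in> bounded_borel \<and> (\<forall>x y. ennreal (\<phi> x + \<psi> y) \<le> c' (x, y)) \<and>
      r - inverse (real (Suc n)) \<le> dual_value \<phi> \<psi>" for n
  proof (rule ccontr)
    assume none: "\<not> ?thesis"
    let ?s = "r - inverse (real (Suc n))"
    have b: "dual_bound c' ?s" unfolding dual_bound_def using none by (meson less_imp_le not_le)
    \<comment> \<open>\<open>ennreal\<close> would collapse a negative bound to 0; the zero
      potentials exclude that case before the comparison returns to the reals.\<close>
    have "0 \<le> ?s" using dual_boundD[OF b bounded_borel_const[of 0] bounded_borel_const[of 0]] by simp
    moreover have "ennreal r \<le> ennreal ?s"
      using Pcost_le_of_dual_bound[OF c'm c'fin \<pi> c'pi b] eq unfolding r(1) c'_def[abs_def] by simp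
    ultimately have "r \<le> ?s" by (simp only: ennreal_le_iff)
    then show False by simp
  qed
  then obtain \<Phi> \<Psi> where P: "\<And>n. \<Phi> n \<in> bounded_borel" "\<And>n. \<Psi> n \<in> bounded_borel"
    "\<And>n x y. ennreal (\<Phi> n x + \<Psi> n y) \<le> c' (x, y)"
    "\<And>n. r - inverse (real (Suc n)) \<le> dual_value (\<Phi> n) (\<Psi> n)"
    by metis
  have tinc: "incseq (\<lambda>n. r - inverse (real (Suc n)))"
    by (intro incseq_SucI diff_left_mono le_imp_inverse_le) auto
  have dec: "decseq (\<lambda>n::nat. c' z)" for z by (simp add: decseq_def)
  obtain \<phi> :: "'a \<Rightarrow> ereal" and \<psi> :: "'b \<Rightarrow> ereal" where lim:
    "\<phi> \<in> borel_measurable borel" "\<psi> \<in> borel_measurable borel" "\<And>x. \<phi> x < \<infinity>" "\<And>y. \<psi> y < \<infinity>"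
    "\<And>n::nat. \<And>x y. \<phi> x + \<psi> y \<le> enn2ereal (c' (x, y))"
    "AE z in \<pi>. \<bar>\<phi> (fst z) + \<psi> (snd z)\<bar> \<noteq> \<infinity>"
    "integrable \<pi> (\<lambda>z. real_of_ereal (\<phi> (fst z) + \<psi> (snd z)))"
    "\<And>n. r - inverse (real (Suc n)) \<le> (\<integral>z. real_of_ereal (\<phi> (fst z) + \<psi> (snd z)) \<partial>\<pi>)"
    by (rule exists_limit_potentials[OF \<pi> c'm c'fin c'pi dec order_refl P(1-3) tinc P(4)]) blast
  define J where "J = (\<integral>z. real_of_ereal (\<phi> (fst z) + \<psi> (snd z)) \<partial>\<pi>)"
  have adm: "admissible c \<phi> \<psi>"
    unfolding admissible_def
  proof (intro conjI allI lim)
    fix x y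
    have "enn2ereal (c' (x, y)) \<le> enn2ereal (c (x, y))"
      unfolding less_eq_ennreal.rep_eq[symmetric] by (simp add: c'_def)
    then show "\<phi> x + \<psi> y \<le> enn2ereal (c (x, y))" by (rule order_trans[OF lim(5)])
  qed
  have "(\<lambda>n. r - inverse (real (Suc n))) \<longlonglongrightarrow> r - 0"
    by (intro tendsto_diff tendsto_const LIMSEQ_inverse_real_of_nat)
  then have rJ: "r \<le> J" using lim(8) unfolding J_def by (intro LIMSEQ_le_const2) auto
  note pot = integral_potentials_le[OF \<pi> lim(1,2) adm lim(6,7), folded J_def]
  have "J \<le> r" using pot(2) r by (simp add: ennreal_le_iff)
  with rJ have Jr: "J = r" by simp
  have Pr: "enn2ereal (Prel \<mu> \<nu> c) = ereal r" using r by (simp add: enn2ereal_ennreal)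
  have D: "Dual \<mu> \<nu> c = ereal r"
    using pot(1) Dual_le_Prel[OF \<pi>, of c] unfolding Pr Jr by (rule antisym[rotated])
  have "fst \<in> \<pi> \<rightarrow>\<^sub>M borel" "snd \<in> \<pi> \<rightarrow>\<^sub>M borel"
    using cp(4,5) measurable_cong_sets[OF refl sets_mu] measurable_cong_sets[OF refl sets_nu] by blast+
  then have qm: "(\<lambda>z. \<phi> (fst z) + \<psi> (snd z)) \<in> borel_measurable \<pi>"
    using lim(1,2) by measurable
  have "Jc \<mu> \<nu> c \<phi> \<psi> = ereal J"
    unfolding Jc_def \<pi>_def[symmetric] J_def case_prod_unfold
    by (rule ereal_int_upper_eq[OF qm lim(6,7)])
  then show ?thesis using lim(1,2) adm Pr D Jr by (intro exI[of _ \<phi>] exI[of _ \<psi>]) simp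
qed

end

theorem theorem3p5:
  fixes \<mu> :: "'a::polish_space measure" and \<nu> :: "'b::polish_space measure"
    and c :: "'a \<times> 'b \<Rightarrow> ennreal"
  assumes "prob_space \<mu>" and "sets \<mu> = sets borel"
    and "prob_space \<nu>" and "sets \<nu> = sets borel"
    and "c \<in> borel_measurable borel"
    and "\<exists>\<pi>. finite_cost_plan \<mu> \<nu> c \<pi>"
  shows
    "(\<forall>h :: nat \<Rightarrow> 'a \<times> 'b \<Rightarrow> ennreal.
        (\<forall>n. h n \<in> borel_measurable borel) \<and>
        (\<forall>n. AE z in \<mu> \<Otimes>\<^sub>M \<nu>. h n z \<noteq> \<infinity>) \<and>
        (\<forall>n z. h n z \<le> h (Suc n) z) \<and>
        (\<forall>m::real. m \<ge> 0 \<longrightarrow> (\<exists>N. \<forall>n\<ge>N. \<forall>z. ennreal m \<le> h n z))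
      \<longrightarrow> incseq (\<lambda>n. Pcost \<mu> \<nu> (\<lambda>z. min (c z) (h n z))) \<and>
          (\<lambda>n. Pcost \<mu> \<nu> (\<lambda>z. min (c z) (h n z))) \<longlonglongrightarrow> Prel \<mu> \<nu> c)
    \<and>
    ((\<exists>(\<phi> :: 'a \<Rightarrow> ereal) (\<psi> :: 'b \<Rightarrow> ereal).
        \<phi> \<in> borel_measurable borel \<and> \<psi> \<in> borel_measurable borel \<and> admissible c \<phi> \<psi> \<and>
        enn2ereal (Prel \<mu> \<nu> c) = Dual \<mu> \<nu> c \<and> Dual \<mu> \<nu> c = Jc \<mu> \<nu> c \<phi> \<psi>)
     \<longleftrightarrow>
     (\<exists>h :: 'a \<times> 'b \<Rightarrow> ennreal. h \<in> borel_measurable borel \<and>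
        (AE z in \<mu> \<Otimes>\<^sub>M \<nu>. h z \<noteq> \<infinity>) \<and>
        Prel \<mu> \<nu> c = Pcost \<mu> \<nu> (\<lambda>z. min (c z) (h z))))"
proof -
  interpret \<mu>: prob_space \<mu> by fact
  interpret \<nu>: prob_space \<nu> by fact
  interpret polish_marginals \<mu> \<nu> by unfold_locales (fact assms)+
  obtain \<pi> where plan: "finite_cost_plan \<mu> \<nu> c \<pi>" using assms(6) by blast
  show ?thesis
  proof (intro conjI allI impI iffI)
    fix h :: "nat \<Rightarrow> 'a \<times> 'b \<Rightarrow> ennreal"
    assume h: "(\<forall>n. h n \<in> borel_measurable borel) \<and> (\<forall>n. AE z in \<mu> \<Otimes>\<^sub>M \<nu>. h n z \<noteq> \<infinity>) \<and>
        (\<forall>n z. h n z \<le> h (Suc n) z) \<and> (\<forall>m::real. m \<ge> 0 \<longrightarrow> (\<exists>N. \<forall>n\<ge>N. \<forall>z. ennreal m \<le> h n z))"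
    show "incseq (\<lambda>n. Pcost \<mu> \<nu> (\<lambda>z. min (c z) (h n z)))"
      "(\<lambda>n. Pcost \<mu> \<nu> (\<lambda>z. min (c z) (h n z))) \<longlonglongrightarrow> Prel \<mu> \<nu> c"
      by (rule truncated_Pcost_tendsto[OF assms(5) plan]; use h in blast)+
  next
    assume "\<exists>(\<phi> :: 'a \<Rightarrow> ereal) (\<psi> :: 'b \<Rightarrow> ereal).
        \<phi> \<in> borel_measurable borel \<and> \<psi> \<in> borel_measurable borel \<and> admissible c \<phi> \<psi> \<and>
        enn2ereal (Prel \<mu> \<nu> c) = Dual \<mu> \<nu> c \<and> Dual \<mu> \<nu> c = Jc \<mu> \<nu> c \<phi> \<psi>"
    then obtain \<phi> :: "'a \<Rightarrow> ereal" and \<psi> :: "'b \<Rightarrow> ereal" where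
      "\<phi> \<in> borel_measurable borel" "\<psi> \<in> borel_measurable borel" "admissible c \<phi> \<psi>"
      "enn2ereal (Prel \<mu> \<nu> c) = Jc \<mu> \<nu> c \<phi> \<psi>" by auto
    then show "\<exists>h. h \<in> borel_measurable borel \<and> (AE z in \<mu> \<Otimes>\<^sub>M \<nu>. h z \<noteq> \<infinity>) \<and>
        Prel \<mu> \<nu> c = Pcost \<mu> \<nu> (\<lambda>z. min (c z) (h z))"
      by (rule dual_attained_imp_truncation[OF assms(5,6)])
  next
    assume "\<exists>h. h \<in> borel_measurable borel \<and> (AE z in \<mu> \<Otimes>\<^sub>M \<nu>. h z \<noteq> \<infinity>) \<and>
        Prel \<mu> \<nu> c = Pcost \<mu> \<nu> (\<lambda>z. min (c z) (h z))"
    then obtain h where "h \<in> borel_measurable borel" "AE z in \<mu> \<Otimes>\<^sub>M \<nu>. h z \<noteq> \<infinity>"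
      "Prel \<mu> \<nu> c = Pcost \<mu> \<nu> (\<lambda>z. min (c z) (h z))" by blast
    then show "\<exists>(\<phi> :: 'a \<Rightarrow> ereal) (\<psi> :: 'b \<Rightarrow> ereal).
        \<phi> \<in> borel_measurable borel \<and> \<psi> \<in> borel_measurable borel \<and> admissible c \<phi> \<psi> \<and>
        enn2ereal (Prel \<mu> \<nu> c) = Dual \<mu> \<nu> c \<and> Dual \<mu> \<nu> c = Jc \<mu> \<nu> c \<phi> \<psi>"
      by (rule truncation_imp_dual_attained[OF assms(5,6)])
  qed
qed

end
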